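(* Let $K=\mathbb{R}$ or $K=\mathbb{C}$ and let $M$ be a finitely generated commutative binoid. There is a homotopy equivalence $$K\mathrm{Spec}(M)\simeq\coprod_{\mathfrak r\in \mathrm{Adm}(M)} K\mathrm{Spec}\big(M(\mathfrak r)^{\times\circ}\big),$$ which is compatible with the decomposition $K\mathrm{Spec}(M)=\coprod_{\mathfrak r\in \mathrm{Adm}(M)}K\mathrm{Spec}(M(\mathfrak r))$ and which is induced on each summand by the map $j_{\mathfrak r}^*:K\mathrm{Spec}(M(\mathfrak r)^{\times\circ})\to K\mathrm{Spec}(M(\mathfrak r))$.
   Context: A (commutative) binoid is a set $M$ with a commutative associative multiplication, an identity $1$ and an absorbing element $0$ ($0m=0$ for all $m$). Homomorphisms preserve products, $1$ and $0$. An ideal of $M$ is a subset $I$ with $0\in I$ and $IM\subseteq I$; an ideal $\mathfrak p\ne M$ is prime if $xy\in\mathfrak p$ implies $x\in\mathfrak p$ or $y\in\mathfrak p$. $K\mathrm{Spec}(M)=\mathrm{Hom}(M,K)$ is the set of binoid homomorphisms from $M$ to the multiplicative binoid of $K$. If $e_1,\dots,e_n$ generate $M$, then $f\mapsto(f(e_1),\dots,f(e_n))$ embeds $K\mathrm{Spec}(M)$ in $K^n$, and it carries the (Euclidean) subspace topology, which is independent of the chosen generators. A binoid homomorphism $f:M\to N$ induces $f^*:K\mathrm{Spec}(N)\to K\mathrm{Spec}(M)$ by precomposition. $\mathrm{Idem}(M)$ is the binoid of idempotents of $M$, and $\mathrm{Adm}(M)$ is the set of prime ideals of $\mathrm{Idem}(M)$.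 For $\mathfrak r\in\mathrm{Adm}(M)$ put $\mathfrak r^{c}=\mathrm{Idem}(M)\setminus\mathfrak r$, and let $M(\mathfrak r)$ be the quotient of $M$ by the smallest congruence identifying all elements of $\mathfrak r M$ with $0$ and all elements of $\mathfrak r^c$ with $1$. The decomposition $K\mathrm{Spec}(M)=\coprod_{\mathfrak r}K\mathrm{Spec}(M(\mathfrak r))$ is given by precomposition with the canonical maps $M\to M(\mathfrak r)$. For a binoid $N$, $N^{\times\circ}$ denotes the binoid consisting of all invertible elements of $N$ together with $0$, and $j:N\to N^{\times\circ}$ is the homomorphism with $j(m)=m$ if $m\in N^{\times\circ}$ and $j(m)=0$ otherwise; $j_{\mathfrak r}$ is this map for $N=M(\mathfrak r)$. *)

theory Defs
  imports "HOL-Analysis.Analysis" "HOL-Algebra.Coset"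
begin

section \<open>Commutative binoids\<close>

record 'a binoid = "'a monoid" +
  bzero :: 'a

text \<open>The binoid with \<open>0 = 1\<close> is allowed.\<close>

locale comm_binoid = comm_monoid M for M :: "'a binoid" (structure) +
  assumes bzero_closed [simp, intro]: "bzero M \<in> carrier M"
    and bzero_mult [simp]: "m \<in> carrier M \<Longrightarrow> bzero M \<otimes> m = bzero M"
begin

lemma mult_bzero [simp]: "m \<in> carrier M \<Longrightarrow> m \<otimes> bzero M = bzero M"
  using m_comm[of m "bzero M"] by simp

end

definition binoid_hom :: "'a binoid \<Rightarrow> 'b binoid \<Rightarrow> ('a \<Rightarrow> 'b) set" where
  "binoid_hom M N =
     {f \<in> hom M N. f \<one>\<^bsub>M\<^esub> = \<one>\<^bsub>N\<^esub> \<and> f (bzero M) = bzero N}"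

inductive_set binoid_generate :: "'a binoid \<Rightarrow> 'a set \<Rightarrow> 'a set"
  for M (structure) and S where
  one: "\<one> \<in> binoid_generate M S"
| bzero: "bzero M \<in> binoid_generate M S"
| incl: "s \<in> S \<Longrightarrow> s \<in> binoid_generate M S"
| mult: "x \<in> binoid_generate M S \<Longrightarrow> y \<in> binoid_generate M S \<Longrightarrow>
    x \<otimes> y \<in> binoid_generate M S"

definition binoid_generators :: "'a binoid \<Rightarrow> 'a list \<Rightarrow> bool" where
  "binoid_generators M es \<longleftrightarrow>
     set es \<subseteq> carrier M \<and> binoid_generate M (set es) = carrier M"

definition fg_binoid :: "'a binoid \<Rightarrow> bool" where
  "fg_binoid M \<longleftrightarrow> (\<exists>es. binoid_generators M es)"

definition binoid_ideal :: "'a binoid \<Rightarrow> 'a set \<Rightarrow> bool" where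
  "binoid_ideal M I \<longleftrightarrow>
     I \<subseteq> carrier M \<and> bzero M \<in> I \<and> I <#>\<^bsub>M\<^esub> carrier M \<subseteq> I"

definition binoid_prime :: "'a binoid \<Rightarrow> 'a set \<Rightarrow> bool" where
  "binoid_prime M P \<longleftrightarrow> binoid_ideal M P \<and> P \<noteq> carrier M \<and>
     (\<forall>x\<in>carrier M. \<forall>y\<in>carrier M. x \<otimes>\<^bsub>M\<^esub> y \<in> P \<longrightarrow> x \<in> P \<or> y \<in> P)"

definition idem_binoid :: "'a binoid \<Rightarrow> 'a binoid" where
  "idem_binoid M = M\<lparr>carrier := {e \<in> carrier M. e \<otimes>\<^bsub>M\<^esub> e = e}\<rparr>"

definition Adm :: "'a binoid \<Rightarrow> 'a set set" where
  "Adm M = {r. binoid_prime (idem_binoid M) r}"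


section \<open>Quotients\<close>

definition binoid_congruence :: "'a binoid \<Rightarrow> ('a \<times> 'a) set \<Rightarrow> bool" where
  "binoid_congruence M R \<longleftrightarrow> equiv (carrier M) R \<and>
     (\<forall>a b c d. (a, b) \<in> R \<longrightarrow> (c, d) \<in> R \<longrightarrow> (a \<otimes>\<^bsub>M\<^esub> c, b \<otimes>\<^bsub>M\<^esub> d) \<in> R)"

definition binoid_quotient :: "'a binoid \<Rightarrow> ('a \<times> 'a) set \<Rightarrow> 'a set binoid" where
  "binoid_quotient M R =
     \<lparr>carrier = carrier M // R,
      mult = (\<lambda>A B. \<Union>a\<in>A. \<Union>b\<in>B. R `` {a \<otimes>\<^bsub>M\<^esub> b}),
      one = R `` {\<one>\<^bsub>M\<^esub>},
      bzero = R `` {bzero M}\<rparr>"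

definition adm_rel :: "'a binoid \<Rightarrow> 'a set \<Rightarrow> ('a \<times> 'a) set" where
  "adm_rel M r = \<Inter>{R. binoid_congruence M R \<and>
     (\<forall>x \<in> r <#>\<^bsub>M\<^esub> carrier M. (x, bzero M) \<in> R) \<and>
     (\<forall>e \<in> carrier (idem_binoid M) - r. (e, \<one>\<^bsub>M\<^esub>) \<in> R)}"

definition adm_quot :: "'a binoid \<Rightarrow> 'a set \<Rightarrow> 'a set binoid" where
  "adm_quot M r = binoid_quotient M (adm_rel M r)"

definition adm_proj :: "'a binoid \<Rightarrow> 'a set \<Rightarrow> 'a \<Rightarrow> 'a set" where
  "adm_proj M r = (\<lambda>m. adm_rel M r `` {m})"


section \<open>Units together with zero\<close>

definition units_binoid :: "'a binoid \<Rightarrow> 'a binoid" where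
  "units_binoid N = N\<lparr>carrier := Units N \<union> {bzero N}\<rparr>"

definition units_retract :: "'a binoid \<Rightarrow> 'a \<Rightarrow> 'a" where
  "units_retract N m = (if m \<in> carrier (units_binoid N) then m else bzero N)"


section \<open>The space of points\<close>

definition field_binoid :: "'k::field binoid" where
  "field_binoid = \<lparr>carrier = UNIV, mult = (*), one = 1, bzero = 0\<rparr>"

text \<open>Functions are taken extensional on the carrier, so that they are determined by their
  values there.\<close>

definition KSpec :: "'a binoid \<Rightarrow> ('a \<Rightarrow> 'k::field) set" where
  "KSpec M = binoid_hom M field_binoid \<inter> extensional (carrier M)"

definition KSpec_pullback ::
    "'a binoid \<Rightarrow> ('a \<Rightarrow> 'b) \<Rightarrow> ('b \<Rightarrow> 'k::field) \<Rightarrow> ('a \<Rightarrow> 'k)" where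
  "KSpec_pullback M f g = compose (carrier M) g f"

definition generator_eval :: "'a list \<Rightarrow> ('a \<Rightarrow> 'k) \<Rightarrow> (nat \<Rightarrow> 'k)" where
  "generator_eval es f = (\<lambda>i\<in>{..<length es}. f (es ! i))"

definition KSpec_topology_wrt ::
    "'a binoid \<Rightarrow> 'a list \<Rightarrow> ('a \<Rightarrow> 'k::real_normed_field) topology" where
  "KSpec_topology_wrt M es =
     pullback_topology (KSpec M) (generator_eval es)
       (product_topology (\<lambda>_. euclidean) {..<length es})"

text \<open>Meaningful for finitely generated binoids only; the choice of the generators is
  immaterial by \<open>KSpec_topology_eq\<close> below.\<close>

definition KSpec_topology :: "'a binoid \<Rightarrow> ('a \<Rightarrow> 'k::real_normed_field) topology" where
  "KSpec_topology M = KSpec_topology_wrt M (SOME es. binoid_generators M es)"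

definition homotopy_equivalence_map :: "'a topology \<Rightarrow> 'b topology \<Rightarrow> ('a \<Rightarrow> 'b) \<Rightarrow> bool" where
  "homotopy_equivalence_map X Y f \<longleftrightarrow>
     (\<exists>g. continuous_map X Y f \<and> continuous_map Y X g \<and>
          homotopic_with (\<lambda>_. True) X X (g \<circ> f) id \<and>
          homotopic_with (\<lambda>_. True) Y Y (f \<circ> g) id)"


section \<open>Basic facts: the constructions are well defined\<close>

lemma topspace_KSpec_topology_wrt [simp]: "topspace (KSpec_topology_wrt M es) = KSpec M"
  by (auto simp: KSpec_topology_wrt_def topspace_pullback_topology generator_eval_def)

lemma topspace_KSpec_topology [simp]: "topspace (KSpec_topology M) = KSpec M"
  by (simp add: KSpec_topology_def)

lemma continuous_map_mult_normed_field:
  fixes f g :: "'a \<Rightarrow> 'k::real_normed_field"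
  assumes "continuous_map X euclidean f" "continuous_map X euclidean g"
  shows "continuous_map X euclidean (\<lambda>x. f x * g x)"
  using assms by (simp add: continuous_map_atin tendsto_mult)

lemma KSpecD:
  assumes "f \<in> KSpec M"
  shows "\<And>x y. x \<in> carrier M \<Longrightarrow> y \<in> carrier M \<Longrightarrow> f (x \<otimes>\<^bsub>M\<^esub> y) = f x * f y"
    and "f \<one>\<^bsub>M\<^esub> = 1" and "f (bzero M) = 0"
  using assms by (auto simp: KSpec_def binoid_hom_def hom_def field_binoid_def)

lemma continuous_map_KSpec_eval:
  fixes M :: "'a binoid"
  assumes es: "binoid_generators M es" and x: "x \<in> carrier M"
  shows "continuous_map (KSpec_topology_wrt M es) euclidean (\<lambda>f. f x :: 'k::real_normed_field)"
proof -
  let ?T = "KSpec_topology_wrt M es :: ('a \<Rightarrow> 'k) topology"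
  have gen: "binoid_generate M (set es) = carrier M"
    using es by (simp add: binoid_generators_def)
  have "x \<in> binoid_generate M (set es)" using x gen by simp
  then show ?thesis
  proof induction
    case one
    have "continuous_map ?T euclidean (\<lambda>_. 1)" by simp
    then show ?case by (rule continuous_map_eq) (metis KSpecD(2) topspace_KSpec_topology_wrt)
  next
    case bzero
    have "continuous_map ?T euclidean (\<lambda>_. 0)" by simp
    then show ?case by (rule continuous_map_eq) (metis KSpecD(3) topspace_KSpec_topology_wrt)
  next
    case (incl s)
    then obtain i where i: "i < length es" "s = es ! i" by (auto simp: in_set_conv_nth)
    have "continuous_map ?T euclidean ((\<lambda>h. h i) \<circ> generator_eval es)"
      unfolding KSpec_topology_wrt_def
      by (intro continuous_map_pullback continuous_map_product_projection) (use i in simp)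
    then show ?case by (rule continuous_map_eq) (use i in \<open>auto simp: generator_eval_def\<close>)
  next
    case (mult x y)
    have "continuous_map ?T euclidean (\<lambda>f. f x * f y)"
      using mult.IH by (rule continuous_map_mult_normed_field)
    then show ?case
      by (rule continuous_map_eq) (metis KSpecD(1) mult.hyps gen topspace_KSpec_topology_wrt)
  qed
qed

lemma KSpec_topology_wrt_continuous_id:
  fixes M :: "'a binoid"
  assumes "binoid_generators M es" "binoid_generators M fs"
  shows "continuous_map (KSpec_topology_wrt M es)
           (KSpec_topology_wrt M fs :: ('a \<Rightarrow> 'k::real_normed_field) topology) (\<lambda>f. f)"
  unfolding KSpec_topology_wrt_def[of M fs]
proof (rule continuous_map_pullback')
  have "fs ! i \<in> carrier M" if "i < length fs" for i
    using assms(2) that by (auto simp: binoid_generators_def)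
  then have "continuous_map (KSpec_topology_wrt M es) euclidean (\<lambda>f. f (fs ! i) :: 'k)"
    if "i < length fs" for i
    using continuous_map_KSpec_eval[OF assms(1)] that by blast
  then show "continuous_map (KSpec_topology_wrt M es)
      (product_topology (\<lambda>_. euclidean) {..<length fs})
      (generator_eval fs \<circ> (\<lambda>f. f :: 'a \<Rightarrow> 'k))"
    by (simp add: continuous_map_componentwise generator_eval_def comp_def image_subset_iff)
qed simp

lemma KSpec_topology_wrt_unique:
  assumes "binoid_generators M es" "binoid_generators M fs"
  shows "KSpec_topology_wrt M es = KSpec_topology_wrt M fs"
proof -
  have "openin (KSpec_topology_wrt M es) U"
    if es: "binoid_generators M es" and fs: "binoid_generators M fs"
      and U: "openin (KSpec_topology_wrt M fs) U"
    for es fs and U :: "('a \<Rightarrow> 'b) set"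
  proof -
    have "openin (KSpec_topology_wrt M es) {f \<in> topspace (KSpec_topology_wrt M es). f \<in> U}"
      by (rule openin_continuous_map_preimage[OF KSpec_topology_wrt_continuous_id[OF es fs] U])
    moreover have "U \<subseteq> KSpec M" using openin_subset[OF U] by simp
    then have "{f \<in> topspace (KSpec_topology_wrt M es). f \<in> U} = U" by auto
    ultimately show ?thesis by simp
  qed
  then show ?thesis unfolding topology_eq using assms by blast
qed

lemma KSpec_topology_eq:
  assumes "binoid_generators M es"
  shows "KSpec_topology M = KSpec_topology_wrt M es"
  unfolding KSpec_topology_def
  using assms by (intro KSpec_topology_wrt_unique) (rule someI)

context comm_binoid
begin

lemma generate_closed:
  assumes "S \<subseteq> carrier M" "x \<in> binoid_generate M S"
  shows "x \<in> carrier M"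
  using assms(2) by induction (use assms(1) in auto)

lemma adm_subset: "r \<in> Adm M \<Longrightarrow> r \<subseteq> carrier M"
  by (auto simp: Adm_def binoid_prime_def binoid_ideal_def idem_binoid_def)

lemma adm_rel_congruence:
  assumes "r \<in> Adm M"
  shows "binoid_congruence M (adm_rel M r)"
proof -
  define A where "A = {R. binoid_congruence M R \<and>
     (\<forall>x \<in> r <#> carrier M. (x, bzero M) \<in> R) \<and>
     (\<forall>e \<in> carrier (idem_binoid M) - r. (e, \<one>) \<in> R)}"
  have cong: "binoid_congruence M R" if "R \<in> A" for R using that by (simp add: A_def)
  have eq: "refl_on (carrier M) R" "sym R" "trans R" if "R \<in> A" for R
    using cong[OF that] by (simp_all add: binoid_congruence_def equiv_def)
  have mult: "(a \<otimes> c, b \<otimes> d) \<in> R" if "R \<in> A" "(a, b) \<in> R" "(c, d) \<in> R" for R a b c d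
    using cong[OF that(1)] that(2,3) by (simp add: binoid_congruence_def)
  have "r <#> carrier M \<subseteq> carrier M"
    using adm_subset[OF assms] by (auto simp: set_mult_def)
  moreover have "binoid_congruence M (carrier M \<times> carrier M)"
    by (auto simp: binoid_congruence_def intro!: equivI refl_onI symI transI)
  ultimately have full: "carrier M \<times> carrier M \<in> A"
    by (auto simp: A_def idem_binoid_def)
  have "equiv (carrier M) (\<Inter>A)"
  proof (rule equivI)
    show "\<Inter>A \<subseteq> carrier M \<times> carrier M" by (rule Inter_lower[OF full])
    show "refl_on (carrier M) (\<Inter>A)"
      using eq(1) by (intro refl_onI InterI) (auto dest: refl_onD)
    show "sym (\<Inter>A)" using eq(2) by (intro symI InterI) (auto dest: symD)
    show "trans (\<Inter>A)"
    proof (intro transI InterI)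
      fix x y z R assume "(x, y) \<in> \<Inter>A" "(y, z) \<in> \<Inter>A" "R \<in> A"
      then show "(x, z) \<in> R" using eq(3)[of R] by (meson InterD transD)
    qed
  qed
  moreover have "(a \<otimes> c, b \<otimes> d) \<in> \<Inter>A" if "(a, b) \<in> \<Inter>A" "(c, d) \<in> \<Inter>A" for a b c d
    using that by (intro InterI mult) (simp_all only: InterD)
  ultimately have "binoid_congruence M (\<Inter>A)"
    unfolding binoid_congruence_def by blast
  then show ?thesis by (simp only: adm_rel_def A_def)
qed

lemma quotient_mult:
  assumes R: "binoid_congruence M R" and x: "x \<in> carrier M" and y: "y \<in> carrier M"
  shows "R `` {x} \<otimes>\<^bsub>binoid_quotient M R\<^esub> R `` {y} = R `` {x \<otimes> y}"
proof -
  have eqv: "equiv (carrier M) R" using R by (simp add: binoid_congruence_def)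
  have const: "R `` {a \<otimes> b} = R `` {x \<otimes> y}" if "a \<in> R `` {x}" "b \<in> R `` {y}" for a b
    using that R equiv_class_eq[OF eqv, of "x \<otimes> y" "a \<otimes> b"]
    by (simp add: binoid_congruence_def)
  have self: "x \<in> R `` {x}" "y \<in> R `` {y}"
    using equiv_class_self[OF eqv] x y by blast+
  have "(\<Union>a\<in>R `` {x}. \<Union>b\<in>R `` {y}. R `` {a \<otimes> b}) = R `` {x \<otimes> y}"
  proof (rule subset_antisym)
    show "(\<Union>a\<in>R `` {x}. \<Union>b\<in>R `` {y}. R `` {a \<otimes> b}) \<subseteq> R `` {x \<otimes> y}"
      by (intro UN_least) (simp only: const order_refl)
    show "R `` {x \<otimes> y} \<subseteq> (\<Union>a\<in>R `` {x}. \<Union>b\<in>R `` {y}. R `` {a \<otimes> b})"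
      by (rule order_trans[OF _ UN_upper[OF self(1)]]) (rule UN_upper[OF self(2)])
  qed
  then show ?thesis by (simp add: binoid_quotient_def)
qed

lemma comm_binoid_quotient:
  assumes R: "binoid_congruence M R"
  shows "comm_binoid (binoid_quotient M R)"
proof -
  let ?Q = "binoid_quotient M R"
  define p where "p = (\<lambda>x. R `` {x})"
  have car: "carrier ?Q = p ` carrier M"
    unfolding binoid_quotient_def quotient_def p_def by auto
  have one: "\<one>\<^bsub>?Q\<^esub> = p \<one>" and zero: "bzero ?Q = p (bzero M)"
    by (simp_all add: binoid_quotient_def p_def)
  have mlt: "p x \<otimes>\<^bsub>?Q\<^esub> p y = p (x \<otimes> y)" if "x \<in> carrier M" "y \<in> carrier M" for x y
    unfolding p_def using that by (rule quotient_mult[OF R])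
  have "comm_monoid ?Q"
  proof (rule comm_monoidI)
    show "x \<otimes>\<^bsub>?Q\<^esub> y = y \<otimes>\<^bsub>?Q\<^esub> x" if xy: "x \<in> carrier ?Q" "y \<in> carrier ?Q" for x y
    proof -
      obtain a b where "x = p a" "y = p b" "a \<in> carrier M" "b \<in> carrier M"
        using xy unfolding car by blast
      then show ?thesis using m_comm[of a b] by (simp add: mlt)
    qed
  qed (auto simp: car one mlt m_assoc)
  then show ?thesis
    by (auto simp: comm_binoid_def comm_binoid_axioms_def car zero mlt)
qed

lemma comm_binoid_adm_quot: "r \<in> Adm M \<Longrightarrow> comm_binoid (adm_quot M r)"
  by (simp add: adm_quot_def comm_binoid_quotient adm_rel_congruence)

lemma adm_proj_hom:
  assumes "r \<in> Adm M"
  shows "adm_proj M r \<in> binoid_hom M (adm_quot M r)"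
proof -
  let ?R = "adm_rel M r"
  have "\<forall>x\<in>carrier M. \<forall>y\<in>carrier M. ?R `` {x \<otimes> y} =
      ?R `` {x} \<otimes>\<^bsub>binoid_quotient M ?R\<^esub> ?R `` {y}"
    using quotient_mult[OF adm_rel_congruence[OF assms]] by metis
  moreover have "?R `` {x} \<in> carrier (binoid_quotient M ?R)" if "x \<in> carrier M" for x
    using that by (simp add: binoid_quotient_def quotientI)
  moreover have "\<one>\<^bsub>binoid_quotient M ?R\<^esub> = ?R `` {\<one>}"
    "bzero (binoid_quotient M ?R) = ?R `` {bzero M}"
    by (simp_all add: binoid_quotient_def)
  ultimately show ?thesis
    by (simp add: binoid_hom_def hom_def adm_proj_def adm_quot_def)
qed

lemma fg_adm_quot:
  assumes r: "r \<in> Adm M" and "fg_binoid M"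
  shows "fg_binoid (adm_quot M r)"
proof -
  let ?Q = "adm_quot M r" and ?p = "adm_proj M r"
  interpret Q: comm_binoid ?Q by (rule comm_binoid_adm_quot[OF r])
  obtain es where es: "set es \<subseteq> carrier M" "binoid_generate M (set es) = carrier M"
    using assms(2) by (auto simp: fg_binoid_def binoid_generators_def)
  have hom: "?p \<in> hom M ?Q" "?p \<one> = \<one>\<^bsub>?Q\<^esub>" "?p (bzero M) = bzero ?Q"
    using adm_proj_hom[OF r] by (auto simp: binoid_hom_def)
  have sub: "set (map ?p es) \<subseteq> carrier ?Q" using es hom by (auto simp: hom_def)
  have "?p x \<in> binoid_generate ?Q (set (map ?p es))" if "x \<in> carrier M" for x
  proof -
    have "x \<in> binoid_generate M (set es)" using that es by simp
    then show ?thesis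
    proof induction
      case (mult x y)
      then have "?p (x \<otimes> y) = ?p x \<otimes>\<^bsub>?Q\<^esub> ?p y" using hom(1) es by (auto simp: hom_def)
      with mult.IH show ?case by (simp only: binoid_generate.mult)
    next
      case one
      show ?case unfolding hom(2) by (rule binoid_generate.one)
    next
      case bzero
      show ?case unfolding hom(3) by (rule binoid_generate.bzero)
    next
      case (incl s)
      then show ?case by (intro binoid_generate.incl) simp
    qed
  qed
  moreover have "carrier ?Q = ?p ` carrier M"
    unfolding adm_quot_def binoid_quotient_def adm_proj_def quotient_def by auto
  ultimately have "carrier ?Q \<subseteq> binoid_generate ?Q (set (map ?p es))"
    by (simp only: image_subset_iff) (intro ballI)
  then have "binoid_generate ?Q (set (map ?p es)) = carrier ?Q"
    using Q.generate_closed[OF sub] by (intro subset_antisym subsetI) (simp_all only: subsetD)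
  with sub show ?thesis unfolding fg_binoid_def binoid_generators_def by blast
qed

lemma comm_binoid_units: "comm_binoid (units_binoid M)"
proof -
  have sub: "Units M \<union> {bzero M} \<subseteq> carrier M" by auto
  have "comm_monoid (units_binoid M)"
  proof (rule comm_monoidI)
    fix x y
    assume xy: "x \<in> carrier (units_binoid M)" "y \<in> carrier (units_binoid M)"
    then have car: "x \<in> carrier M" "y \<in> carrier M" using sub by (auto simp: units_binoid_def)
    show "x \<otimes>\<^bsub>units_binoid M\<^esub> y \<in> carrier (units_binoid M)"
      using xy car by (auto simp: units_binoid_def)
    show "x \<otimes>\<^bsub>units_binoid M\<^esub> y = y \<otimes>\<^bsub>units_binoid M\<^esub> x"
      using car m_comm[of x y] by (simp add: units_binoid_def)
    fix z assume "z \<in> carrier (units_binoid M)"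
    then have "z \<in> carrier M" using sub by (auto simp: units_binoid_def)
    then show "x \<otimes>\<^bsub>units_binoid M\<^esub> y \<otimes>\<^bsub>units_binoid M\<^esub> z =
        x \<otimes>\<^bsub>units_binoid M\<^esub> (y \<otimes>\<^bsub>units_binoid M\<^esub> z)"
      using car m_assoc[of x y z] by (simp add: units_binoid_def)
  qed (auto simp: units_binoid_def)
  then show ?thesis by (auto simp: comm_binoid_def comm_binoid_axioms_def units_binoid_def)
qed

lemma unit_factors:
  assumes "x \<in> carrier M" "y \<in> carrier M" "x \<otimes> y \<in> Units M"
  shows "x \<in> Units M" "y \<in> Units M"
proof -
  have left: "a \<in> Units M" if "a \<in> carrier M" "b \<in> carrier M" "a \<otimes> b \<in> Units M" for a b
  proof -
    obtain z where z: "z \<in> carrier M" "a \<otimes> b \<otimes> z = \<one>"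
      using \<open>a \<otimes> b \<in> Units M\<close> by (auto simp: Units_def)
    then have "a \<otimes> (b \<otimes> z) = \<one>" using that by (simp add: m_assoc)
    moreover have "b \<otimes> z \<otimes> a = a \<otimes> (b \<otimes> z)" using that z by (simp add: m_comm)
    ultimately show ?thesis using that z unfolding Units_def by auto
  qed
  show "x \<in> Units M" using left assms by blast
  show "y \<in> Units M" using left[of y x] assms by (simp add: m_comm)
qed

lemma units_retract_hom: "units_retract M \<in> binoid_hom M (units_binoid M)"
proof -
  let ?j = "units_retract M"
  have unit: "?j x = x" if "x \<in> Units M" for x
    using that by (simp add: units_retract_def units_binoid_def)
  have other: "?j x = bzero M" if "x \<notin> Units M" for x
    using that by (simp add: units_retract_def units_binoid_def)
  have "?j (x \<otimes> y) = ?j x \<otimes> ?j y" if xy: "x \<in> carrier M" "y \<in> carrier M" for x y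
  proof (cases "x \<in> Units M \<and> y \<in> Units M")
    case True
    then show ?thesis by (simp add: unit)
  next
    case False
    then have "x \<otimes> y \<notin> Units M" using unit_factors xy by blast
    moreover have "?j x \<in> carrier M" "?j y \<in> carrier M"
      using xy by (simp_all add: units_retract_def)
    ultimately show ?thesis using False by (auto simp: other)
  qed
  moreover have "?j x \<in> carrier (units_binoid M)" for x
    by (simp add: units_retract_def units_binoid_def)
  moreover have "?j (bzero M) = bzero M"
    by (simp add: units_retract_def)
  ultimately show ?thesis
    using unit[of \<one>] by (simp add: binoid_hom_def hom_def) (simp add: units_binoid_def)
qed

lemma fg_units_binoid:
  assumes "fg_binoid M"
  shows "fg_binoid (units_binoid M)"
proof -
  let ?U = "units_binoid M"
  interpret U: comm_binoid ?U by (rule comm_binoid_units)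
  obtain es where es: "set es \<subseteq> carrier M" "binoid_generate M (set es) = carrier M"
    using assms by (auto simp: fg_binoid_def binoid_generators_def)
  let ?us = "filter (\<lambda>e. e \<in> Units M) es"
  have sub: "set ?us \<subseteq> carrier ?U" by (auto simp: units_binoid_def)
  have "x \<in> binoid_generate ?U (set ?us)" if "x \<in> carrier ?U" for x
  proof (cases "x = bzero M")
    case True
    then show ?thesis using binoid_generate.bzero[of ?U] by (simp add: units_binoid_def)
  next
    case False
    then have "x \<in> Units M" using that by (simp add: units_binoid_def)
    have "x \<in> binoid_generate M (set es)" using \<open>x \<in> Units M\<close> es by auto
    then show ?thesis using \<open>x \<in> Units M\<close>
    proof induction
      case one
      then show ?case using binoid_generate.one[of ?U] by (simp add: units_binoid_def)
    next
      case bzero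
      then show ?case using binoid_generate.bzero[of ?U] by (simp add: units_binoid_def)
    next
      case (incl s)
      then show ?case by (simp add: binoid_generate.incl)
    next
      case (mult x y)
      then have "x \<in> Units M" "y \<in> Units M" using unit_factors es by blast+
      with mult.IH show ?case
        using binoid_generate.mult[of x ?U _ y] by (simp add: units_binoid_def)
    qed
  qed
  then have "binoid_generate ?U (set ?us) = carrier ?U"
    using U.generate_closed[OF sub] by blast
  with sub show ?thesis unfolding fg_binoid_def binoid_generators_def by blast
qed

end

end

theory Submission
  imports Defs "HOL-Algebra.FiniteProduct"
begin

text \<open>
  The idempotents of a finitely generated binoid are finite in number, so the decomposition of
  \<open>K Spec M\<close> according to the idempotents at which a point vanishes is a decomposition into open
  sets. It remains to contract \<open>K Spec N\<close>, for a binoid \<open>N\<close> without idempotents other than \<open>0\<close>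
  and \<open>1\<close>, onto the points vanishing off the units. A homotopy of the points with values in
  \<open>[0, \<infinity>)\<close> that never enlarges supports extends to all points by keeping the phase
  \<open>sgn (f x)\<close>, so only nonnegative points matter.

  In coordinates, the nonnegative points with a fixed support \<open>J\<close> form the image \<open>exp L\<close> of a
  linear subspace. Unless \<open>J\<close> consists of units, \<open>L\<close> contains a nonzero nonnegative vector: by an
  integral form of Stiemke's theorem of the alternative there would otherwise be a nontrivial
  idempotent. By Birch's theorem each point of the closure \<open>T\<close> of \<open>exp L\<close> is determined by its
  orthogonal projection to \<open>L\<close>. Translating this projection along that of the vector
  \<open>- (1, \<dots>, 1)\<close> until it reaches the boundary of the image deforms \<open>T\<close> into \<open>T - exp L\<close>,
  relative to \<open>T - exp L\<close>. The points of \<open>T - exp L\<close> have smaller support, so the strata can be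
  removed one after the other, maximal supports first.
\<close>

section \<open>Closures of exponentials of linear subspaces\<close>

text \<open>Multiplying by growing powers of a contracting point also pushes a stratum to smaller
  supports in the limit, but in general it moves the points of smaller support as well, so it cannot
  be glued to the identity on the other strata. Translation in projected coordinates can: the time
  needed to reach the boundary is continuous and zero on \<open>T - exp L\<close>. The direction is
  explained by the fact that a nonnegative vector plus a positive multiple of
  \<open>(1, ..., 1)\<close> is positive, and positive vectors project into the open image of
  \<open>exp L\<close>. So the part of a line inside the image is unbounded upwards and interior
  except for a possible lower end. The nonzero nonnegative vector of \<open>L\<close> forces this
  lower end to exist: pairing with it is nonnegative on \<open>T\<close> and strictly decreasing
  along the translation. Supports must not grow because phases are undefined at vanishing
  coordinates, and points supported on the units have to stay fixed for the retraction to be exact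
  there.\<close>

lemma tendsto_fun_iff:
  fixes f :: "'c \<Rightarrow> 'a \<Rightarrow> 'b::topological_space"
  shows "(f \<longlongrightarrow> l) F \<longleftrightarrow> (\<forall>i. ((\<lambda>n. f n i) \<longlongrightarrow> l i) F)"
  using limitin_componentwise[of "\<lambda>_. euclidean" UNIV f l F]
  by (simp add: euclidean_product_topology limitin_canonical_iff)

text \<open>A diagonal extraction, obtained from compactness of a product of intervals in the
  product topology.\<close>

lemma bounded_fun_seq_convergent_subseq:
  fixes f :: "nat \<Rightarrow> nat \<Rightarrow> real"
  assumes "\<And>k i. \<bar>f k i\<bar> \<le> C"
  obtains l r where "strict_mono r" "\<And>i. (\<lambda>k. f (r k) i) \<longlonglongrightarrow> l i"
proof -
  have "compactin (product_topology (\<lambda>_. euclidean) UNIV) (PiE UNIV (\<lambda>_::nat. {-C..C}))"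
    by (simp add: compactin_PiE)
  then have "seq_compact (PiE UNIV (\<lambda>_::nat. {-C..C}))"
    by (simp add: euclidean_product_topology compact_imp_seq_compact)
  moreover have "\<forall>k. f k \<in> PiE UNIV (\<lambda>_::nat. {-C..C})"
    using assms by (auto simp: PiE_iff abs_le_iff minus_le_iff)
  ultimately obtain l r where "strict_mono r" "(f \<circ> r) \<longlonglongrightarrow> l"
    unfolding seq_compact_def by meson
  then show ?thesis by (intro that[of r l]) (simp_all add: tendsto_fun_iff o_def)
qed

text \<open>For \<open>y < 0\<close> the linear term alone gives
  \<open>\<bar>y\<bar> \<le> \<bar>c\<bar> / b\<close>; for \<open>y \<ge> 0\<close> the quadratic
  Taylor bound of \<open>exp\<close> outgrows \<open>b * y\<close>. The stated bound is the sum of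
  the bounds of the two cases.\<close>

lemma exp_coercive:
  fixes b c y :: real
  assumes b: "b > 0" and le: "exp y - b * y \<le> c"
  shows "\<bar>y\<bar> \<le> \<bar>c\<bar> / b + 2 * (b + \<bar>c\<bar> + 1)"
proof (cases "y \<ge> 0")
  case False
  have "- (b * y) \<le> c" using le exp_gt_zero[of y] by linarith
  then have "\<bar>y\<bar> \<le> \<bar>c\<bar> / b" using False b by (simp add: field_simps abs_if split: if_splits)
  then show ?thesis using b by simp
next
  case True
  have "y \<le> 2 * (b + \<bar>c\<bar> + 1)"
  proof (rule ccontr)
    assume "\<not> ?thesis"
    then have y: "2 * (b + \<bar>c\<bar> + 1) < y" by simp
    have "1 + y + y\<^sup>2 / 2 \<le> exp y" using True exp_lower_Taylor_quadratic by blast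
    then have "y\<^sup>2 / 2 \<le> b * y + c - 1 - y" using le by linarith
    moreover have "y\<^sup>2 / 2 \<ge> (b + \<bar>c\<bar> + 1) * y"
      using mult_right_mono[of "2 * (b + \<bar>c\<bar> + 1)" y y] y True
      by (simp add: power2_eq_square algebra_simps)
    moreover have "\<bar>c\<bar> * y \<ge> \<bar>c\<bar> * 1" using y b by (intro mult_left_mono) auto
    moreover have "(b + \<bar>c\<bar> + 1) * y = b * y + \<bar>c\<bar> * y + y" by (simp add: algebra_simps)
    ultimately show False using True by linarith
  qed
  then show ?thesis using True b by (simp add: add_increasing)
qed

text \<open>The tangent inequality of \<open>exp\<close> at \<open>ln b\<close>, where
  \<open>exp y - b * y\<close> attains its minimum.\<close>

lemma exp_minus_linear_bounded_below:
  fixes b y :: real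
  assumes "b > 0"
  shows "b - b * ln b \<le> exp y - b * y"
proof -
  have "1 + (y - ln b) \<le> exp (y - ln b)" by (rule exp_ge_add_one_self)
  also have "\<dots> = exp y / b" using assms by (simp add: exp_diff)
  finally show ?thesis using assms by (simp add: field_simps)
qed

section \<open>Birch's theorem for the closure of the exponentials of a subspace\<close>

locale exp_subspace =
  fixes J :: "nat set" and L :: "(nat \<Rightarrow> real) set"
  assumes finite_J: "finite J"
    and L_support: "x \<in> L \<Longrightarrow> i \<notin> J \<Longrightarrow> x i = 0"
    and L_zero: "(\<lambda>_. 0) \<in> L"
    and L_add: "x \<in> L \<Longrightarrow> y \<in> L \<Longrightarrow> (\<lambda>i. x i + y i) \<in> L"
    and L_scale: "x \<in> L \<Longrightarrow> (\<lambda>i. c * x i) \<in> L"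
    and L_closed: "closed L"
begin

definition expJ :: "(nat \<Rightarrow> real) \<Rightarrow> nat \<Rightarrow> real" where
  "expJ x = (\<lambda>i. if i \<in> J then exp (x i) else 0)"

definition T :: "(nat \<Rightarrow> real) set" where
  "T = closure (expJ ` L)"

text \<open>Only the values on \<open>J\<close> enter the pairing, so that vectors such as
  \<open>\<rho> - s\<close>, shifted in all coordinates, can be used without truncation.\<close>

definition perp :: "(nat \<Rightarrow> real) \<Rightarrow> bool" where
  "perp d \<longleftrightarrow> (\<forall>x\<in>L. (\<Sum>i\<in>J. d i * x i) = 0)"

lemma T_seq:
  assumes "\<rho> \<in> T"
  obtains x where "\<And>k. x k \<in> L" "\<And>i. (\<lambda>k. expJ (x k) i) \<longlonglongrightarrow> \<rho> i"
proof -
  obtain y where y: "\<forall>k. y k \<in> expJ ` L" "y \<longlonglongrightarrow> \<rho>"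
    using assms unfolding T_def closure_sequential by blast
  then have "\<forall>k. \<exists>x. x \<in> L \<and> y k = expJ x" by blast
  then obtain x where "\<And>k. x k \<in> L" "\<And>k. y k = expJ (x k)" by metis
  then show ?thesis by (intro that[of x]) (use y(2) in \<open>simp_all add: tendsto_fun_iff\<close>)
qed

lemma expJ_in_T: "x \<in> L \<Longrightarrow> expJ x \<in> T"
  unfolding T_def by (rule subsetD[OF closure_subset]) (rule imageI)

lemma T_nonneg:
  assumes "\<rho> \<in> T"
  shows "0 \<le> \<rho> i"
proof -
  obtain x where "\<And>k. x k \<in> L" "\<And>i. (\<lambda>k. expJ (x k) i) \<longlonglongrightarrow> \<rho> i"
    using T_seq[OF assms] by blast
  then show ?thesis by (intro LIMSEQ_le_const[of "\<lambda>k. expJ (x k) i"]) (simp_all add: expJ_def)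
qed

lemma T_support:
  assumes "\<rho> \<in> T" "i \<notin> J"
  shows "\<rho> i = 0"
proof -
  obtain x where "\<And>k. x k \<in> L" and lim: "\<And>i. (\<lambda>k. expJ (x k) i) \<longlonglongrightarrow> \<rho> i"
    using T_seq[OF assms(1)] by blast
  show ?thesis using lim[of i] assms(2) by (simp add: expJ_def LIMSEQ_const_iff)
qed

lemma perp_add: "perp c \<Longrightarrow> perp d \<Longrightarrow> perp (\<lambda>i. c i + d i)"
  by (simp add: perp_def distrib_right sum.distrib)

lemma perp_diff: "perp c \<Longrightarrow> perp d \<Longrightarrow> perp (\<lambda>i. c i - d i)"
  by (simp add: perp_def left_diff_distrib sum_subtractf)

text \<open>Along sequences \<open>exp x\<^sub>k \<longrightarrow> \<rho>\<close> and \<open>exp y\<^sub>k \<longrightarrow> \<sigma>\<close> every term with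
  \<open>\<rho>\<^sub>i \<noteq> \<sigma>\<^sub>i\<close> of the pairing of \<open>\<rho> - \<sigma>\<close> with \<open>x\<^sub>k - y\<^sub>k\<close> is eventually positive.\<close>

lemma T_perp_unique:
  assumes \<rho>: "\<rho> \<in> T" and \<sigma>: "\<sigma> \<in> T" and p: "perp (\<lambda>i. \<rho> i - \<sigma> i)"
  shows "\<rho> = \<sigma>"
proof (rule ccontr)
  assume "\<rho> \<noteq> \<sigma>"
  then obtain j where j: "\<rho> j \<noteq> \<sigma> j" by blast
  then have "j \<in> J" using T_support \<rho> \<sigma> by metis
  obtain x where x: "\<And>k. x k \<in> L" "\<And>i. (\<lambda>k. expJ (x k) i) \<longlonglongrightarrow> \<rho> i"
    using T_seq[OF \<rho>] by blast
  obtain y where y: "\<And>k. y k \<in> L" "\<And>i. (\<lambda>k. expJ (y k) i) \<longlonglongrightarrow> \<sigma> i"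
    using T_seq[OF \<sigma>] by blast
  \<comment> \<open>A strict inequality of the limits eventually separates the exponentials, and
    since \<open>exp\<close> is monotone it orders the exponents themselves.\<close>
  have less: "\<forall>\<^sub>F k in sequentially. a k i < b k i"
    if "(\<lambda>k. expJ (a k) i) \<longlonglongrightarrow> u" "(\<lambda>k. expJ (b k) i) \<longlonglongrightarrow> v" "u < v" "i \<in> J"
    for a b u v i
  proof -
    obtain c where "u < c" "c < v" using \<open>u < v\<close> dense by blast
    then have "\<forall>\<^sub>F k in sequentially. expJ (a k) i < c" "\<forall>\<^sub>F k in sequentially. c < expJ (b k) i"
      using order_tendstoD that by blast+
    then show ?thesis
      by eventually_elim (use \<open>i \<in> J\<close> in \<open>auto simp: expJ_def dest: less_trans\<close>)
  qed
  have "\<forall>\<^sub>F k in sequentially. (\<rho> i - \<sigma> i) * (x k i - y k i) > 0"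
    if "i \<in> J" "\<rho> i \<noteq> \<sigma> i" for i
  proof (cases "\<rho> i < \<sigma> i")
    case True
    show ?thesis
      using less[OF x(2) y(2) True \<open>i \<in> J\<close>]
      by eventually_elim (use True in \<open>simp add: mult_neg_neg\<close>)
  next
    case False
    then have "\<sigma> i < \<rho> i" using that by simp
    show ?thesis
      using less[OF y(2) x(2) \<open>\<sigma> i < \<rho> i\<close> \<open>i \<in> J\<close>]
      by eventually_elim (use \<open>\<sigma> i < \<rho> i\<close> in simp)
  qed
  then have "\<forall>\<^sub>F k in sequentially. \<forall>i\<in>J. \<rho> i \<noteq> \<sigma> i \<longrightarrow> (\<rho> i - \<sigma> i) * (x k i - y k i) > 0"
    using finite_J by (simp add: eventually_ball_finite_distrib eventually_mono)
  then obtain k where k: "\<forall>i\<in>J. \<rho> i \<noteq> \<sigma> i \<longrightarrow> (\<rho> i - \<sigma> i) * (x k i - y k i) > 0"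
    using eventually_happens trivial_limit_sequentially by blast
  have "(\<Sum>i\<in>J. (\<rho> i - \<sigma> i) * x k i) = 0" "(\<Sum>i\<in>J. (\<rho> i - \<sigma> i) * y k i) = 0"
    using p x(1) y(1) unfolding perp_def by blast+
  then have "(\<Sum>i\<in>J. (\<rho> i - \<sigma> i) * (x k i - y k i)) = 0"
    by (simp add: right_diff_distrib sum_subtractf)
  moreover have "(\<Sum>i\<in>J. (\<rho> i - \<sigma> i) * (x k i - y k i)) > 0"
  proof (rule sum_pos2[OF finite_J \<open>j \<in> J\<close>])
    show "0 < (\<rho> j - \<sigma> j) * (x k j - y k j)" using k j \<open>j \<in> J\<close> by blast
    show "0 \<le> (\<rho> i - \<sigma> i) * (x k i - y k i)" if "i \<in> J" for i
      using k that by (cases "\<rho> i = \<sigma> i") (auto intro: less_imp_le)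
  qed
  ultimately show False by simp
qed

text \<open>Orthogonal projection to \<open>L\<close> is proper on \<open>T\<close>. Otherwise the
  normalised points \<open>d\<close> accumulate at a nonzero nonnegative \<open>e\<close>, which is
  orthogonal to \<open>L\<close> because the \<open>b k\<close> are bounded. Some
  \<open>\<sigma> m\<close> is large wherever \<open>e\<close> is positive, hence so is an
  exponential \<open>expJ (x k)\<close> close to it, and then \<open>x k\<close> in \<open>L\<close>
  is positive on the support of \<open>e\<close>: its pairing with \<open>e\<close> cannot
  vanish.\<close>

lemma T_perp_bounded:
  fixes \<sigma> b :: "nat \<Rightarrow> nat \<Rightarrow> real"
  assumes \<sigma>: "\<And>k. \<sigma> k \<in> T" and p: "\<And>k. perp (\<lambda>i. \<sigma> k i - b k i)"
    and b: "\<And>k i. i \<in> J \<Longrightarrow> \<bar>b k i\<bar> \<le> B"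
  shows "\<exists>C. \<forall>k i. \<sigma> k i \<le> C"
proof (rule ccontr)
  assume unb: "\<nexists>C. \<forall>k i. \<sigma> k i \<le> C"
  define s where "s k = (\<Sum>i\<in>J. \<sigma> k i)" for k
  have s0: "0 \<le> s k" for k unfolding s_def by (intro sum_nonneg T_nonneg \<sigma>)
  have le_s: "\<sigma> k i \<le> s k" for k i
  proof (cases "i \<in> J")
    case True
    then show ?thesis unfolding s_def by (intro member_le_sum T_nonneg \<sigma> finite_J)
  next
    case False
    then show ?thesis using s0[of k] T_support[OF \<sigma>] by simp
  qed
  have "\<exists>m. s m \<ge> real k + 1" for k
  proof (rule ccontr)
    assume "\<nexists>m. s m \<ge> real k + 1"
    then have "\<sigma> m i \<le> real k + 1" for m i
      using le_s[of m i] by (meson linear order_trans)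
    then show False using unb by blast
  qed
  then obtain r where r: "\<And>k. s (r k) \<ge> real k + 1" by metis
  have spos: "s (r k) > 0" for k using r[of k] by linarith
  have s_inf: "filterlim (\<lambda>k. s (r k)) at_top sequentially"
    by (rule filterlim_at_top_mono[OF filterlim_real_sequentially])
       (intro always_eventually allI, use r in \<open>simp add: add_le_imp_le_right order_trans[OF _ r]\<close>)
  \<comment> \<open>Division by the coordinate sum fixes the sum at \<open>1\<close>, which passes
    to the limit and keeps \<open>e\<close> from being zero.\<close>
  define d where "d k i = \<sigma> (r k) i / s (r k)" for k i
  have "\<bar>d k i\<bar> \<le> 1" for k i
    using T_nonneg[OF \<sigma>, of "r k" i] le_s[of "r k" i] spos[of k] by (simp add: d_def)
  then obtain e q where q: "strict_mono q" and lim: "\<And>i. (\<lambda>k. d (q k) i) \<longlonglongrightarrow> e i"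
    using bounded_fun_seq_convergent_subseq by blast
  have e0: "0 \<le> e i" for i
    by (rule LIMSEQ_le_const[OF lim]) (use T_nonneg[OF \<sigma>] spos in \<open>simp add: d_def less_imp_le\<close>)
  have "(\<Sum>i\<in>J. d k i) = 1" for k
    using spos[of k] by (simp add: d_def s_def flip: sum_divide_distrib)
  moreover have "(\<lambda>k. \<Sum>i\<in>J. d (q k) i) \<longlonglongrightarrow> (\<Sum>i\<in>J. e i)"
    by (intro tendsto_sum lim)
  ultimately have e1: "(\<Sum>i\<in>J. e i) = 1" by (simp add: LIMSEQ_const_iff)
  have "\<exists>j\<in>J. e j > 0"
  proof (rule ccontr)
    assume "\<not> (\<exists>j\<in>J. e j > 0)"
    then have "(\<Sum>i\<in>J. e i) \<le> 0" by (intro sum_nonpos) force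
    then show False using e1 by simp
  qed
  then obtain j where j: "j \<in> J" "e j > 0" by blast
  have s_inf': "filterlim (\<lambda>k. s (r (q k))) at_top sequentially"
    using filterlim_compose[OF s_inf filterlim_subseq[OF q]] .
  have perp_e: "perp e"
    unfolding perp_def
  proof
    fix x assume "x \<in> L"
    \<comment> \<open>In the pairing with \<open>L\<close> the unbounded \<open>\<sigma>\<close> may
      be replaced by the bounded \<open>b\<close>, and dividing by \<open>s\<close> sends the result
      to \<open>0\<close>.\<close>
    have eq: "(\<Sum>i\<in>J. d k i * x i) = (\<Sum>i\<in>J. b (r k) i * x i) / s (r k)" for k
    proof -
      have "(\<Sum>i\<in>J. \<sigma> (r k) i * x i) = (\<Sum>i\<in>J. b (r k) i * x i)"
        using p[of "r k"] \<open>x \<in> L\<close> by (simp add: perp_def left_diff_distrib sum_subtractf)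
      then show ?thesis by (simp add: d_def sum_divide_distrib[symmetric])
    qed
    have bd: "\<bar>\<Sum>i\<in>J. b (r k) i * x i\<bar> \<le> (\<Sum>i\<in>J. B * \<bar>x i\<bar>)" for k
      by (rule order_trans[OF sum_abs]) (intro sum_mono, simp add: abs_mult b mult_right_mono)
    have "(\<lambda>k. (\<Sum>i\<in>J. B * \<bar>x i\<bar>) / s (r (q k))) \<longlonglongrightarrow> 0"
      by (rule real_tendsto_divide_at_top[OF tendsto_const s_inf'])
    then have "(\<lambda>k. \<Sum>i\<in>J. d (q k) i * x i) \<longlonglongrightarrow> 0"
      by (rule Lim_null_comparison[rotated])
         (use bd spos in \<open>auto simp: eq abs_mult divide_right_mono less_imp_le intro!: always_eventually\<close>)
    moreover have "(\<lambda>k. \<Sum>i\<in>J. d (q k) i * x i) \<longlonglongrightarrow> (\<Sum>i\<in>J. e i * x i)"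
      by (intro tendsto_sum tendsto_mult lim tendsto_const)
    ultimately show "(\<Sum>i\<in>J. e i * x i) = 0" using LIMSEQ_unique by blast
  qed
  have "\<forall>\<^sub>F k in sequentially. \<sigma> (r (q k)) i > 2" if "e i > 0" for i
  proof -
    have "filterlim (\<lambda>k. d (q k) i * s (r (q k))) at_top sequentially"
      by (rule filterlim_tendsto_pos_mult_at_top[OF lim that s_inf'])
    then have "\<forall>\<^sub>F k in sequentially. d (q k) i * s (r (q k)) > 2"
      by (simp add: filterlim_at_top_dense)
    then show ?thesis
      by eventually_elim (use spos in \<open>simp add: d_def less_imp_neq[symmetric]\<close>)
  qed
  then have "\<forall>\<^sub>F k in sequentially. \<forall>i\<in>J. e i > 0 \<longrightarrow> \<sigma> (r (q k)) i > 2"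
    using finite_J by (simp add: eventually_ball_finite_distrib eventually_mono)
  \<comment> \<open>Any threshold above \<open>1\<close> would serve: approximants of
    \<open>\<sigma> m\<close> then exceed \<open>1\<close>, which means positive exponents.\<close>
  then obtain m where m: "\<forall>i\<in>J. e i > 0 \<longrightarrow> \<sigma> m i > 2"
    using eventually_happens trivial_limit_sequentially by blast
  obtain x where x: "\<And>k. x k \<in> L" "\<And>i. (\<lambda>k. expJ (x k) i) \<longlonglongrightarrow> \<sigma> m i"
    using T_seq[OF \<sigma>] by blast
  have "\<forall>\<^sub>F k in sequentially. expJ (x k) i > 1" if "i \<in> J" "e i > 0" for i
    by (rule order_tendstoD[OF x(2)]) (use m that in force)
  then have "\<forall>\<^sub>F k in sequentially. \<forall>i\<in>J. e i > 0 \<longrightarrow> expJ (x k) i > 1"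
    using finite_J by (simp add: eventually_ball_finite_distrib eventually_mono)
  then obtain k where k: "\<forall>i\<in>J. e i > 0 \<longrightarrow> expJ (x k) i > 1"
    using eventually_happens trivial_limit_sequentially by blast
  have "(\<Sum>i\<in>J. e i * x k i) > 0"
  proof (rule sum_pos2[OF finite_J j(1)])
    show "0 < e j * x k j" using k j by (simp add: expJ_def)
    show "0 \<le> e i * x k i" if "i \<in> J" for i
      using k that e0[of i] by (cases "e i = 0") (auto simp: expJ_def)
  qed
  then show False using perp_e x(1) by (auto simp: perp_def)
qed

text \<open>The preimage, under orthogonal projection to \<open>L\<close>, of the image of
  \<open>T\<close>. It is written as a union of classes modulo the orthogonal complement, so that
  the projection itself is never formed. \<open>Dom0\<close> is the corresponding set for the
  exponentials of \<open>L\<close>.\<close>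

definition Dom :: "(nat \<Rightarrow> real) set" where
  "Dom = {b. \<exists>\<sigma>\<in>T. perp (\<lambda>i. \<sigma> i - b i)}"

definition Dom0 :: "(nat \<Rightarrow> real) set" where
  "Dom0 = {b. \<exists>x\<in>L. perp (\<lambda>i. expJ x i - b i)}"

text \<open>The inverse of the projection on \<open>T\<close>, as a function on classes. For
  nonnegative \<open>b\<close> this is the extended maximum likelihood estimate of a log-linear
  model with data \<open>b\<close>.\<close>

definition birch :: "(nat \<Rightarrow> real) \<Rightarrow> nat \<Rightarrow> real" where
  "birch b = (THE \<sigma>. \<sigma> \<in> T \<and> perp (\<lambda>i. \<sigma> i - b i))"

lemma Dom0_subset: "Dom0 \<subseteq> Dom"
  using expJ_in_T by (auto simp: Dom0_def Dom_def)

lemma birch_eq: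
  assumes "\<sigma> \<in> T" "perp (\<lambda>i. \<sigma> i - b i)"
  shows "birch b = \<sigma>"
  unfolding birch_def
proof (rule the_equality)
  show "\<tau> = \<sigma>" if "\<tau> \<in> T \<and> perp (\<lambda>i. \<tau> i - b i)" for \<tau>
    using perp_diff[of "\<lambda>i. \<tau> i - b i" "\<lambda>i. \<sigma> i - b i"] that assms
    by (intro T_perp_unique) simp_all
qed (use assms in blast)

lemma birch:
  assumes "b \<in> Dom"
  shows "birch b \<in> T" "perp (\<lambda>i. birch b i - b i)"
proof -
  obtain \<sigma> where "\<sigma> \<in> T" "perp (\<lambda>i. \<sigma> i - b i)" using assms by (auto simp: Dom_def)
  then show "birch b \<in> T" "perp (\<lambda>i. birch b i - b i)" using birch_eq by simp_all
qed

lemma T_Dom: "\<rho> \<in> T \<Longrightarrow> \<rho> \<in> Dom" and birch_T: "\<rho> \<in> T \<Longrightarrow> birch \<rho> = \<rho>"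
proof -
  assume "\<rho> \<in> T"
  moreover have "perp (\<lambda>i. \<rho> i - \<rho> i)" by (simp add: perp_def)
  ultimately show "\<rho> \<in> Dom" "birch \<rho> = \<rho>"
    unfolding Dom_def by (blast, intro birch_eq)
qed

lemma closed_T: "closed T"
  by (simp add: T_def)

text \<open>Boundedness gives every subsequence a further one along which \<open>birch\<close>
  converges. Closedness of \<open>T\<close> and continuity of the pairing put the limit into
  \<open>T\<close> and into the class of \<open>c\<close>, and uniqueness makes it
  \<open>birch c\<close> each time.\<close>

lemma birch_limit:
  assumes bD: "\<And>k. b k \<in> Dom" and b: "b \<longlonglongrightarrow> c"
  shows "c \<in> Dom" "(\<lambda>k. birch (b k)) \<longlonglongrightarrow> birch c"
proof -
  have bi: "\<And>i. (\<lambda>k. b k i) \<longlonglongrightarrow> c i" using b by (simp add: tendsto_fun_iff)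
  have "\<exists>B. \<forall>k. \<bar>b k i\<bar> \<le> B" for i
    using convergent_imp_Bseq[OF convergentI[OF bi]] by (auto simp: Bseq_def)
  then obtain B where B: "\<And>i k. \<bar>b k i\<bar> \<le> B i" by metis
  have "\<bar>b k i\<bar> \<le> (\<Sum>i\<in>J. B i)" if "i \<in> J" for k i
  proof -
    have "0 \<le> B j" for j using B[of k j] by (rule order_trans[OF abs_ge_zero])
    then have "B i \<le> (\<Sum>i\<in>J. B i)" using that finite_J by (intro member_le_sum) auto
    then show ?thesis using B order_trans by blast
  qed
  then have "\<exists>C. \<forall>k i. birch (b k) i \<le> C"
    by (rule T_perp_bounded[where b = b, OF birch(1)[OF bD] birch(2)[OF bD]])
  then obtain C where C: "\<And>k i. birch (b k) i \<le> C" by blast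
  have abs: "\<bar>birch (b k) i\<bar> \<le> C" for k i
    unfolding abs_of_nonneg[OF T_nonneg[OF birch(1)[OF bD]]] by (rule C)
  \<comment> \<open>Stated for every subsequence: the identity yields membership of
    \<open>c\<close>, and a subsequence avoiding a neighbourhood of \<open>birch c\<close> yields
    the contradiction in the proof of convergence.\<close>
  have sub: "c \<in> Dom \<and> (\<exists>q. strict_mono q \<and> (\<lambda>k. birch (b (r (q k)))) \<longlonglongrightarrow> birch c)"
    if r: "strict_mono r" for r :: "nat \<Rightarrow> nat"
  proof -
    obtain \<sigma> q where q: "strict_mono q" and lim: "\<And>i. (\<lambda>k. birch (b (r (q k))) i) \<longlonglongrightarrow> \<sigma> i"
      by (rule bounded_fun_seq_convergent_subseq[of "\<lambda>k. birch (b (r k))" C, OF abs]) (rule that)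
    have lim': "(\<lambda>k. birch (b (r (q k)))) \<longlonglongrightarrow> \<sigma>" using lim by (simp add: tendsto_fun_iff)
    have \<sigma>: "\<sigma> \<in> T"
      using closed_sequentially[OF closed_T _ lim'] birch(1)[OF bD] by blast
    have "(\<lambda>k. b (r (q k)) i) \<longlonglongrightarrow> c i" for i
      using LIMSEQ_subseq_LIMSEQ[OF LIMSEQ_subseq_LIMSEQ[OF bi r] q] by (simp add: o_def)
    then have lim2: "(\<lambda>k. \<Sum>i\<in>J. (birch (b (r (q k))) i - b (r (q k)) i) * x i)
        \<longlonglongrightarrow> (\<Sum>i\<in>J. (\<sigma> i - c i) * x i)" for x
      by (intro tendsto_intros lim)
    have "perp (\<lambda>i. \<sigma> i - c i)"
      unfolding perp_def
    proof
      fix x assume "x \<in> L"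
      then have "(\<Sum>i\<in>J. (birch (b k) i - b k i) * x i) = 0" for k
        using birch(2)[OF bD] by (simp add: perp_def)
      then show "(\<Sum>i\<in>J. (\<sigma> i - c i) * x i) = 0"
        using lim2[of x] by (simp add: LIMSEQ_const_iff)
    qed
    then have "c \<in> Dom" "birch c = \<sigma>" using \<sigma> birch_eq by (auto simp: Dom_def)
    then show ?thesis using lim' q by blast
  qed
  show "c \<in> Dom" using sub[of "\<lambda>k. k"] by (simp add: strict_mono_def)
  show "(\<lambda>k. birch (b k)) \<longlonglongrightarrow> birch c"
  proof (rule topological_tendstoI, rule ccontr)
    fix S assume S: "open S" "birch c \<in> S" "\<not> (\<forall>\<^sub>F k in sequentially. birch (b k) \<in> S)"
    then have "\<exists>\<^sub>\<infinity>k. birch (b k) \<notin> S"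
      by (simp add: not_eventually cofinite_eq_sequentially)
    then have "infinite {k. birch (b k) \<notin> S}" by (simp add: INFM_iff_infinite)
    then obtain r :: "nat \<Rightarrow> nat" where r: "strict_mono r" "\<And>k. birch (b (r k)) \<notin> S"
      using infinite_enumerate by blast
    then obtain q where "(\<lambda>k. birch (b (r (q k)))) \<longlonglongrightarrow> birch c" using sub by blast
    then have "\<forall>\<^sub>F k in sequentially. birch (b (r (q k))) \<in> S"
      using S topological_tendstoD by blast
    then have "\<exists>k. birch (b (r (q k))) \<in> S"
      using eventually_happens trivial_limit_sequentially by blast
    then show False using r(2) by blast
  qed
qed

lemma closed_Dom: "closed Dom"
  unfolding closed_sequential_limits using birch_limit(1) by blast

lemma continuous_on_birch: "continuous_on Dom birch"
  unfolding continuous_on_sequentially using birch_limit(2) by (auto simp: o_def)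

text \<open>Birch's theorem: a critical point on \<open>L\<close> of the coercive function
  \<open>x \<mapsto> \<Sum>\<^sub>i exp x\<^sub>i - b\<^sub>i x\<^sub>i\<close>.\<close>

lemma pos_in_Dom0:
  assumes b: "\<And>i. i \<in> J \<Longrightarrow> b i > 0"
  shows "b \<in> Dom0"
proof -
  define \<phi> where "\<phi> x = (\<Sum>i\<in>J. exp (x i) - b i * x i)" for x :: "nat \<Rightarrow> real"
  \<comment> \<open>The minimum of the \<open>i\<close>-th summand of \<open>\<phi>\<close>. On the
    sublevel set \<open>S\<close> the total excess over these minima is at most \<open>c\<close>,
    hence so is the excess of each single summand.\<close>
  define m where "m i = b i - b i * ln (b i)" for i
  define c where "c = \<phi> (\<lambda>_. 0) - (\<Sum>i\<in>J. m i)"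
  define S where "S = {x \<in> L. \<phi> x \<le> \<phi> (\<lambda>_. 0)}"
  have cont: "continuous_on A \<phi>" for A
    unfolding \<phi>_def
    by (intro continuous_on_sum continuous_on_diff continuous_on_exp continuous_on_mult_left
        continuous_on_subset[OF continuous_on_product_coordinates subset_UNIV])
  have bnd: "\<bar>x i\<bar> \<le> \<bar>c + m i\<bar> / b i + 2 * (b i + \<bar>c + m i\<bar> + 1)" if "x \<in> S" "i \<in> J" for x i
  proof (rule exp_coercive)
    have "exp (x i) - b i * x i - m i \<le> (\<Sum>i\<in>J. exp (x i) - b i * x i - m i)"
      using b exp_minus_linear_bounded_below that finite_J
      by (intro member_le_sum[of i J "\<lambda>i. exp (x i) - b i * x i - m i"]) (auto simp: m_def)
    also have "\<dots> \<le> c" using that by (simp add: S_def c_def \<phi>_def sum_subtractf)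
    finally show "exp (x i) - b i * x i \<le> c + m i" by simp
  qed (use b that in simp)
  \<comment> \<open>Zero off \<open>J\<close>, so that \<open>S\<close> lies in a compact box over
    all of \<open>nat\<close>.\<close>
  define C where "C i = (if i \<in> J then \<bar>c + m i\<bar> / b i + 2 * (b i + \<bar>c + m i\<bar> + 1) else 0)" for i
  have "x \<in> PiE UNIV (\<lambda>i. {- C i..C i})" if "x \<in> S" for x
  proof -
    have "\<bar>x i\<bar> \<le> C i" for i
      using bnd[OF that, of i] L_support[of x i] that by (cases "i \<in> J") (simp_all add: C_def S_def)
    then show ?thesis by (simp add: PiE_iff abs_le_iff minus_le_iff)
  qed
  moreover have "compactin (product_topology (\<lambda>_. euclidean) UNIV) (PiE UNIV (\<lambda>i::nat. {- C i..C i}))"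
    by (simp add: compactin_PiE)
  then have "compact (PiE UNIV (\<lambda>i::nat. {- C i..C i}))" by (simp add: euclidean_product_topology)
  moreover have "S = L \<inter> \<phi> -` {..\<phi> (\<lambda>_. 0)}" by (auto simp: S_def)
  then have "closed S"
    using cont[of UNIV] L_closed by (simp add: closed_Int closed_vimage)
  ultimately have "compact S"
    using compact_Int_closed[of "PiE UNIV (\<lambda>i::nat. {- C i..C i})" S] by (simp add: Int_absorb1 subsetI)
  moreover have "(\<lambda>_. 0) \<in> S" using L_zero by (simp add: S_def)
  ultimately obtain x where x: "x \<in> S" "\<And>y. y \<in> S \<Longrightarrow> \<phi> x \<le> \<phi> y"
    using continuous_attains_inf[OF _ _ cont, of S] by auto
  then have xL: "x \<in> L" by (simp add: S_def)
  have min: "\<phi> x \<le> \<phi> y" if "y \<in> L" for y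
    using x that by (cases "y \<in> S") (auto simp: S_def)
  have "perp (\<lambda>i. expJ x i - b i)"
    unfolding perp_def
  proof
    fix v assume v: "v \<in> L"
    \<comment> \<open>The derivative at the minimum in the direction \<open>v\<close> is the pairing
      of \<open>expJ x - b\<close> with \<open>v\<close>; the terms \<open>0 * v i\<close> are the
      evaluation at \<open>t = 0\<close>.\<close>
    have der: "((\<lambda>t. \<phi> (\<lambda>i. x i + t * v i)) has_real_derivative
        (\<Sum>i\<in>J. exp (x i + 0 * v i) * v i - b i * v i)) (at 0)"
      unfolding \<phi>_def by (auto intro!: derivative_eq_intros sum.cong)
    have "\<phi> (\<lambda>i. x i + 0 * v i) \<le> \<phi> (\<lambda>i. x i + t * v i)" for t
      using min L_add[OF xL L_scale[OF v]] by simp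
    then have "(\<Sum>i\<in>J. exp (x i + 0 * v i) * v i - b i * v i) = 0"
      by (intro DERIV_local_min[OF der zero_less_one]) blast
    then show "(\<Sum>i\<in>J. (expJ x i - b i) * v i) = 0"
      by (simp add: expJ_def left_diff_distrib)
  qed
  then show ?thesis using xL by (auto simp: Dom0_def)
qed

lemma Dom0_perp: "b \<in> Dom0 \<Longrightarrow> perp (\<lambda>i. b i - c i) \<Longrightarrow> c \<in> Dom0"
proof -
  assume "b \<in> Dom0" and p: "perp (\<lambda>i. b i - c i)"
  then obtain x where x: "x \<in> L" "perp (\<lambda>i. expJ x i - b i)" by (auto simp: Dom0_def)
  have "perp (\<lambda>i. (expJ x i - b i) + (b i - c i))" by (rule perp_add[OF x(2) p])
  then show "c \<in> Dom0" using x(1) by (auto simp: Dom0_def)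
qed

text \<open>Modulo the orthogonal complement \<open>b\<close> is the nonnegative vector
  \<open>birch b\<close>, and adding \<open>s > 0\<close> makes it positive. Thus upward translation
  from the boundary enters the interior at once.\<close>

lemma Dom_shift:
  assumes "b \<in> Dom" "s > 0"
  shows "(\<lambda>i. b i + s) \<in> Dom0"
proof -
  have "(\<lambda>i. birch b i + s) \<in> Dom0"
    using T_nonneg[OF birch(1)[OF assms(1)]] assms(2) by (intro pos_in_Dom0 add_nonneg_pos)
  moreover have "perp (\<lambda>i. (birch b i + s) - (b i + s))" using birch(2)[OF assms(1)] by simp
  ultimately show ?thesis by (rule Dom0_perp)
qed

text \<open>If \<open>expJ x\<close> represents \<open>b\<close>, then
  \<open>expJ x + (b' - b)\<close> represents \<open>b'\<close>, and it is still positive on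
  \<open>J\<close> for \<open>b'\<close> near \<open>b\<close>.\<close>

lemma open_Dom0: "open Dom0"
proof (subst open_subopen, intro ballI)
  fix b assume "b \<in> Dom0"
  then obtain x where x: "x \<in> L" "perp (\<lambda>i. expJ x i - b i)" by (auto simp: Dom0_def)
  let ?U = "\<Inter>i\<in>J. {b'. 0 < exp (x i) + b' i - b i}"
  have "open {b'. 0 < exp (x i) + b' i - b i}" for i
    by (intro open_Collect_less continuous_intros continuous_on_product_coordinates)
  then have "open ?U" using finite_J by (intro open_INT) auto
  moreover have "b \<in> ?U" by simp
  moreover have "?U \<subseteq> Dom0"
  proof
    fix b' assume "b' \<in> ?U"
    then have "(\<lambda>i. expJ x i + b' i - b i) \<in> Dom0" by (intro pos_in_Dom0) (simp add: expJ_def)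
    moreover have "perp (\<lambda>i. (expJ x i + b' i - b i) - b' i)" using x(2) by (simp add: algebra_simps)
    ultimately show "b' \<in> Dom0" by (rule Dom0_perp)
  qed
  ultimately show "\<exists>T. open T \<and> b \<in> T \<and> T \<subseteq> Dom0" by blast
qed

end

section \<open>Translation along the diagonal to the boundary of the domain\<close>

locale exp_subspace_nonneg = exp_subspace +
  fixes \<delta> :: "nat \<Rightarrow> real"
  assumes \<delta>_L: "\<delta> \<in> L" and \<delta>_nonneg: "0 \<le> \<delta> i" and \<delta>_nonzero: "\<exists>i. \<delta> i \<noteq> 0"
begin

definition exit_time :: "(nat \<Rightarrow> real) \<Rightarrow> real" where
  "exit_time \<rho> = Sup {s. 0 \<le> s \<and> (\<lambda>i. \<rho> i - s) \<in> Dom}"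

lemma sum_\<delta>_pos: "(\<Sum>i\<in>J. \<delta> i) > 0"
proof -
  obtain j where "\<delta> j \<noteq> 0" using \<delta>_nonzero by blast
  then have "j \<in> J" "\<delta> j > 0" using L_support[OF \<delta>_L] \<delta>_nonneg[of j] by fastforce+
  then show ?thesis using sum_pos2[OF finite_J] \<delta>_nonneg by blast
qed

text \<open>Pairing with \<open>\<delta>\<close> is nonnegative on \<open>T\<close>, hence on
  \<open>Dom\<close>, because \<open>birch\<close> preserves pairings with \<open>L\<close>.
  Translation by \<open>- s\<close> lowers it by \<open>s\<close> times the positive sum of
  \<open>\<delta>\<close>.\<close>

lemma exit_bound:
  assumes "\<rho> \<in> T" "(\<lambda>i. \<rho> i - s) \<in> Dom"
  shows "s \<le> (\<Sum>i\<in>J. \<rho> i * \<delta> i) / (\<Sum>i\<in>J. \<delta> i)"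
proof -
  have "(\<Sum>i\<in>J. (birch (\<lambda>i. \<rho> i - s) i - (\<rho> i - s)) * \<delta> i) = 0"
    using birch(2)[OF assms(2)] \<delta>_L by (auto simp: perp_def)
  then have "(\<Sum>i\<in>J. birch (\<lambda>i. \<rho> i - s) i * \<delta> i) = (\<Sum>i\<in>J. \<rho> i * \<delta> i) - s * (\<Sum>i\<in>J. \<delta> i)"
    by (simp add: left_diff_distrib sum_subtractf sum_distrib_left)
  moreover have "0 \<le> (\<Sum>i\<in>J. birch (\<lambda>i. \<rho> i - s) i * \<delta> i)"
    by (intro sum_nonneg mult_nonneg_nonneg \<delta>_nonneg T_nonneg birch(1) assms(2))
  ultimately show ?thesis using sum_\<delta>_pos by (simp add: le_divide_eq)
qed

lemma exit_bdd: "\<rho> \<in> T \<Longrightarrow> bdd_above {s. 0 \<le> s \<and> (\<lambda>i. \<rho> i - s) \<in> Dom}"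
  by (rule bdd_aboveI[where M = "(\<Sum>i\<in>J. \<rho> i * \<delta> i) / (\<Sum>i\<in>J. \<delta> i)"]) (use exit_bound in blast)

lemma continuous_shift: "continuous_on A (\<lambda>s i. \<rho> i - s :: real)"
  by (intro continuous_on_coordinatewise_then_product continuous_intros)

lemma exit_nonneg: "\<rho> \<in> T \<Longrightarrow> 0 \<le> exit_time \<rho>"
  unfolding exit_time_def by (rule cSup_upper[OF _ exit_bdd]) (simp_all add: T_Dom)

lemma exit_mem:
  assumes "\<rho> \<in> T"
  shows "(\<lambda>i. \<rho> i - exit_time \<rho>) \<in> Dom"
proof -
  let ?S = "{s. 0 \<le> s \<and> (\<lambda>i. \<rho> i - s) \<in> Dom}"
  have "closed ((\<lambda>s i. \<rho> i - s) -` Dom)"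
    by (rule closed_vimage[OF closed_Dom continuous_shift])
  moreover have "?S = {0..} \<inter> (\<lambda>s i. \<rho> i - s) -` Dom" by auto
  ultimately have "closed ?S" by (simp add: closed_Int)
  moreover have "0 \<in> ?S" using T_Dom[OF assms] by simp
  then have "?S \<noteq> {}" by blast
  ultimately have "Sup ?S \<in> ?S" by (intro closed_contains_Sup exit_bdd assms)
  then show ?thesis by (simp add: exit_time_def)
qed

text \<open>The admissible times fill the closed interval from \<open>0\<close> to
  \<open>exit_time \<rho>\<close>: the right end belongs to it since \<open>Dom\<close> is closed,
  and earlier times since \<open>Dom_shift\<close> adds back the difference.\<close>

lemma le_exit_iff:
  assumes "\<rho> \<in> T" "0 \<le> a"
  shows "a \<le> exit_time \<rho> \<longleftrightarrow> (\<lambda>i. \<rho> i - a) \<in> Dom"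
proof
  assume "a \<le> exit_time \<rho>"
  show "(\<lambda>i. \<rho> i - a) \<in> Dom"
  proof (cases "a = exit_time \<rho>")
    case True
    then show ?thesis using exit_mem assms by simp
  next
    case False
    then show ?thesis
      using Dom_shift[OF exit_mem[OF assms(1)], of "exit_time \<rho> - a"] \<open>a \<le> exit_time \<rho>\<close> Dom0_subset
      by auto
  qed
next
  assume "(\<lambda>i. \<rho> i - a) \<in> Dom"
  then show "a \<le> exit_time \<rho>"
    unfolding exit_time_def using assms by (intro cSup_upper[OF _ exit_bdd]) simp_all
qed

text \<open>Before the exit time \<open>Dom_shift\<close> even reaches \<open>Dom0\<close>.
  Conversely \<open>Dom0\<close> is open, so from a point in it the translation can continue a
  little further.\<close>

lemma less_exit_iff:
  assumes "\<rho> \<in> T" "0 \<le> a"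
  shows "a < exit_time \<rho> \<longleftrightarrow> (\<lambda>i. \<rho> i - a) \<in> Dom0"
proof
  assume "a < exit_time \<rho>"
  then show "(\<lambda>i. \<rho> i - a) \<in> Dom0"
    using Dom_shift[OF exit_mem[OF assms(1)], of "exit_time \<rho> - a"] by simp
next
  assume a: "(\<lambda>i. \<rho> i - a) \<in> Dom0"
  have "open ((\<lambda>s i. \<rho> i - s) -` Dom0)"
    by (rule open_vimage[OF open_Dom0 continuous_shift])
  then obtain e where e: "e > 0" "\<And>s. dist s a < e \<Longrightarrow> (\<lambda>i. \<rho> i - s) \<in> Dom0"
    using a by (auto simp: open_dist)
  have "(\<lambda>i. \<rho> i - (a + e / 2)) \<in> Dom"
    using e(2)[of "a + e / 2"] e(1) Dom0_subset by (auto simp: dist_real_def)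
  then have "a + e / 2 \<le> exit_time \<rho>"
    using le_exit_iff[of \<rho> "a + e / 2"] assms e(1) by simp
  then show "a < exit_time \<rho>" using e(1) by linarith
qed

text \<open>Semicontinuity from both sides: for \<open>a \<ge> 0\<close>, an exit time above
  \<open>a\<close> is an open condition because \<open>Dom0\<close> is open, and an exit time below
  \<open>a\<close> is one because \<open>Dom\<close> is closed.\<close>

lemma continuous_on_exit: "continuous_on T exit_time"
  unfolding continuous_on_def
proof (intro ballI order_tendstoI)
  fix \<rho> a assume \<rho>: "\<rho> \<in> T"
  have cont: "continuous_on UNIV (\<lambda>\<sigma> i. \<sigma> i - a :: real)"
    by (intro continuous_on_coordinatewise_then_product continuous_on_diff
        continuous_on_product_coordinates continuous_on_const)
  {
    assume a: "a < exit_time \<rho>"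
    show "\<forall>\<^sub>F \<sigma> in at \<rho> within T. a < exit_time \<sigma>"
    proof (cases "0 \<le> a")
      case True
      have "open ((\<lambda>\<sigma> i. \<sigma> i - a) -` Dom0)" by (rule open_vimage[OF open_Dom0 cont])
      moreover have "\<rho> \<in> (\<lambda>\<sigma> i. \<sigma> i - a) -` Dom0" using less_exit_iff[OF \<rho> True] a by simp
      ultimately show ?thesis
        unfolding eventually_at_topological using less_exit_iff[OF _ True] by fastforce
    next
      case False
      have "a < exit_time \<sigma>" if "\<sigma> \<in> T" for \<sigma> using exit_nonneg[OF that] False by linarith
      then show ?thesis unfolding eventually_at_topological by blast
    qed
  next
    assume a: "exit_time \<rho> < a"
    then have a0: "0 \<le> a" using exit_nonneg[OF \<rho>] by linarith
    have "open (- ((\<lambda>\<sigma> i. \<sigma> i - a) -` Dom))"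
      using closed_vimage[OF closed_Dom cont] by (simp only: open_Compl)
    moreover have "\<rho> \<in> - ((\<lambda>\<sigma> i. \<sigma> i - a) -` Dom)" using le_exit_iff[OF \<rho> a0] a by simp
    ultimately show "\<forall>\<^sub>F \<sigma> in at \<rho> within T. exit_time \<sigma> < a"
      unfolding eventually_at_topological using le_exit_iff[OF _ a0] by (fastforce simp: not_le[symmetric])
  }
qed

text \<open>Time is rescaled by the exit time, so that all points reach the boundary at
  \<open>t = 1\<close>.\<close>

definition push :: "real \<times> (nat \<Rightarrow> real) \<Rightarrow> nat \<Rightarrow> real" where
  "push = (\<lambda>(t, \<rho>). birch (\<lambda>i. \<rho> i - t * exit_time \<rho>))"

lemma push_Dom:
  assumes "\<rho> \<in> T" "t \<in> {0..1}"
  shows "(\<lambda>i. \<rho> i - t * exit_time \<rho>) \<in> Dom"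
  using le_exit_iff[OF assms(1), of "t * exit_time \<rho>"] exit_nonneg[OF assms(1)] assms(2)
  by (simp add: mult_left_le_one_le)

lemma push_in_T: "\<rho> \<in> T \<Longrightarrow> t \<in> {0..1} \<Longrightarrow> push (t, \<rho>) \<in> T"
  by (simp only: push_def prod.case birch(1)[OF push_Dom])

lemma continuous_on_push: "continuous_on ({0..1} \<times> T) push"
proof -
  have exit: "continuous_on ({0..1::real} \<times> T) (\<lambda>p. exit_time (snd p))"
    by (rule continuous_on_compose2[OF continuous_on_exit continuous_on_snd]) auto
  have coord: "continuous_on ({0..1::real} \<times> T) (\<lambda>p. snd p i)" for i
    by (rule continuous_on_compose2[OF continuous_on_product_coordinates continuous_on_snd[OF continuous_on_id] subset_UNIV])
  have "continuous_on ({0..1} \<times> T) (\<lambda>p i. snd p i - fst p * exit_time (snd p))"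
    by (intro continuous_on_coordinatewise_then_product continuous_on_diff continuous_on_mult
        continuous_on_fst continuous_on_id exit coord)
  then have "continuous_on ({0..1} \<times> T) (\<lambda>p. birch (\<lambda>i. snd p i - fst p * exit_time (snd p)))"
    by (rule continuous_on_compose2[OF continuous_on_birch]) (auto simp: push_Dom)
  then show ?thesis by (simp add: push_def case_prod_unfold)
qed

lemma push_0: "\<rho> \<in> T \<Longrightarrow> push (0, \<rho>) = \<rho>"
  by (simp add: push_def birch_T)

text \<open>If the end point were an exponential of \<open>L\<close>, the translated vector would
  lie in \<open>Dom0\<close> and the translation could go on past the exit time.\<close>

lemma push_1:
  assumes "\<rho> \<in> T"
  shows "push (1, \<rho>) \<notin> expJ ` L"
proof
  assume "push (1, \<rho>) \<in> expJ ` L"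
  then obtain x where x: "x \<in> L" "push (1, \<rho>) = expJ x" by blast
  have "perp (\<lambda>i. push (1, \<rho>) i - (\<rho> i - exit_time \<rho>))"
    using birch(2)[OF exit_mem[OF assms]] by (simp add: push_def)
  then have "(\<lambda>i. \<rho> i - exit_time \<rho>) \<in> Dom0" using x by (auto simp: Dom0_def)
  then have "exit_time \<rho> < exit_time \<rho>" by (simp only: less_exit_iff[OF assms exit_nonneg[OF assms]])
  then show False by simp
qed

text \<open>A positive exit time would put \<open>\<rho>\<close> itself into \<open>Dom0\<close>,
  and by uniqueness in its class \<open>\<rho>\<close> would be an exponential of \<open>L\<close>.
  So the exit time is zero and nothing moves.\<close>

lemma push_boundary:
  assumes "\<rho> \<in> T" "\<rho> \<notin> expJ ` L"
  shows "push (t, \<rho>) = \<rho>"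
proof -
  have "\<not> 0 < exit_time \<rho>"
  proof
    assume "0 < exit_time \<rho>"
    then have "\<rho> \<in> Dom0" using less_exit_iff[OF assms(1), of 0] by simp
    then obtain x where x: "x \<in> L" "perp (\<lambda>i. expJ x i - \<rho> i)" by (auto simp: Dom0_def)
    then have "expJ x = \<rho>" by (intro T_perp_unique expJ_in_T assms(1))
    then show False using assms(2) x(1) by blast
  qed
  then have "exit_time \<rho> = 0" using exit_nonneg[OF assms(1)] by simp
  then show ?thesis by (simp add: push_def birch_T[OF assms(1)])
qed

end

section \<open>Contracting sets of nonnegative points\<close>

definition supp :: "(nat \<Rightarrow> real) \<Rightarrow> nat set" where
  "supp \<rho> = {i. \<rho> i \<noteq> 0}"

text \<open>Abstracts the nonnegative points in coordinates. The real powers include the exponent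
  \<open>0\<close> and negative exponents; as \<open>0 powr s = 0\<close> for every
  \<open>s\<close>, all of them keep the support. In logarithmic coordinates
  \<open>V_contracting\<close> supplies the nonzero nonnegative vector
  \<open>- ln \<sigma>\<close>.\<close>

locale positive_toric_set =
  fixes n :: nat and V :: "(nat \<Rightarrow> real) set" and U :: "nat set"
  assumes closed_V: "closed V"
    and V_nonneg: "\<rho> \<in> V \<Longrightarrow> 0 \<le> \<rho> i"
    and V_supp: "\<rho> \<in> V \<Longrightarrow> supp \<rho> \<subseteq> {..<n}"
    and V_mult: "\<rho> \<in> V \<Longrightarrow> \<sigma> \<in> V \<Longrightarrow> (\<lambda>i. \<rho> i * \<sigma> i) \<in> V"
    and V_powr: "\<rho> \<in> V \<Longrightarrow> (\<lambda>i. \<rho> i powr s) \<in> V"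
    and U_supp: "\<rho> \<in> V \<Longrightarrow> U \<subseteq> supp \<rho>"
    and V_contracting: "\<rho> \<in> V \<Longrightarrow> supp \<rho> \<noteq> U \<Longrightarrow>
      \<exists>\<sigma>\<in>V. supp \<sigma> = supp \<rho> \<and> (\<forall>i. \<sigma> i \<le> 1) \<and> (\<exists>i\<in>supp \<rho>. \<sigma> i < 1)"
begin

definition logs :: "nat set \<Rightarrow> (nat \<Rightarrow> real) set" where
  "logs J = {x. (\<forall>i. i \<notin> J \<longrightarrow> x i = 0) \<and> (\<lambda>i. if i \<in> J then exp (x i) else 0) \<in> V}"

lemma V_pos: "\<rho> \<in> V \<Longrightarrow> i \<in> supp \<rho> \<Longrightarrow> 0 < \<rho> i"
  using V_nonneg[of \<rho> i] by (simp add: supp_def)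

lemma exp_subspace_logs:
  assumes "\<rho> \<in> V"
  shows "exp_subspace (supp \<rho>) (logs (supp \<rho>))"
proof
  let ?J = "supp \<rho>"
  show "finite ?J" using V_supp[OF assms] finite_subset by blast
  show "x i = 0" if "x \<in> logs ?J" "i \<notin> ?J" for x i using that by (simp add: logs_def)
  \<comment> \<open>Since \<open>0 powr 0 = 0\<close>, the zeroth power is the indicator function of
    the support.\<close>
  have "(\<lambda>i. if i \<in> ?J then exp 0 else 0) = (\<lambda>i. \<rho> i powr 0)" by (auto simp: supp_def)
  then show "(\<lambda>_. 0) \<in> logs ?J" using V_powr[OF assms, of 0] by (simp add: logs_def)
  show "(\<lambda>i. x i + y i) \<in> logs ?J" if "x \<in> logs ?J" "y \<in> logs ?J" for x y
  proof -
    have "(\<lambda>i. if i \<in> ?J then exp (x i + y i) else 0) =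
        (\<lambda>i. (if i \<in> ?J then exp (x i) else 0) * (if i \<in> ?J then exp (y i) else 0))"
      by (auto simp: exp_add)
    then show ?thesis using V_mult that by (simp add: logs_def)
  qed
  show "(\<lambda>i. c * x i) \<in> logs ?J" if "x \<in> logs ?J" for x c
  proof -
    have "(\<lambda>i. if i \<in> ?J then exp (c * x i) else 0) =
        (\<lambda>i. (if i \<in> ?J then exp (x i) else 0) powr c)"
      by (auto simp: powr_def)
    then show ?thesis using V_powr that by (simp add: logs_def)
  qed
  have cont: "continuous_on UNIV (\<lambda>x i. if i \<in> ?J then exp (x i) else 0 :: real)"
  proof (rule continuous_on_coordinatewise_then_product)
    show "continuous_on UNIV (\<lambda>x. if i \<in> ?J then exp (x i) else 0 :: real)" for i
      by (cases "i \<in> ?J") (simp_all add: continuous_on_exp)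
  qed
  have "closed (\<Inter>i\<in>-?J. {x. x i = (0::real)})"
    by (intro closed_INT ballI closed_Collect_eq continuous_on_product_coordinates continuous_on_const)
  moreover have "logs ?J = (\<Inter>i\<in>-?J. {x. x i = 0}) \<inter> (\<lambda>x i. if i \<in> ?J then exp (x i) else 0) -` V"
    by (auto simp: logs_def)
  ultimately show "closed (logs ?J)"
    using closed_vimage[OF closed_V cont] by (simp add: closed_Int)
qed

section \<open>Stratification by supports and removal of maximal strata\<close>

definition stratum :: "nat set \<Rightarrow> (nat \<Rightarrow> real) set" where
  "stratum J = {\<rho> \<in> V. supp \<rho> = J}"

definition strata :: "nat set set \<Rightarrow> (nat \<Rightarrow> real) set" where
  "strata G = {\<rho> \<in> V. supp \<rho> \<in> G}"

text \<open>\<open>G\<close> may contain sets that are not supports of points of \<open>V\<close>;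
  only supports that occur are compared.\<close>

definition down_closed :: "nat set set \<Rightarrow> bool" where
  "down_closed G \<longleftrightarrow> (\<forall>\<rho>\<in>V. \<forall>\<sigma>\<in>strata G. supp \<rho> \<subseteq> supp \<sigma> \<longrightarrow> supp \<rho> \<in> G)"

lemma log_in_logs:
  assumes "\<rho> \<in> V"
  shows "(\<lambda>i. if i \<in> supp \<rho> then ln (\<rho> i) else 0) \<in> logs (supp \<rho>)"
proof -
  have "(\<lambda>i. if i \<in> supp \<rho> then exp (ln (\<rho> i)) else 0) = \<rho>"
    using V_nonneg[OF assms] by (auto simp: supp_def less_le)
  then show ?thesis using assms by (simp add: logs_def cong: if_cong)
qed

lemma image_exp_logs:
  assumes "\<rho> \<in> V"
  shows "exp_subspace.expJ (supp \<rho>) ` logs (supp \<rho>) = stratum (supp \<rho>)"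
proof -
  interpret exp_subspace "supp \<rho>" "logs (supp \<rho>)" by (rule exp_subspace_logs[OF assms])
  show ?thesis
  proof
    show "expJ ` logs (supp \<rho>) \<subseteq> stratum (supp \<rho>)"
      unfolding expJ_def by (auto simp: logs_def stratum_def supp_def)
    show "stratum (supp \<rho>) \<subseteq> expJ ` logs (supp \<rho>)"
    proof
      fix \<sigma> assume "\<sigma> \<in> stratum (supp \<rho>)"
      then have \<sigma>: "\<sigma> \<in> V" "supp \<sigma> = supp \<rho>" by (simp_all add: stratum_def)
      define x where "x i = (if i \<in> supp \<rho> then ln (\<sigma> i) else 0)" for i
      have "expJ x i = \<sigma> i" for i
      proof (cases "i \<in> supp \<rho>")
        case True
        then show ?thesis using V_pos[OF \<sigma>(1), of i] \<sigma>(2) by (simp add: expJ_def x_def)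
      next
        case False
        then have "i \<notin> supp \<sigma>" using \<sigma>(2) by simp
        then show ?thesis using False by (simp add: expJ_def) (simp add: supp_def)
      qed
      then have "expJ x = \<sigma>" by (rule ext)
      moreover have "x \<in> logs (supp \<rho>)"
        using log_in_logs[OF \<sigma>(1)] \<sigma>(2) by (simp add: x_def[abs_def])
      ultimately show "\<sigma> \<in> expJ ` logs (supp \<rho>)" by (rule image_eqI[OF sym])
    qed
  qed
qed

lemma exp_subspace_nonneg_logs:
  assumes "\<rho> \<in> V" "supp \<rho> \<noteq> U"
  shows "\<exists>\<delta>. exp_subspace_nonneg (supp \<rho>) (logs (supp \<rho>)) \<delta>"
proof -
  interpret exp_subspace "supp \<rho>" "logs (supp \<rho>)" by (rule exp_subspace_logs[OF assms(1)])
  obtain \<sigma> j where \<sigma>: "\<sigma> \<in> V" "supp \<sigma> = supp \<rho>" "\<And>i. \<sigma> i \<le> 1" and j: "j \<in> supp \<rho>" "\<sigma> j < 1"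
    using V_contracting[OF assms] by blast
  define \<delta> where "\<delta> i = - 1 * (if i \<in> supp \<rho> then ln (\<sigma> i) else 0)" for i
  have pos: "\<sigma> i > 0" if "i \<in> supp \<rho>" for i
    using V_pos[OF \<sigma>(1), of i] that \<sigma>(2) by simp
  have "exp_subspace_nonneg (supp \<rho>) (logs (supp \<rho>)) \<delta>"
  proof unfold_locales
    show "\<delta> \<in> logs (supp \<rho>)"
      using L_scale[OF log_in_logs[OF \<sigma>(1), unfolded \<sigma>(2)], of "-1"] by (simp add: \<delta>_def[abs_def])
    show "0 \<le> \<delta> i" for i using \<sigma>(3)[of i] pos[of i] by (simp add: \<delta>_def)
    have "\<delta> j \<noteq> 0" using j pos[of j] by (simp add: \<delta>_def)
    then show "\<exists>i. \<delta> i \<noteq> 0" by blast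
  qed
  then show ?thesis by blast
qed

text \<open>A coordinate that is nonzero in the limit is eventually nonzero, so the support of the
  limit lies in the support of some member of the sequence.\<close>

lemma closed_strata:
  assumes "down_closed G"
  shows "closed (strata G)"
  unfolding closed_sequential_limits
proof (intro allI impI, elim conjE)
  fix \<rho> l assume \<rho>: "\<forall>k. \<rho> k \<in> strata G" and lim: "\<rho> \<longlonglongrightarrow> l"
  have l: "l \<in> V"
    using closed_sequentially[OF closed_V _ lim] \<rho> by (simp add: strata_def)
  have "\<forall>\<^sub>F k in sequentially. \<rho> k i \<noteq> 0" if "i \<in> supp l" for i
  proof (rule tendsto_imp_eventually_ne)
    show "(\<lambda>k. \<rho> k i) \<longlonglongrightarrow> l i" using lim by (simp add: tendsto_fun_iff)
  qed (use that in \<open>simp add: supp_def\<close>)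
  moreover have "finite (supp l)" using V_supp[OF l] finite_subset by blast
  ultimately have "\<forall>\<^sub>F k in sequentially. \<forall>i\<in>supp l. \<rho> k i \<noteq> 0"
    by (simp add: eventually_ball_finite_distrib)
  then obtain k where "\<forall>i\<in>supp l. \<rho> k i \<noteq> 0"
    using eventually_happens trivial_limit_sequentially by blast
  then have "supp l \<subseteq> supp (\<rho> k)" by (auto simp: supp_def)
  then show "l \<in> strata G" using assms l \<rho> by (auto simp: down_closed_def strata_def)
qed

text \<open>The invariant of the homotopies. Supports that do not grow allow phases to be carried
  along; fixing the points with support \<open>U\<close> makes the final retraction the identity on
  them.\<close>

definition shrinking :: "nat set set \<Rightarrow> ((nat \<Rightarrow> real) \<Rightarrow> nat \<Rightarrow> real) \<Rightarrow> bool" where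
  "shrinking G g \<longleftrightarrow> (\<forall>\<rho>\<in>strata G. supp (g \<rho>) \<subseteq> supp \<rho> \<and> (supp \<rho> = U \<longrightarrow> g \<rho> = \<rho>))"

text \<open>The closure \<open>T\<close> of the maximal stratum and the union of the other strata
  are closed and cover \<open>strata G\<close>. On their intersection \<open>push\<close> is the
  identity, so it extends by the identity.\<close>

lemma remove_stratum:
  assumes G: "down_closed G" and \<rho>0: "\<rho>0 \<in> strata G" "supp \<rho>0 \<noteq> U"
    and max: "\<And>\<sigma>. \<sigma> \<in> strata G \<Longrightarrow> supp \<rho>0 \<subseteq> supp \<sigma> \<Longrightarrow> supp \<sigma> = supp \<rho>0"
  shows "down_closed (G - {supp \<rho>0})"
    and "\<exists>q. homotopic_with_canon (shrinking G) (strata G) (strata G) id q \<and>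
           q ` strata G \<subseteq> strata (G - {supp \<rho>0})"
proof -
  define J where "J = supp \<rho>0"
  have \<rho>0V: "\<rho>0 \<in> V" using \<rho>0(1) by (simp add: strata_def)
  obtain \<delta> where "exp_subspace_nonneg J (logs J) \<delta>"
    using exp_subspace_nonneg_logs[OF \<rho>0V \<rho>0(2)] by (auto simp: J_def)
  then interpret exp_subspace_nonneg J "logs J" \<delta> .
  have img: "expJ ` logs J = stratum J" using image_exp_logs[OF \<rho>0V] by (simp add: J_def)
  have TV: "T \<subseteq> V"
    unfolding T_def img by (rule closure_minimal[OF _ closed_V]) (auto simp: stratum_def)
  have suppT: "supp \<rho> \<subseteq> J" if "\<rho> \<in> T" for \<rho> using T_support[OF that] by (auto simp: supp_def)
  have TG: "T \<subseteq> strata G"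
  proof
    fix \<rho> assume "\<rho> \<in> T"
    then have "\<rho> \<in> V" "supp \<rho> \<subseteq> supp \<rho>0" using TV suppT[of \<rho>] by (auto simp: J_def)
    then show "\<rho> \<in> strata G" using G \<rho>0(1) unfolding down_closed_def strata_def by blast
  qed
  show dc: "down_closed (G - {supp \<rho>0})"
    unfolding down_closed_def
  proof (intro ballI impI)
    fix \<rho> \<sigma> assume *: "\<rho> \<in> V" "\<sigma> \<in> strata (G - {supp \<rho>0})" "supp \<rho> \<subseteq> supp \<sigma>"
    then have \<sigma>: "\<sigma> \<in> strata G" "supp \<sigma> \<noteq> supp \<rho>0" by (auto simp: strata_def)
    then have "supp \<rho> \<in> G" using G * by (auto simp: down_closed_def)
    moreover have "supp \<rho> \<noteq> supp \<rho>0" using max[OF \<sigma>(1)] \<sigma>(2) *(3) by auto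
    ultimately show "supp \<rho> \<in> G - {supp \<rho>0}" by simp
  qed
  let ?Y = "strata (G - {J})"
  \<comment> \<open>\<open>T\<close> can be a proper part of the points with support inside
    \<open>J\<close>; the others lie in the remaining strata.\<close>
  have Y: "strata G = T \<union> ?Y"
  proof
    have "stratum J \<subseteq> T" unfolding T_def img by (rule closure_subset)
    then show "strata G \<subseteq> T \<union> ?Y" by (auto simp: strata_def stratum_def)
    show "T \<union> ?Y \<subseteq> strata G" using TG by (auto simp: strata_def)
  qed
  have closedY: "closed ?Y" using closed_strata[OF dc] by (simp add: J_def)
  have fixed: "push (t, \<rho>) = \<rho>" if "\<rho> \<in> T" "supp \<rho> \<noteq> J" for t \<rho>
    by (rule push_boundary[OF that(1)]) (use that(2) in \<open>simp add: img stratum_def\<close>)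
  define h where "h p = (if snd p \<in> T then push p else snd p)" for p
  have "continuous_on (({0..1} \<times> T) \<union> ({0..1} \<times> ?Y)) h"
    unfolding h_def
  proof (rule continuous_on_cases)
    show "closed ({0..1::real} \<times> T)" "closed ({0..1::real} \<times> ?Y)"
      by (simp_all add: closed_Times closed_T closedY)
    show "\<forall>p. p \<in> {0..1} \<times> T \<and> snd p \<notin> T \<or> p \<in> {0..1} \<times> ?Y \<and> snd p \<in> T \<longrightarrow> push p = snd p"
      using fixed by (auto simp: strata_def)
  qed (intro continuous_on_push continuous_on_snd continuous_on_id)+
  then have cont: "continuous_on ({0..1} \<times> strata G) h"
    by (simp add: Y Sigma_Un_distrib2)
  have hG: "h (t, \<rho>) \<in> strata G" if "t \<in> {0..1}" "\<rho> \<in> strata G" for t \<rho>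
    using push_in_T[of \<rho> t] that TG by (auto simp: h_def)
  have shr: "shrinking G (\<lambda>\<rho>. h (t, \<rho>))" if "t \<in> {0..1}" for t
    unfolding shrinking_def
  proof (intro ballI conjI impI)
    fix \<rho> assume \<rho>: "\<rho> \<in> strata G"
    show "supp (h (t, \<rho>)) \<subseteq> supp \<rho>"
      using fixed[of \<rho> t] suppT[OF push_in_T[of \<rho> t]] that by (cases "supp \<rho> = J") (auto simp: h_def)
    show "h (t, \<rho>) = \<rho>" if "supp \<rho> = U"
      using fixed[of \<rho> t] that \<rho>0(2) by (auto simp: h_def J_def)
  qed
  have "h (1, \<rho>) \<in> strata (G - {J})" if "\<rho> \<in> strata G" for \<rho>
  proof (cases "\<rho> \<in> T")
    case True
    then have "h (1, \<rho>) \<notin> stratum J" using push_1 img by (simp add: h_def)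
    then show ?thesis using hG[of 1, OF _ that] by (auto simp: strata_def stratum_def)
  next
    case False
    then show ?thesis using that Y by (simp add: h_def)
  qed
  moreover have "h (0, \<rho>) = \<rho>" for \<rho> by (simp add: h_def push_0)
  ultimately have "homotopic_with_canon (shrinking G) (strata G) (strata G) id (\<lambda>\<rho>. h (1, \<rho>)) \<and>
      (\<lambda>\<rho>. h (1, \<rho>)) ` strata G \<subseteq> strata (G - {supp \<rho>0})"
    unfolding homotopic_with_def
    using cont hG shr
    by (intro conjI exI[of _ h]) (auto simp: J_def prod_topology_subtopology_eu)
  then show "\<exists>q. homotopic_with_canon (shrinking G) (strata G) (strata G) id q \<and>
           q ` strata G \<subseteq> strata (G - {supp \<rho>0})" by blast
qed

lemma strata_contract:
  assumes "finite G" "down_closed G"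
  shows "\<exists>q. homotopic_with_canon (shrinking G) (strata G) (strata G) id q \<and>
           (\<forall>\<rho>\<in>strata G. supp (q \<rho>) = U)"
  using assms
proof (induction "card G" arbitrary: G rule: less_induct)
  case less
  \<comment> \<open>Only supports that occur are candidates for removal, and \<open>U\<close> is to
    remain.\<close>
  let ?A = "supp ` strata G - {U}"
  show ?case
  proof (cases "?A = {}")
    case True
    have "homotopic_with_canon (shrinking G) (strata G) (strata G) id id"
      by (simp add: shrinking_def)
    then show ?thesis using True by (intro exI[of _ id]) auto
  next
    case False
    have "finite ?A" by (rule finite_subset[OF _ \<open>finite G\<close>]) (auto simp: strata_def)
    then obtain J where J: "J \<in> ?A" "\<And>K. K \<in> ?A \<Longrightarrow> J \<subseteq> K \<Longrightarrow> K = J"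
      using finite_has_maximal[of ?A] False by metis
    then obtain \<rho>0 where \<rho>0: "\<rho>0 \<in> strata G" "supp \<rho>0 = J" "J \<noteq> U" by blast
    have "U \<subseteq> J" using U_supp \<rho>0 by (auto simp: strata_def)
    \<comment> \<open>\<open>J\<close> was chosen maximal among the supports other than
      \<open>U\<close>; since \<open>U \<subseteq> J\<close>, the support \<open>U\<close> cannot
      lie above it either.\<close>
    have max: "supp \<sigma> = supp \<rho>0" if "\<sigma> \<in> strata G" "supp \<rho>0 \<subseteq> supp \<sigma>" for \<sigma>
      using J(2)[of "supp \<sigma>"] that \<rho>0(2,3) \<open>U \<subseteq> J\<close> by auto
    have ne: "supp \<rho>0 \<noteq> U" using \<rho>0 by simp
    let ?G' = "G - {supp \<rho>0}"
    note rs = remove_stratum[OF \<open>down_closed G\<close> \<rho>0(1) ne max]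
    obtain q where q: "homotopic_with_canon (shrinking G) (strata G) (strata G) id q"
      "q ` strata G \<subseteq> strata ?G'"
      using rs(2) by blast
    have "supp \<rho>0 \<in> G" using \<rho>0(1) by (simp add: strata_def)
    then have "card ?G' < card G" using \<open>finite G\<close> by (intro psubset_card_mono) auto
    then obtain q' where q': "homotopic_with_canon (shrinking ?G') (strata ?G') (strata ?G') id q'"
      "\<forall>\<rho>\<in>strata ?G'. supp (q' \<rho>) = U"
      using less.hyps[of ?G'] rs(1) \<open>finite G\<close> by blast
    have shq: "shrinking G q" using homotopic_with_imp_property[OF q(1)] by blast
    have contq: "continuous_on (strata G) q"
      using homotopic_with_imp_continuous[OF q(1)] by blast
    have sub: "strata ?G' \<subseteq> strata G" by (auto simp: strata_def)
    have comp: "shrinking G (j \<circ> q)" if "shrinking ?G' j" for j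
      unfolding shrinking_def
    proof (intro ballI conjI impI)
      fix \<rho> assume \<rho>: "\<rho> \<in> strata G"
      then have q\<rho>: "q \<rho> \<in> strata ?G'" "supp (q \<rho>) \<subseteq> supp \<rho>" "supp \<rho> = U \<Longrightarrow> q \<rho> = \<rho>"
        using q(2) shq by (auto simp: shrinking_def)
      show "supp ((j \<circ> q) \<rho>) \<subseteq> supp \<rho>" using that q\<rho> by (auto simp: shrinking_def)
      show "(j \<circ> q) \<rho> = \<rho>" if "supp \<rho> = U"
        using \<open>shrinking ?G' j\<close> q\<rho> that by (auto simp: shrinking_def)
    qed
    \<comment> \<open>Precomposed with \<open>q\<close>, the homotopy on the smaller set starts at
      \<open>q\<close> and so continues the one that removed the stratum.\<close>
    have "homotopic_with_canon (shrinking G) (strata G) (strata ?G') (id \<circ> q) (q' \<circ> q)"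
      by (rule homotopic_with_compose_continuous_map_right[OF q'(1)])
         (use contq q(2) comp in \<open>auto simp: continuous_map_in_subtopology\<close>)
    then have "homotopic_with_canon (shrinking G) (strata G) (strata G) q (q' \<circ> q)"
      using homotopic_with_subset_right[OF _ sub] by simp
    then have "homotopic_with_canon (shrinking G) (strata G) (strata G) id (q' \<circ> q)"
      by (rule homotopic_with_trans[OF q(1)])
    then show ?thesis using q'(2) q(2) by (intro exI[of _ "q' \<circ> q"]) auto
  qed
qed

theorem toric_contract:
  obtains h where "continuous_on ({0..1} \<times> V) h" "h ` ({0..1} \<times> V) \<subseteq> V"
    "\<And>\<rho>. \<rho> \<in> V \<Longrightarrow> h (0::real, \<rho>) = \<rho>" "\<And>\<rho>. \<rho> \<in> V \<Longrightarrow> supp (h (1, \<rho>)) = U"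
    "\<And>t \<rho>. t \<in> {0..1} \<Longrightarrow> \<rho> \<in> V \<Longrightarrow> supp (h (t, \<rho>)) \<subseteq> supp \<rho>"
    "\<And>t \<rho>. t \<in> {0..1} \<Longrightarrow> \<rho> \<in> V \<Longrightarrow> supp \<rho> = U \<Longrightarrow> h (t, \<rho>) = \<rho>"
proof -
  let ?G = "Pow {..<n}"
  have V: "strata ?G = V" using V_supp by (auto simp: strata_def)
  have "finite ?G" by simp
  moreover have "down_closed ?G" using V_supp by (auto simp: down_closed_def)
  ultimately obtain q where q: "homotopic_with_canon (shrinking ?G) V V id q" "\<forall>\<rho>\<in>V. supp (q \<rho>) = U"
    using strata_contract[of ?G] V by auto
  obtain h where h: "continuous_map (prod_topology (top_of_set {0..1::real}) (top_of_set V)) (top_of_set V) h"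
    "\<forall>\<rho>. h (0, \<rho>) = id \<rho>" "\<forall>\<rho>. h (1, \<rho>) = q \<rho>" "\<forall>t\<in>{0..1}. shrinking ?G (\<lambda>\<rho>. h (t, \<rho>))"
    using q(1) unfolding homotopic_with_def by blast
  show ?thesis
    by (rule that[of h]) (use h q(2) V in \<open>auto simp: shrinking_def prod_topology_subtopology_eu\<close>)
qed

end

section \<open>Points of a finitely generated binoid\<close>

lemma int_subgroup_scale:
  fixes K :: "('i \<Rightarrow> int) set"
  assumes zero: "(\<lambda>_. 0) \<in> K" and add: "\<And>k l. k \<in> K \<Longrightarrow> l \<in> K \<Longrightarrow> (\<lambda>i. k i + l i) \<in> K"
    and neg: "\<And>k. k \<in> K \<Longrightarrow> (\<lambda>i. - k i) \<in> K" and k: "k \<in> K"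
  shows "(\<lambda>i. c * k i) \<in> K"
proof -
  have nat: "(\<lambda>i. int m * k i) \<in> K" for m
  proof (induction m)
    case 0
    show ?case using zero by simp
  next
    case (Suc m)
    then show ?case using add[OF Suc k] by (simp add: distrib_right add.commute)
  qed
  show ?thesis
  proof (cases "0 \<le> c")
    case True
    then show ?thesis using nat[of "nat c"] by simp
  next
    case False
    then show ?thesis using neg[OF nat[of "nat (- c)"]] by simp
  qed
qed

text \<open>Induction on the coordinates, kept over the integers so that the positive vector is an
  actual element of \<open>K\<close>. When a vector positive on \<open>J\<close> is negative at the
  new coordinate \<open>j\<close>, the induction hypothesis is applied again, to the subgroup of
  vectors vanishing at \<open>j\<close>; a weight found there extends to \<open>j\<close> by
  elimination.\<close>

lemma int_subgroup_stiemke: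
  fixes K :: "('i \<Rightarrow> int) set"
  assumes "finite J"
    and "(\<lambda>_. 0) \<in> K" and "\<And>k l. k \<in> K \<Longrightarrow> l \<in> K \<Longrightarrow> (\<lambda>i. k i + l i) \<in> K"
    and "\<And>k. k \<in> K \<Longrightarrow> (\<lambda>i. - k i) \<in> K"
  shows "(\<exists>k\<in>K. \<forall>i\<in>J. 0 < k i) \<or>
    (\<exists>\<delta>. (\<forall>i\<in>J. 0 \<le> \<delta> i) \<and> (\<exists>i\<in>J. 0 < \<delta> i) \<and> (\<forall>k\<in>K. (\<Sum>i\<in>J. \<delta> i * k i) = 0))"
  using assms
proof (induction J arbitrary: K rule: finite_induct)
  case empty
  then show ?case by blast
next
  case (insert j J)
  note zero = insert.prems(1) and add = insert.prems(2) and neg = insert.prems(3)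
  have scale: "(\<lambda>i. c * k i) \<in> K" if "k \<in> K" for c k
    using int_subgroup_scale[of K k c] zero add neg that by blast
  \<comment> \<open>With a vanishing \<open>j\<close>-th entry, either a large multiple of
    \<open>p\<close> can be corrected by some \<open>v\<close> with \<open>v j > 0\<close>, or all
    of \<open>K\<close> vanishes at \<open>j\<close> and the indicator of \<open>j\<close> is a
    weight.\<close>
  have boundary: ?case if p: "p \<in> K" "\<forall>i\<in>J. 0 < p i" "p j = 0" for p
  proof (cases "\<exists>v\<in>K. v j \<noteq> 0")
    case True
    then obtain v where "v \<in> K" "v j \<noteq> 0" by blast
    then obtain v where v: "v \<in> K" "v j > 0"
      using neg[of v] by (cases "v j > 0") (auto simp: not_less)
    \<comment> \<open>Larger than every \<open>\<bar>v i\<bar>\<close> on \<open>J\<close>, where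
      integrality gives \<open>p i \<ge> 1\<close>.\<close>
    define m where "m = (\<Sum>i\<in>J. \<bar>v i\<bar>) + 1"
    have "(\<lambda>i. m * p i + v i) \<in> K" using add scale p(1) v(1) by blast
    moreover have "m * p i + v i > 0" if "i \<in> J" for i
    proof -
      have "\<bar>v i\<bar> < m"
        using member_le_sum[of i J "\<lambda>i. \<bar>v i\<bar>"] that insert.hyps(1) by (simp add: m_def)
      moreover have "m * 1 \<le> m * p i"
        using p(2) that \<open>\<bar>v i\<bar> < m\<close> by (intro mult_left_mono) fastforce+
      ultimately show ?thesis by linarith
    qed
    moreover have "m * p j + v j > 0" using p(3) v(2) by simp
    ultimately show ?thesis by (intro disjI1 bexI[of _ "\<lambda>i. m * p i + v i"]) auto
  next
    case False
    have "(\<Sum>i\<in>insert j J. (if i = j then 1 else 0) * k i) = 0" if "k \<in> K" for k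
      by (rule sum.neutral) (use False that in auto)
    then show ?thesis
      by (intro disjI2 exI[of _ "\<lambda>i. if i = j then 1 else 0"]) auto
  qed
  from insert.IH[OF zero add neg] consider
    (pos) p where "p \<in> K" "\<forall>i\<in>J. 0 < p i" |
    (perp) \<delta> where "\<forall>i\<in>J. 0 \<le> \<delta> i" "\<exists>i\<in>J. 0 < \<delta> i" "\<forall>k\<in>K. (\<Sum>i\<in>J. \<delta> i * k i) = 0"
    by blast
  then show ?case
  proof cases
    case perp
    have "(\<Sum>i\<in>insert j J. (\<delta>(j := 0)) i * k i) = (\<Sum>i\<in>J. \<delta> i * k i)" for k
      using insert.hyps by (auto intro!: sum.cong)
    then have "\<forall>k\<in>K. (\<Sum>i\<in>insert j J. (\<delta>(j := 0)) i * k i) = 0" using perp(3) by simp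
    moreover have "\<exists>i\<in>J. 0 < (\<delta>(j := 0)) i"
      using perp(2) insert.hyps(2) by (metis fun_upd_other)
    moreover have "\<forall>i\<in>insert j J. 0 \<le> (\<delta>(j := 0)) i" using perp(1) by simp
    ultimately show ?thesis by (intro disjI2 exI[of _ "\<delta>(j := 0)"]) blast
  next
    case pos
    show ?thesis
    proof (cases "p j \<ge> 0")
      case True
      show ?thesis
      proof (cases "p j = 0")
        case False
        then have "\<forall>i\<in>insert j J. 0 < p i" using True pos(2) by simp
        then show ?thesis using pos(1) by blast
      qed (rule boundary[OF pos])
    next
      case False
      let ?K0 = "{k \<in> K. k j = 0}"
      have "(\<exists>k\<in>?K0. \<forall>i\<in>J. 0 < k i) \<or>
        (\<exists>\<delta>. (\<forall>i\<in>J. 0 \<le> \<delta> i) \<and> (\<exists>i\<in>J. 0 < \<delta> i) \<and> (\<forall>k\<in>?K0. (\<Sum>i\<in>J. \<delta> i * k i) = 0))"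
        by (rule insert.IH) (use zero add neg in auto)
      then consider
        (pos0) q where "q \<in> ?K0" "\<forall>i\<in>J. 0 < q i" |
        (perp0) \<delta> where "\<forall>i\<in>J. 0 \<le> \<delta> i" "\<exists>i\<in>J. 0 < \<delta> i" "\<forall>k\<in>?K0. (\<Sum>i\<in>J. \<delta> i * k i) = 0"
        by blast
      then show ?thesis
      proof cases
        case pos0
        then show ?thesis using boundary by blast
      next
        case perp0
        define S where "S k = (\<Sum>i\<in>J. \<delta> i * k i)" for k
        \<comment> \<open>For \<open>k \<in> K\<close> the vector \<open>p j * k - k j * p\<close>
          lies in \<open>?K0\<close>, so \<open>p j * S k = k j * S p\<close>. This says that the
          weight \<open>\<epsilon>\<close> is orthogonal to \<open>k\<close>; its signs are right
          because \<open>p j < 0\<close> and \<open>S p \<ge> 0\<close>.\<close>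
        define \<epsilon> where "\<epsilon> i = (if i = j then S p else - p j * \<delta> i)" for i
        have Sp: "0 \<le> S p"
          unfolding S_def using perp0(1) pos(2) by (intro sum_nonneg mult_nonneg_nonneg) (auto intro: less_imp_le)
        have "(\<Sum>i\<in>insert j J. \<epsilon> i * k i) = 0" if "k \<in> K" for k
        proof -
          have "(\<lambda>i. p j * k i + - k j * p i) \<in> K"
            by (rule add[OF scale[OF that] scale[OF pos(1)]])
          then have "(\<lambda>i. p j * k i + - k j * p i) \<in> ?K0" by simp
          then have "S (\<lambda>i. p j * k i + - k j * p i) = 0" using perp0(3) by (simp add: S_def)
          moreover have "S (\<lambda>i. p j * k i + - k j * p i) = p j * S k - k j * S p"
            by (simp add: S_def sum_subtractf sum_distrib_left algebra_simps)
          moreover have "(\<Sum>i\<in>J. \<epsilon> i * k i) = - p j * S k"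
            unfolding S_def sum_distrib_left \<epsilon>_def using insert.hyps by (intro sum.cong) auto
          ultimately show ?thesis using insert.hyps by (simp add: \<epsilon>_def)
        qed
        moreover have "\<forall>i\<in>insert j J. 0 \<le> \<epsilon> i"
          using Sp False perp0(1) by (auto simp: \<epsilon>_def mult_nonpos_nonneg)
        moreover have "\<exists>i\<in>insert j J. 0 < \<epsilon> i"
        proof -
          obtain i where "i \<in> J" "0 < \<delta> i" using perp0(2) by blast
          then have "0 < \<epsilon> i" using False insert.hyps by (auto simp: \<epsilon>_def mult_neg_pos)
          then show ?thesis using \<open>i \<in> J\<close> by blast
        qed
        ultimately show ?thesis by blast
      qed
    qed
  qed
qed

lemma KSpecI:
  assumes "\<And>x y. x \<in> carrier M \<Longrightarrow> y \<in> carrier M \<Longrightarrow> f (x \<otimes>\<^bsub>M\<^esub> y) = f x * f y"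
    and "f \<one>\<^bsub>M\<^esub> = 1" "f (bzero M) = 0" "f \<in> extensional (carrier M)"
  shows "f \<in> KSpec M"
  using assms by (auto simp: KSpec_def binoid_hom_def hom_def field_binoid_def)

context comm_binoid begin

lemma KSpec_restrictI:
  assumes "\<And>x y. x \<in> carrier M \<Longrightarrow> y \<in> carrier M \<Longrightarrow> f (x \<otimes> y) = f x * f y"
    and "f \<one> = 1" "f (bzero M) = 0"
  shows "restrict f (carrier M) \<in> KSpec M"
  by (rule KSpecI) (use assms in auto)

lemma KSpec_unit_nonzero:
  assumes "f \<in> KSpec M" "x \<in> Units M"
  shows "f x \<noteq> 0"
proof -
  have "f x * f (inv x) = 1"
    using KSpecD(1)[OF assms(1), of x "inv x"] KSpecD(2)[OF assms(1)] assms(2)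
    by (simp add: Units_closed)
  then show ?thesis by auto
qed

end

section \<open>Monomials and coordinates with respect to generators\<close>

locale generated_binoid = comm_binoid +
  fixes es :: "'a list"
  assumes es: "binoid_generators M es"
begin

lemma es_closed: "set es \<subseteq> carrier M" and generate_es: "binoid_generate M (set es) = carrier M"
  using es by (simp_all add: binoid_generators_def)

lemma nth_closed [simp]: "i < length es \<Longrightarrow> es ! i \<in> carrier M"
  using es_closed by auto

lemma carrier_induct [consumes 1, case_names one bzero gen mult]:
  assumes "x \<in> carrier M" "P \<one>" "P (bzero M)" "\<And>i. i < length es \<Longrightarrow> P (es ! i)"
    and "\<And>x y. x \<in> carrier M \<Longrightarrow> y \<in> carrier M \<Longrightarrow> P x \<Longrightarrow> P y \<Longrightarrow> P (x \<otimes> y)"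
  shows "P x"
proof -
  have "x \<in> binoid_generate M (set es)" using assms(1) generate_es by simp
  then show ?thesis
    by induction (use assms generate_es in \<open>auto simp: in_set_conv_nth\<close>)
qed

lemma KSpec_eqI:
  assumes f: "f \<in> KSpec M" and g: "g \<in> KSpec M" and eq: "\<And>i. i < length es \<Longrightarrow> f (es ! i) = g (es ! i)"
  shows "f = g"
proof (rule extensionalityI)
  show "f \<in> extensional (carrier M)" "g \<in> extensional (carrier M)"
    using f g by (simp_all add: KSpec_def)
  show "f x = g x" if "x \<in> carrier M" for x
    using that by (induction rule: carrier_induct) (simp_all add: KSpecD[OF f] KSpecD[OF g] eq)
qed

definition monom :: "(nat \<Rightarrow> nat) \<Rightarrow> 'a" where
  "monom u = finprod M (\<lambda>i. es ! i [^] u i) {..<length es}"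

lemma monom_closed [simp]: "monom u \<in> carrier M"
  unfolding monom_def by (intro finprod_closed) auto

lemma monom_0 [simp]: "monom (\<lambda>_. 0) = \<one>"
  unfolding monom_def by (intro finprod_one_eqI) auto

lemma monom_add: "monom (\<lambda>i. u i + v i) = monom u \<otimes> monom v"
proof -
  have "monom u \<otimes> monom v = finprod M (\<lambda>i. es ! i [^] u i \<otimes> es ! i [^] v i) {..<length es}"
    unfolding monom_def by (subst finprod_multf) auto
  also have "\<dots> = monom (\<lambda>i. u i + v i)"
    unfolding monom_def by (intro finprod_cong') (auto simp: nat_pow_mult)
  finally show ?thesis by simp
qed

lemma monom_single:
  assumes "i < length es"
  shows "monom (\<lambda>j. if j = i then 1 else 0) = es ! i"
proof -
  have "monom (\<lambda>j. if j = i then 1 else 0) = finprod M (\<lambda>j. if i = j then es ! j else \<one>) {..<length es}"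
    unfolding monom_def by (intro finprod_cong') auto
  also have "\<dots> = es ! i" using assms by (intro finprod_singleton) auto
  finally show ?thesis .
qed

lemma eq_monom:
  assumes "x \<in> carrier M"
  shows "x = bzero M \<or> (\<exists>u. x = monom u)"
  using assms
proof (induction rule: carrier_induct)
  case one
  then show ?case using monom_0 by metis
next
  case (gen i)
  then show ?case using monom_single by metis
next
  case (mult x y)
  show ?case
  proof (cases "x = bzero M \<or> y = bzero M")
    case True
    then show ?thesis using mult.hyps by auto
  next
    case False
    then obtain u v where "x = monom u" "y = monom v" using mult.IH by blast
    then have "x \<otimes> y = monom (\<lambda>i. u i + v i)" by (simp add: monom_add)
    then show ?thesis by blast
  qed
qed simp

lemma KSpec_monom:
  assumes f: "f \<in> KSpec M"
  shows "f (monom u) = (\<Prod>i<length es. f (es ! i) ^ u i)"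
proof -
  have pow: "f (x [^] k) = f x ^ k" if "x \<in> carrier M" for x and k :: nat
    by (induction k) (simp_all add: KSpecD[OF f] that mult.commute)
  have "f (finprod M (\<lambda>i. es ! i [^] u i) A) = (\<Prod>i\<in>A. f (es ! i) ^ u i)"
    if "A \<subseteq> {..<length es}" for A
    using finite_subset[OF that finite_lessThan] that
  proof (induction A rule: finite_induct)
    case empty
    then show ?case by (simp add: KSpecD[OF f])
  next
    case (insert i A)
    have "finprod M (\<lambda>i. es ! i [^] u i) (insert i A) = es ! i [^] u i \<otimes> finprod M (\<lambda>i. es ! i [^] u i) A"
      using insert.prems insert.hyps by (intro finprod_insert) auto
    moreover have "finprod M (\<lambda>i. es ! i [^] u i) A \<in> carrier M"
      using insert.prems by (intro finprod_closed) auto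
    ultimately show ?case using insert by (simp add: KSpecD[OF f] pow)
  qed
  then show ?thesis by (simp add: monom_def)
qed

definition KSpec_nonneg :: "('a \<Rightarrow> real) set" where
  "KSpec_nonneg = {f \<in> KSpec M. \<forall>x\<in>carrier M. 0 \<le> f x}"

definition coords :: "('a \<Rightarrow> real) \<Rightarrow> nat \<Rightarrow> real" where
  "coords f = (\<lambda>i. if i < length es then f (es ! i) else 0)"

definition unit_indices :: "nat set" where
  "unit_indices = {i. i < length es \<and> es ! i \<in> Units M}"

lemma KSpec_nonnegI:
  assumes "f \<in> KSpec M" "\<And>i. i < length es \<Longrightarrow> 0 \<le> f (es ! i)"
  shows "f \<in> KSpec_nonneg"
proof -
  have "0 \<le> f x" if "x \<in> carrier M" for x
    using that by (induction rule: carrier_induct) (simp_all add: KSpecD[OF assms(1)] assms(2))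
  then show ?thesis using assms(1) by (simp add: KSpec_nonneg_def)
qed

text \<open>Convergence at the generators spreads to all elements of the binoid by induction over
  products, and a pointwise limit of homomorphisms is a homomorphism.\<close>

lemma closed_coords: "closed (coords ` KSpec_nonneg)"
  unfolding closed_sequential_limits
proof (intro allI impI, elim conjE)
  fix \<rho> l assume "\<forall>k. \<rho> k \<in> coords ` KSpec_nonneg" and lim: "\<rho> \<longlonglongrightarrow> l"
  then have "\<forall>k. \<exists>f. f \<in> KSpec_nonneg \<and> \<rho> k = coords f" by blast
  then obtain f where f: "\<And>k. f k \<in> KSpec_nonneg" and \<rho>: "\<And>k. \<rho> k = coords (f k)" by metis
  have fK: "f k \<in> KSpec M" for k using f by (simp add: KSpec_nonneg_def)
  have lim': "(\<lambda>k. coords (f k) i) \<longlonglongrightarrow> l i" for i using lim by (simp add: \<rho> tendsto_fun_iff)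
  have gen: "(\<lambda>k. f k (es ! i)) \<longlonglongrightarrow> l i" if "i < length es" for i
    using lim'[of i] that by (simp add: coords_def)
  have "convergent (\<lambda>k. f k x)" if "x \<in> carrier M" for x
    using that
  proof (induction rule: carrier_induct)
    case (gen i)
    then show ?case using \<open>\<And>i. i < length es \<Longrightarrow> (\<lambda>k. f k (es ! i)) \<longlonglongrightarrow> l i\<close> convergentI by blast
  qed (simp_all add: KSpecD[OF fK] convergent_const convergent_mult)
  then have conv: "(\<lambda>k. f k x) \<longlonglongrightarrow> lim (\<lambda>k. f k x)" if "x \<in> carrier M" for x
    using that by (simp add: convergent_LIMSEQ_iff)
  define g where "g = restrict (\<lambda>x. lim (\<lambda>k. f k x)) (carrier M)"
  have "g \<in> KSpec M"
    unfolding g_def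
  proof (rule KSpec_restrictI)
    fix x y assume xy: "x \<in> carrier M" "y \<in> carrier M"
    have "(\<lambda>k. f k (x \<otimes> y)) \<longlonglongrightarrow> lim (\<lambda>k. f k x) * lim (\<lambda>k. f k y)"
      using tendsto_mult[OF conv[OF xy(1)] conv[OF xy(2)]] xy by (simp add: KSpecD[OF fK])
    then show "lim (\<lambda>k. f k (x \<otimes> y)) = lim (\<lambda>k. f k x) * lim (\<lambda>k. f k y)" by (rule limI)
  qed (simp_all add: KSpecD[OF fK])
  moreover have gl: "g (es ! i) = l i" if "i < length es" for i
    using limI[OF gen[OF that]] that by (simp add: g_def)
  moreover have "0 \<le> l i" if "i < length es" for i
    by (rule LIMSEQ_le_const[OF gen[OF that]]) (use f that in \<open>simp add: KSpec_nonneg_def\<close>)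
  ultimately have "g \<in> KSpec_nonneg" by (intro KSpec_nonnegI) simp_all
  moreover have "l i = 0" if "\<not> i < length es" for i
    using lim'[of i] that by (simp add: coords_def LIMSEQ_const_iff)
  then have "coords g = l" by (auto simp: coords_def gl)
  ultimately show "l \<in> coords ` KSpec_nonneg" by blast
qed

text \<open>If the exponent vectors \<open>u - v\<close> of the relations \<open>monom u = monom v\<close> on the support of
  \<open>f\<close> contain a positive one, a multiple of it is the exponent of an idempotent, necessarily
  \<open>1\<close>, so that the support consists of units. Otherwise the alternative provides a weight
  \<open>\<delta>\<close> orthogonal to all of them, and \<open>x \<mapsto> exp (- \<delta> \<cdot> u)\<close> for \<open>x = monom u\<close> is well defined.\<close>

lemma KSpec_contracting:
  assumes idem: "\<And>e. e \<in> carrier M \<Longrightarrow> e \<otimes> e = e \<Longrightarrow> e = bzero M \<or> e = \<one>"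
    and f: "f \<in> KSpec_nonneg" and ne: "supp (coords f) \<noteq> unit_indices"
  shows "\<exists>g\<in>KSpec_nonneg. supp (coords g) = supp (coords f) \<and> (\<forall>i. coords g i \<le> 1) \<and>
    (\<exists>i\<in>supp (coords f). coords g i < 1)"
proof -
  define J where "J = supp (coords f)"
  have fK: "f \<in> KSpec M" using f by (simp add: KSpec_nonneg_def)
  have J: "J = {i. i < length es \<and> f (es ! i) \<noteq> 0}" by (auto simp: J_def supp_def coords_def)
  then have "finite J" by simp
  have UJ: "unit_indices \<subseteq> J" using KSpec_unit_nonzero[OF fK] by (auto simp: unit_indices_def J)
  have mono_nonzero: "f (monom u) \<noteq> 0 \<longleftrightarrow> (\<forall>i<length es. i \<notin> J \<longrightarrow> u i = 0)" for u
    by (auto simp: KSpec_monom[OF fK] J)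
  \<comment> \<open>Only relations between monomials at which \<open>f\<close> does not vanish
    count: their exponents are zero at the generators outside \<open>J\<close>, and multiplicativity
    of \<open>f\<close> preserves the condition when relations are added, so that \<open>K\<close>
    is a group.\<close>
  define K where "K = {k. \<exists>u v. monom u = monom v \<and> f (monom u) \<noteq> 0 \<and> (\<forall>i. k i = int (u i) - int (v i))}"
  have "(\<exists>k\<in>K. \<forall>i\<in>J. 0 < k i) \<or>
    (\<exists>\<delta>. (\<forall>i\<in>J. 0 \<le> \<delta> i) \<and> (\<exists>i\<in>J. 0 < \<delta> i) \<and> (\<forall>k\<in>K. (\<Sum>i\<in>J. \<delta> i * k i) = 0))"
  proof (rule int_subgroup_stiemke[OF \<open>finite J\<close>])
    show "(\<lambda>_. 0) \<in> K"
      unfolding K_def using KSpecD(2)[OF fK] by (auto intro!: exI[of _ "\<lambda>_. 0"])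
    show "(\<lambda>i. k i + l i) \<in> K" if "k \<in> K" "l \<in> K" for k l
    proof -
      obtain u v where uv: "monom u = monom v" "f (monom u) \<noteq> 0" "\<And>i. k i = int (u i) - int (v i)"
        using \<open>k \<in> K\<close> by (auto simp: K_def)
      obtain u' v' where uv': "monom u' = monom v'" "f (monom u') \<noteq> 0" "\<And>i. l i = int (u' i) - int (v' i)"
        using \<open>l \<in> K\<close> by (auto simp: K_def)
      have "monom (\<lambda>i. u i + u' i) = monom (\<lambda>i. v i + v' i)" using uv uv' by (simp add: monom_add)
      moreover have "f (monom (\<lambda>i. u i + u' i)) \<noteq> 0" using uv uv' by (simp add: monom_add KSpecD[OF fK])
      ultimately show ?thesis
        unfolding K_def
        by (intro CollectI exI[of _ "\<lambda>i. u i + u' i"] exI[of _ "\<lambda>i. v i + v' i"]) (simp add: uv uv')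
    qed
    show "(\<lambda>i. - k i) \<in> K" if "k \<in> K" for k
    proof -
      obtain u v where "monom u = monom v" "f (monom u) \<noteq> 0" "\<And>i. k i = int (u i) - int (v i)"
        using \<open>k \<in> K\<close> by (auto simp: K_def)
      then show ?thesis unfolding K_def by (intro CollectI exI[of _ v] exI[of _ u]) simp
    qed
  qed
  moreover have False if "k \<in> K" "\<forall>i\<in>J. 0 < k i" for k
  proof -
    obtain u v where uv: "monom u = monom v" "f (monom u) \<noteq> 0" "\<And>i. k i = int (u i) - int (v i)"
      using \<open>k \<in> K\<close> by (auto simp: K_def)
    have off: "u i = 0" "v i = 0" if "i < length es" "i \<notin> J" for i
      using uv(1,2) mono_nonzero[of u] mono_nonzero[of v] that by auto
    \<comment> \<open>Truncated subtraction is exact here: \<open>u\<close> exceeds \<open>v\<close>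
      on \<open>J\<close>, and both vanish at the other generators. Hence \<open>monom v\<close>
      absorbs \<open>monom w\<close>.\<close>
    define w where "w i = u i - v i" for i
    have wpos: "0 < w i" "u i = v i + w i" if "i \<in> J" for i
      using \<open>\<forall>i\<in>J. 0 < k i\<close> that uv(3)[of i] by (auto simp: w_def)
    have cong: "monom a = monom b" if "\<And>i. i < length es \<Longrightarrow> a i = b i" for a b
      unfolding monom_def by (intro finprod_cong') (use that in auto)
    have step: "monom v \<otimes> monom w = monom v"
      unfolding uv(1)[symmetric]
      by (subst uv(1), subst monom_add[symmetric], rule cong) (metis wpos(2) off add.right_neutral w_def diff_0_eq_0)
    \<comment> \<open>\<open>c \<ge> v i\<close> on \<open>J\<close> makes \<open>monom v\<close>
      divide the \<open>c\<close>-th power of \<open>monom w\<close>; the \<open>Suc\<close> keeps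
      \<open>c * w i\<close> positive on \<open>J\<close> even for \<open>v = 0\<close>, so that a
      factor \<open>es ! i\<close> can be split off below.\<close>
    define c where "c = Suc (\<Sum>i\<in>J. v i)"
    have "monom v \<otimes> monom (\<lambda>i. m * w i) = monom v" for m
    proof (induction m)
      case (Suc m)
      have "monom (\<lambda>i. Suc m * w i) = monom (\<lambda>i. m * w i) \<otimes> monom w"
        by (simp add: monom_add[symmetric] add.commute)
      then show ?case using Suc step by (simp add: m_assoc[symmetric])
    qed simp
    note absorb = this[of c]
    have v_le: "v i \<le> c * w i" if "i < length es" for i
    proof (cases "i \<in> J")
      case True
      then have "v i \<le> c" using member_le_sum[of i J v] \<open>finite J\<close> by (simp add: c_def)
      also have "\<dots> \<le> c * w i" using wpos(1)[OF True] by simp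
      finally show ?thesis .
    qed (use off that in simp)
    define p where "p = monom (\<lambda>i. c * w i)"
    have split: "p = monom v \<otimes> monom (\<lambda>i. c * w i - v i)"
      unfolding p_def by (subst monom_add[symmetric], rule cong) (use v_le in simp)
    have pc: "p \<in> carrier M" by (simp add: p_def)
    \<comment> \<open>Write \<open>v\<close> for its monomial and \<open>q\<close> for the cofactor:
      with \<open>p = q v\<close> and \<open>v p = v\<close> one gets
      \<open>p p = q v p = q v = p\<close>.\<close>
    have "p \<otimes> p = monom (\<lambda>i. c * w i - v i) \<otimes> (monom v \<otimes> p)"
      by (subst split) (simp add: pc m_ac)
    also have "\<dots> = p" using absorb split by (simp add: p_def m_comm)
    finally have "p = bzero M \<or> p = \<one>" using idem pc by blast
    \<comment> \<open>The point \<open>f\<close> separates \<open>p\<close> from zero, which leaves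
      \<open>p = \<one>\<close>. Every \<open>es ! i\<close> with \<open>i \<in> J\<close> divides
      \<open>p\<close> and is therefore a unit.\<close>
    moreover have "f p \<noteq> 0" unfolding p_def mono_nonzero by (simp add: w_def off)
    ultimately have p1: "p = \<one>" using KSpecD(3)[OF fK] by auto
    have "i \<in> unit_indices" if "i \<in> J" for i
    proof -
      have i: "i < length es" using that J by simp
      have "p = monom (\<lambda>j. if j = i then 1 else 0) \<otimes> monom (\<lambda>j. if j = i then c * w j - 1 else c * w j)"
        unfolding p_def by (subst monom_add[symmetric], rule cong) (use wpos(1)[OF that] in \<open>auto simp: c_def\<close>)
      then have "es ! i \<otimes> monom (\<lambda>j. if j = i then c * w j - 1 else c * w j) = \<one>"
        using p1 monom_single[OF i] by simp
      then have "es ! i \<otimes> monom (\<lambda>j. if j = i then c * w j - 1 else c * w j) \<in> Units M"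
        by (simp only: Units_one_closed)
      then have "es ! i \<in> Units M" using unit_factors(1) i by (meson monom_closed nth_closed)
      then show ?thesis using i by (simp add: unit_indices_def)
    qed
    then show False using UJ ne by (auto simp: J_def)
  qed
  ultimately obtain \<delta> where \<delta>: "\<And>i. i \<in> J \<Longrightarrow> 0 \<le> \<delta> i" "\<exists>i\<in>J. 0 < \<delta> i"
    and perp: "\<And>k. k \<in> K \<Longrightarrow> (\<Sum>i\<in>J. \<delta> i * k i) = 0" by blast
  define d where "d u = (\<Sum>i\<in>J. \<delta> i * int (u i))" for u
  have d_cong: "d u = d v" if "monom u = monom v" "f (monom u) \<noteq> 0" for u v
  proof -
    have "(\<lambda>i. int (u i) - int (v i)) \<in> K" unfolding K_def using that by blast
    from perp[OF this] show ?thesis by (simp add: d_def right_diff_distrib sum_subtractf)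
  qed
  \<comment> \<open>Any exponent vector of \<open>x\<close> will do: where \<open>f\<close> does not
    vanish, \<open>d_cong\<close> makes \<open>d\<close> independent of the choice.\<close>
  define e where "e x = (SOME u. x = monom u)" for x
  have e: "monom (e x) = x" if "x \<in> carrier M" "f x \<noteq> 0" for x
  proof -
    have "\<exists>u. x = monom u" using eq_monom[OF that(1)] KSpecD(3)[OF fK] that(2) by auto
    then show ?thesis unfolding e_def by (intro sym[OF someI_ex[of "\<lambda>u. x = monom u"]])
  qed
  define g where "g = restrict (\<lambda>x. if f x = 0 then 0 else exp (- real_of_int (d (e x)))) (carrier M)"
  have g_monom: "g (monom u) = exp (- real_of_int (d u))" if "f (monom u) \<noteq> 0" for u
    using d_cong[of "e (monom u)" u] e[of "monom u"] that by (simp add: g_def)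
  have gK: "g \<in> KSpec M"
    unfolding g_def
  proof (rule KSpec_restrictI)
    fix x y assume xy: "x \<in> carrier M" "y \<in> carrier M"
    show "(if f (x \<otimes> y) = 0 then 0 else exp (- real_of_int (d (e (x \<otimes> y))))) =
      (if f x = 0 then 0 else exp (- real_of_int (d (e x)))) *
      (if f y = 0 then 0 else exp (- real_of_int (d (e y))))"
    proof (cases "f x = 0 \<or> f y = 0")
      case True
      then show ?thesis using xy by (auto simp: KSpecD[OF fK])
    next
      case False
      then have nz: "f (x \<otimes> y) \<noteq> 0" using xy by (simp add: KSpecD[OF fK])
      have "monom (e (x \<otimes> y)) = monom (\<lambda>i. e x i + e y i)"
        using e[of x] e[of y] e[of "x \<otimes> y"] xy nz False by (simp add: monom_add)
      then have "d (e (x \<otimes> y)) = d (\<lambda>i. e x i + e y i)"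
        using d_cong[of "e (x \<otimes> y)"] e[of "x \<otimes> y"] xy nz by simp
      also have "\<dots> = d (e x) + d (e y)" by (simp add: d_def distrib_left sum.distrib)
      finally show ?thesis using False nz by (simp add: exp_add[symmetric])
    qed
  next
    have "d (e \<one>) = d (\<lambda>_. 0)"
      using d_cong[of "e \<one>" "\<lambda>_. 0"] e[of \<one>] KSpecD(2)[OF fK] by simp
    then show "(if f \<one> = 0 then 0 else exp (- real_of_int (d (e \<one>)))) = 1"
      using KSpecD(2)[OF fK] by (simp add: d_def)
  qed (simp add: KSpecD[OF fK])
  have g_gen: "g (es ! i) = exp (- real_of_int (\<delta> i))" if "i \<in> J" for i
  proof -
    have i: "i < length es" "f (es ! i) \<noteq> 0" using that by (simp_all add: J)
    then have "g (es ! i) = exp (- real_of_int (d (\<lambda>j. if j = i then 1 else 0)))"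
      using g_monom[of "\<lambda>j. if j = i then 1 else 0"] monom_single[OF i(1)] by simp
    also have "d (\<lambda>j. if j = i then 1 else 0) = \<delta> i"
      using that \<open>finite J\<close> by (simp add: d_def if_distrib sum.delta cong: if_cong)
    finally show ?thesis .
  qed
  have g_off: "coords g i = 0" if "i \<notin> J" for i
    using that by (auto simp: J coords_def g_def)
  have g_on: "coords g i = exp (- real_of_int (\<delta> i))" if "i \<in> J" for i
    using g_gen[OF that] that by (simp add: J coords_def)
  have "g \<in> KSpec_nonneg" by (rule KSpec_nonnegI[OF gK]) (simp add: g_def)
  moreover have "supp (coords g) = J" using g_off g_on by (auto simp: supp_def)
  moreover have "coords g i \<le> 1" for i using g_off g_on \<delta>(1) by (cases "i \<in> J") simp_all
  moreover have "\<exists>i\<in>J. coords g i < 1" using \<delta>(2) g_on by auto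
  ultimately show ?thesis unfolding J_def by blast
qed

lemma positive_toric_set_coords:
  assumes idem: "\<And>e. e \<in> carrier M \<Longrightarrow> e \<otimes> e = e \<Longrightarrow> e = bzero M \<or> e = \<one>"
  shows "positive_toric_set (length es) (coords ` KSpec_nonneg) unit_indices"
proof
  show "closed (coords ` KSpec_nonneg)" by (rule closed_coords)
  fix \<rho> assume "\<rho> \<in> coords ` KSpec_nonneg"
  then obtain f where f: "f \<in> KSpec_nonneg" "\<rho> = coords f" by blast
  then have fK: "f \<in> KSpec M" and f0: "\<And>x. x \<in> carrier M \<Longrightarrow> 0 \<le> f x"
    by (simp_all add: KSpec_nonneg_def)
  show "0 \<le> \<rho> i" for i using f0 f(2) by (simp add: coords_def)
  show "supp \<rho> \<subseteq> {..<length es}" using f(2) by (auto simp: supp_def coords_def)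
  show "unit_indices \<subseteq> supp \<rho>"
    using KSpec_unit_nonzero[OF fK] f(2) by (auto simp: supp_def coords_def unit_indices_def)
  show "(\<lambda>i. \<rho> i powr s) \<in> coords ` KSpec_nonneg" for s
  proof -
    let ?g = "restrict (\<lambda>x. f x powr s) (carrier M)"
    have "?g \<in> KSpec M"
      by (rule KSpec_restrictI) (simp_all add: KSpecD[OF fK] f0 powr_mult)
    then have "?g \<in> KSpec_nonneg" by (rule KSpec_nonnegI) simp
    moreover have "(\<lambda>i. \<rho> i powr s) = coords ?g" by (auto simp: coords_def f(2))
    ultimately show ?thesis by (simp only: imageI)
  qed
  show "\<exists>\<sigma>\<in>coords ` KSpec_nonneg. supp \<sigma> = supp \<rho> \<and> (\<forall>i. \<sigma> i \<le> 1) \<and> (\<exists>i\<in>supp \<rho>. \<sigma> i < 1)"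
    if "supp \<rho> \<noteq> unit_indices"
    using KSpec_contracting[OF idem f(1)] that f(2) by blast
  fix \<sigma> assume "\<sigma> \<in> coords ` KSpec_nonneg"
  then obtain g where g: "g \<in> KSpec_nonneg" "\<sigma> = coords g" by blast
  then have gK: "g \<in> KSpec M" and g0: "\<And>x. x \<in> carrier M \<Longrightarrow> 0 \<le> g x"
    by (simp_all add: KSpec_nonneg_def)
  let ?h = "restrict (\<lambda>x. f x * g x) (carrier M)"
  have "?h \<in> KSpec M"
    by (rule KSpec_restrictI) (simp_all add: KSpecD[OF fK] KSpecD[OF gK])
  then have "?h \<in> KSpec_nonneg" by (rule KSpec_nonnegI) (simp add: f0 g0)
  moreover have "(\<lambda>i. \<rho> i * \<sigma> i) = coords ?h" by (auto simp: coords_def f(2) g(2))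
  ultimately show "(\<lambda>i. \<rho> i * \<sigma> i) \<in> coords ` KSpec_nonneg" by (simp only: imageI)
qed

end

section \<open>Contraction of the space of points\<close>

text \<open>\<open>sgn\<close> is discontinuous only at \<open>0\<close>, and near such a point it
  is bounded by \<open>1\<close> while the factor \<open>g\<close> tends to
  \<open>0\<close>.\<close>

lemma continuous_map_scaleR_sgn:
  fixes z :: "'x \<Rightarrow> 'k::real_normed_vector"
  assumes g: "continuous_map X euclidean g" and z: "continuous_map X euclidean z"
    and zero: "\<And>x. x \<in> topspace X \<Longrightarrow> z x = 0 \<Longrightarrow> g x = 0"
  shows "continuous_map X euclidean (\<lambda>x. g x *\<^sub>R sgn (z x))"
  unfolding continuous_map_atin limitin_canonical_iff
proof
  fix x assume x: "x \<in> topspace X"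
  have gl: "(g \<longlongrightarrow> g x) (atin X x)" and zl: "(z \<longlongrightarrow> z x) (atin X x)"
    using g z x by (simp_all add: continuous_map_atin)
  show "((\<lambda>x. g x *\<^sub>R sgn (z x)) \<longlongrightarrow> g x *\<^sub>R sgn (z x)) (atin X x)"
  proof (cases "z x = 0")
    case True
    then have "g x = 0" using zero x by blast
    then have "(g \<longlongrightarrow> 0) (atin X x)" using gl by simp
    then have "((\<lambda>x. \<bar>g x\<bar>) \<longlongrightarrow> 0) (atin X x)" by (rule tendsto_rabs_zero)
    moreover have "\<forall>\<^sub>F y in atin X x. norm (g y *\<^sub>R sgn (z y)) \<le> \<bar>g y\<bar>"
      by (intro always_eventually allI) (simp add: norm_sgn)
    ultimately have "((\<lambda>x. g x *\<^sub>R sgn (z x)) \<longlongrightarrow> 0) (atin X x)"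
      by (rule Lim_null_comparison[rotated])
    then show ?thesis using \<open>g x = 0\<close> by simp
  next
    case False
    then show ?thesis by (intro tendsto_scaleR gl tendsto_sgn zl)
  qed
qed

lemma continuous_map_into_KSpec:
  fixes F :: "'x \<Rightarrow> 'a \<Rightarrow> 'k::real_normed_field"
  assumes "\<And>x. x \<in> topspace X \<Longrightarrow> F x \<in> KSpec M"
    and "\<And>i. i < length es \<Longrightarrow> continuous_map X euclidean (\<lambda>x. F x (es ! i))"
  shows "continuous_map X (KSpec_topology_wrt M es) F"
  unfolding KSpec_topology_wrt_def
proof (rule continuous_map_pullback')
  show "continuous_map X (product_topology (\<lambda>_. euclidean) {..<length es}) (generator_eval es \<circ> F)"
    using assms(2) by (simp add: continuous_map_componentwise generator_eval_def comp_def image_subset_iff)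
  show "topspace X \<subseteq> F -` KSpec M" using assms(1) by blast
qed

lemma KSpec_pullback_apply: "x \<in> carrier M \<Longrightarrow> KSpec_pullback M f g x = g (f x)"
  by (simp add: KSpec_pullback_def compose_def)

lemma binoid_homD:
  assumes "f \<in> binoid_hom M N"
  shows "\<And>x. x \<in> carrier M \<Longrightarrow> f x \<in> carrier N"
    and "\<And>x y. x \<in> carrier M \<Longrightarrow> y \<in> carrier M \<Longrightarrow> f (x \<otimes>\<^bsub>M\<^esub> y) = f x \<otimes>\<^bsub>N\<^esub> f y"
    and "f \<one>\<^bsub>M\<^esub> = \<one>\<^bsub>N\<^esub>" and "f (bzero M) = bzero N"
  using assms by (auto simp: binoid_hom_def hom_def)

lemma (in comm_binoid) KSpec_pullback_in_KSpec:
  assumes "f \<in> binoid_hom M N" "g \<in> KSpec N"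
  shows "KSpec_pullback M f g \<in> KSpec M"
  unfolding KSpec_pullback_def compose_def
  by (rule KSpec_restrictI) (simp_all add: binoid_homD[OF assms(1)] KSpecD[OF assms(2)])

lemma (in comm_binoid) continuous_map_KSpec_pullback:
  assumes f: "f \<in> binoid_hom M N" and "fg_binoid M" "fg_binoid N"
  shows "continuous_map (KSpec_topology N) (KSpec_topology M :: ('a \<Rightarrow> 'k::real_normed_field) topology)
    (KSpec_pullback M f)"
proof -
  obtain es fs where es: "binoid_generators M es" and fs: "binoid_generators N fs"
    using assms(2,3) by (auto simp: fg_binoid_def)
  have "continuous_map (KSpec_topology_wrt N fs) (KSpec_topology_wrt M es)
      (KSpec_pullback M f :: _ \<Rightarrow> 'a \<Rightarrow> 'k)"
  proof (rule continuous_map_into_KSpec)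
    fix i assume "i < length es"
    then have "es ! i \<in> carrier M" using es by (auto simp: binoid_generators_def)
    then show "continuous_map (KSpec_topology_wrt N fs) euclidean
        (\<lambda>x. KSpec_pullback M f x (es ! i) :: 'k)"
      using continuous_map_KSpec_eval[OF fs binoid_homD(1)[OF f]] by (simp add: KSpec_pullback_apply)
  qed (simp add: KSpec_pullback_in_KSpec[OF f])
  then show ?thesis by (simp add: KSpec_topology_eq[OF es] KSpec_topology_eq[OF fs])
qed

lemma (in comm_binoid) units_binoid_incl: "(\<lambda>x. x) \<in> binoid_hom (units_binoid M) M"
  by (auto simp: binoid_hom_def hom_def units_binoid_def)

section \<open>Absolute values, phases and the homotopy on all points\<close>

context generated_binoid begin

definition norm_coords :: "('a \<Rightarrow> 'k::real_normed_field) \<Rightarrow> nat \<Rightarrow> real" where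
  "norm_coords f = coords (restrict (\<lambda>x. norm (f x)) (carrier M))"

text \<open>Keeps the phases of \<open>f\<close> and replaces its absolute values by
  \<open>\<rho>\<close>, where \<open>f\<close> does not vanish. The nonnegative point is recovered
  from its coordinates \<open>\<rho>\<close> so that the product is multiplicative on the whole
  carrier; \<open>sgn\<close> is multiplicative at \<open>0\<close> too.\<close>

definition twist :: "(nat \<Rightarrow> real) \<Rightarrow> ('a \<Rightarrow> 'k::real_normed_field) \<Rightarrow> 'a \<Rightarrow> 'k" where
  "twist \<rho> f = restrict (\<lambda>x. inv_into KSpec_nonneg coords \<rho> x *\<^sub>R sgn (f x)) (carrier M)"

lemma norm_coords_apply: "i < length es \<Longrightarrow> norm_coords f i = norm (f (es ! i))"
  by (simp add: norm_coords_def coords_def)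

lemma norm_coords_eq_0: "\<not> i < length es \<Longrightarrow> norm_coords f i = 0"
  by (simp add: norm_coords_def coords_def)

lemma norm_coords_in:
  assumes f: "f \<in> KSpec M"
  shows "norm_coords f \<in> coords ` KSpec_nonneg"
  unfolding norm_coords_def
  by (intro imageI KSpec_nonnegI KSpec_restrictI) (simp_all add: KSpecD[OF f] norm_mult)

lemma twist_in_KSpec:
  assumes \<rho>: "\<rho> \<in> coords ` KSpec_nonneg" and f: "f \<in> KSpec M"
  shows "twist \<rho> f \<in> KSpec M"
proof -
  have g: "inv_into KSpec_nonneg coords \<rho> \<in> KSpec M"
    using inv_into_into[OF \<rho>] by (simp add: KSpec_nonneg_def)
  show ?thesis
    unfolding twist_def by (rule KSpec_restrictI) (simp_all add: KSpecD[OF f] KSpecD[OF g] Real_Vector_Spaces.sgn_mult)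
qed

lemma twist_gen:
  assumes "\<rho> \<in> coords ` KSpec_nonneg" "i < length es"
  shows "twist \<rho> f (es ! i) = \<rho> i *\<^sub>R sgn (f (es ! i))"
  using fun_cong[OF f_inv_into_f[OF assms(1)], of i] assms(2) by (simp add: twist_def coords_def)

lemma twist_norm_coords:
  assumes "f \<in> KSpec M"
  shows "twist (norm_coords f) f = f"
proof (rule KSpec_eqI[OF twist_in_KSpec[OF norm_coords_in[OF assms] assms] assms])
  show "twist (norm_coords f) f (es ! i) = f (es ! i)" if "i < length es" for i
    using that by (simp add: twist_gen norm_coords_in assms norm_coords_apply sgn_div_norm divide_inverse[symmetric])
qed

lemma continuous_map_norm_coords:
  "continuous_map (KSpec_topology_wrt M es) euclidean (norm_coords :: ('a \<Rightarrow> 'k::real_normed_field) \<Rightarrow> _)"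
proof -
  have "continuous_map (KSpec_topology_wrt M es) euclidean (\<lambda>f :: 'a \<Rightarrow> 'k. norm_coords f i)" for i
  proof (cases "i < length es")
    case True
    then show ?thesis
      using continuous_map_norm[OF continuous_map_KSpec_eval[OF es nth_closed[OF True]]]
      by (simp add: norm_coords_apply)
  qed (simp add: norm_coords_eq_0)
  then have "continuous_map (KSpec_topology_wrt M es) (product_topology (\<lambda>_. euclidean) UNIV)
      (norm_coords :: ('a \<Rightarrow> 'k) \<Rightarrow> _)"
    by (simp add: continuous_map_componentwise_UNIV)
  then show ?thesis by (simp add: euclidean_product_topology)
qed

text \<open>A product that is not a unit has a factor that is not a unit, so vanishing spreads from
  the generators.\<close>

lemma vanish_off_units:
  assumes f: "f \<in> KSpec M" and gen: "\<And>i. i < length es \<Longrightarrow> es ! i \<notin> Units M \<Longrightarrow> f (es ! i) = 0"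
    and x: "x \<in> carrier M" "x \<notin> Units M"
  shows "f x = 0"
proof -
  have "x \<notin> Units M \<longrightarrow> f x = 0"
    using x(1)
  proof (induction rule: carrier_induct)
    case (mult x y)
    then show ?case by (auto simp: KSpecD[OF f])
  qed (use gen in \<open>simp_all add: KSpecD[OF f]\<close>)
  then show ?thesis using x(2) by simp
qed

lemma KSpec_contract:
  assumes idem: "\<And>e. e \<in> carrier M \<Longrightarrow> e \<otimes> e = e \<Longrightarrow> e = bzero M \<or> e = \<one>"
  obtains H where
    "continuous_map (prod_topology (top_of_set {0..1::real}) (KSpec_topology M))
       (KSpec_topology M :: ('a \<Rightarrow> 'k::real_normed_field) topology) H"
    "\<And>f. f \<in> KSpec M \<Longrightarrow> H (0, f) = f"
    "\<And>f x. f \<in> KSpec M \<Longrightarrow> x \<in> carrier M \<Longrightarrow> x \<notin> Units M \<Longrightarrow> H (1, f) x = 0"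
    "\<And>f. f \<in> KSpec M \<Longrightarrow> (\<And>x. x \<in> carrier M \<Longrightarrow> x \<notin> Units M \<Longrightarrow> f x = 0) \<Longrightarrow> H (1, f) = f"
proof -
  let ?V = "coords ` KSpec_nonneg" and ?X = "KSpec_topology_wrt M es :: ('a \<Rightarrow> 'k) topology"
  interpret positive_toric_set "length es" ?V unit_indices
    by (rule positive_toric_set_coords[OF idem])
  obtain h where cont: "continuous_on ({0..1} \<times> ?V) h" and hV: "h ` ({0..1} \<times> ?V) \<subseteq> ?V"
    and h0: "\<And>\<rho>. \<rho> \<in> ?V \<Longrightarrow> h (0::real, \<rho>) = \<rho>"
    and h1: "\<And>\<rho>. \<rho> \<in> ?V \<Longrightarrow> supp (h (1, \<rho>)) = unit_indices"
    and shr: "\<And>t \<rho>. t \<in> {0..1} \<Longrightarrow> \<rho> \<in> ?V \<Longrightarrow> supp (h (t, \<rho>)) \<subseteq> supp \<rho>"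
    and fix': "\<And>t \<rho>. t \<in> {0..1} \<Longrightarrow> \<rho> \<in> ?V \<Longrightarrow> supp \<rho> = unit_indices \<Longrightarrow> h (t, \<rho>) = \<rho>"
    by (rule toric_contract) (rule that)
  define H where "H p = twist (h (fst p, norm_coords (snd p))) (snd p)" for p :: "real \<times> ('a \<Rightarrow> 'k)"
  have hin: "h (t, norm_coords f) \<in> ?V" if "t \<in> {0..1}" "f \<in> KSpec M" for t and f :: "'a \<Rightarrow> 'k"
    using hV norm_coords_in[OF that(2)] that(1) by blast
  have HK: "H (t, f) \<in> KSpec M" if "t \<in> {0..1}" "f \<in> KSpec M" for t f
    using twist_in_KSpec[OF hin[OF that] that(2)] by (simp add: H_def)
  have Hgen: "H (t, f) (es ! i) = h (t, norm_coords f) i *\<^sub>R sgn (f (es ! i))"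
    if "t \<in> {0..1}" "f \<in> KSpec M" "i < length es" for t f i
    using twist_gen[OF hin[OF that(1,2)] that(3)] by (simp add: H_def)
  let ?I = "top_of_set {0..1::real}"
  have "continuous_map (prod_topology ?I ?X) ?X H"
  proof (rule continuous_map_into_KSpec)
    show "H p \<in> KSpec M" if "p \<in> topspace (prod_topology ?I ?X)" for p
      using HK[of "fst p" "snd p"] that by auto
    fix i assume i: "i < length es"
    have "continuous_map (prod_topology ?I ?X) ?I fst" by (rule continuous_map_fst)
    moreover have "continuous_map (prod_topology ?I ?X) (top_of_set ?V) (\<lambda>p. norm_coords (snd p))"
      using continuous_map_compose[OF continuous_map_snd continuous_map_norm_coords, of ?I] norm_coords_in
      by (auto simp: continuous_map_in_subtopology o_def)
    ultimately have "continuous_map (prod_topology ?I ?X) (prod_topology ?I (top_of_set ?V))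
        (\<lambda>p. (fst p, norm_coords (snd p)))"
      by (rule continuous_map_pairedI)
    then have "continuous_map (prod_topology ?I ?X) (top_of_set ({0..1} \<times> ?V))
        (\<lambda>p. (fst p, norm_coords (snd p)))"
      by (simp add: prod_topology_subtopology_eu)
    moreover have "continuous_map (top_of_set ({0..1} \<times> ?V)) euclidean (\<lambda>p. h p i)"
      using continuous_on_product_then_coordinatewise[OF cont] by simp
    ultimately have "continuous_map (prod_topology ?I ?X) euclidean (\<lambda>p. h (fst p, norm_coords (snd p)) i)"
      by (rule continuous_map_compose[unfolded o_def])
    moreover have "continuous_map (prod_topology ?I ?X) euclidean (\<lambda>p. snd p (es ! i))"
      using continuous_map_compose[OF continuous_map_snd continuous_map_KSpec_eval[OF es nth_closed[OF i]]]
      by (simp add: o_def)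
    \<comment> \<open>Supports do not grow, so a coordinate stays zero where its phase is undefined;
      this is the hypothesis of \<open>continuous_map_scaleR_sgn\<close>.\<close>
    moreover have "h (fst p, norm_coords (snd p)) i = 0"
      if "p \<in> topspace (prod_topology ?I ?X)" "snd p (es ! i) = 0" for p
    proof -
      have "i \<notin> supp (norm_coords (snd p))" using that(2) i by (simp add: supp_def norm_coords_apply)
      then have "i \<notin> supp (h (fst p, norm_coords (snd p)))"
        using shr[of "fst p" "norm_coords (snd p)"] norm_coords_in[of "snd p"] that(1) by auto
      then show ?thesis by (simp add: supp_def)
    qed
    ultimately have "continuous_map (prod_topology ?I ?X) euclidean
        (\<lambda>p. h (fst p, norm_coords (snd p)) i *\<^sub>R sgn (snd p (es ! i)))"
      by (rule continuous_map_scaleR_sgn)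
    then show "continuous_map (prod_topology ?I ?X) euclidean (\<lambda>p. H p (es ! i))"
      by (rule continuous_map_eq) (use Hgen i in auto)
  qed
  then have contH: "continuous_map (prod_topology ?I (KSpec_topology M)) (KSpec_topology M) H"
    by (simp add: KSpec_topology_eq[OF es])
  show ?thesis
  proof (rule that[OF contH])
    fix f :: "'a \<Rightarrow> 'k" assume f: "f \<in> KSpec M"
    show "H (0, f) = f" by (simp add: H_def h0 norm_coords_in f twist_norm_coords)
    show "H (1, f) x = 0" if "x \<in> carrier M" "x \<notin> Units M" for x
    proof (rule vanish_off_units[OF HK[OF _ f] _ that])
      show "H (1, f) (es ! i) = 0" if "i < length es" "es ! i \<notin> Units M" for i
      proof -
        have "i \<notin> supp (h (1, norm_coords f))"
          using h1[OF norm_coords_in[OF f]] that by (simp add: unit_indices_def)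
        then show ?thesis using Hgen[OF _ f that(1), of 1] by (simp add: supp_def)
      qed
    qed simp
    show "H (1, f) = f" if van: "\<And>x. x \<in> carrier M \<Longrightarrow> x \<notin> Units M \<Longrightarrow> f x = 0"
    proof -
      \<comment> \<open>No point vanishes at a unit, and \<open>f\<close> vanishes at the nonunits
        by assumption, so \<open>f\<close> has the support on which the homotopy is
        stationary.\<close>
      have "supp (norm_coords f) = unit_indices"
        using van KSpec_unit_nonzero[OF f] norm_coords_eq_0[of _ f]
        by (auto simp: supp_def unit_indices_def norm_coords_apply)
           (metis norm_coords_apply norm_coords_eq_0 norm_eq_zero nth_closed)+
      then show ?thesis by (simp add: H_def fix' norm_coords_in f twist_norm_coords)
    qed
  qed
qed

text \<open>The inverse \<open>g\<close> restricts to the units after applying \<open>r\<close>, the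
  end of the homotopy. As \<open>r f\<close> vanishes off the units, extension by zero recovers it
  from its restriction, so \<open>?j (g f) = r f\<close>; and \<open>r\<close> fixes points extended
  by zero, so \<open>g (?j u) = u\<close> exactly.\<close>

lemma homotopy_equivalence_units_retract:
  assumes idem: "\<And>e. e \<in> carrier M \<Longrightarrow> e \<otimes> e = e \<Longrightarrow> e = bzero M \<or> e = \<one>"
  shows "homotopy_equivalence_map (KSpec_topology (units_binoid M))
    (KSpec_topology M :: ('a \<Rightarrow> 'k::real_normed_field) topology) (KSpec_pullback M (units_retract M))"
proof -
  let ?U = "units_binoid M" and ?j = "KSpec_pullback M (units_retract M)"
  interpret U: comm_binoid ?U by (rule comm_binoid_units)
  have fg: "fg_binoid M" "fg_binoid ?U"
    using es fg_units_binoid by (auto simp: fg_binoid_def)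
  obtain H where H: "continuous_map (prod_topology (top_of_set {0..1::real}) (KSpec_topology M))
       (KSpec_topology M :: ('a \<Rightarrow> 'k) topology) H"
    and H0: "\<And>f. f \<in> KSpec M \<Longrightarrow> H (0, f) = f"
    and H1: "\<And>f x. f \<in> KSpec M \<Longrightarrow> x \<in> carrier M \<Longrightarrow> x \<notin> Units M \<Longrightarrow> H (1, f) x = 0"
    and Hfix: "\<And>f. f \<in> KSpec M \<Longrightarrow> (\<And>x. x \<in> carrier M \<Longrightarrow> x \<notin> Units M \<Longrightarrow> f x = 0) \<Longrightarrow> H (1, f) = f"
    by (rule KSpec_contract[OF idem]) auto
  define r where "r f = H (1, f)" for f
  have contr: "continuous_map (KSpec_topology M) (KSpec_topology M) r"
    using continuous_map_o_Pair[OF H, of 1] by (simp add: r_def[abs_def] o_def)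
  have rK: "r f \<in> KSpec M" if "f \<in> KSpec M" for f
    using continuous_map_image_subset_topspace[OF contr] that by auto
  define g where "g f = KSpec_pullback ?U (\<lambda>x. x) (r f)" for f
  have g_apply: "g f x = r f x" if "x \<in> carrier ?U" for f x
    using that by (simp add: g_def KSpec_pullback_apply)
  have contg: "continuous_map (KSpec_topology M) (KSpec_topology ?U) g"
    using continuous_map_compose[OF contr U.continuous_map_KSpec_pullback[OF units_binoid_incl fg(2,1)]]
    by (simp add: g_def[abs_def] o_def)
  have contj: "continuous_map (KSpec_topology ?U) (KSpec_topology M :: ('a \<Rightarrow> 'k) topology) ?j"
    by (rule continuous_map_KSpec_pullback[OF units_retract_hom fg])
  have jK: "?j u \<in> KSpec M" if "u \<in> KSpec ?U" for u :: "'a \<Rightarrow> 'k"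
    by (rule KSpec_pullback_in_KSpec[OF units_retract_hom that])
  have sub: "carrier ?U \<subseteq> carrier M" by (auto simp: units_binoid_def)
  have gj: "g (?j u) = u" if u: "u \<in> KSpec ?U" for u
  proof (rule extensionalityI)
    have "?j u x = 0" if "x \<in> carrier M" "x \<notin> Units M" for x
    proof -
      have "units_retract M x = bzero ?U"
        using that by (simp add: units_retract_def units_binoid_def)
      then show ?thesis using that KSpecD(3)[OF u] by (simp add: KSpec_pullback_apply)
    qed
    then have "r (?j u) = ?j u" unfolding r_def by (intro Hfix jK u)
    then show "g (?j u) x = u x" if "x \<in> carrier ?U" for x
      using that sub by (auto simp: g_apply KSpec_pullback_apply units_retract_def)
    show "u \<in> extensional (carrier ?U)" using u by (simp add: KSpec_def)
    show "g (?j u) \<in> extensional (carrier ?U)" by (simp add: g_def KSpec_pullback_def)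
  qed
  have jg: "?j (g f) = r f" if f: "f \<in> KSpec M" for f
  proof (rule extensionalityI)
    show "?j (g f) x = r f x" if x: "x \<in> carrier M" for x
    proof (cases "x \<in> carrier ?U")
      case True
      then show ?thesis using x by (simp add: KSpec_pullback_apply units_retract_def g_apply)
    next
      case False
      then have "x \<notin> Units M" by (simp add: units_binoid_def)
      moreover have "bzero M \<in> carrier ?U" by (simp add: units_binoid_def)
      ultimately show ?thesis
        using x False H1[OF f x] KSpecD(3)[OF rK[OF f]]
        by (simp add: KSpec_pullback_apply units_retract_def g_apply r_def)
    qed
    show "r f \<in> extensional (carrier M)" using rK[OF f] by (simp add: KSpec_def)
    show "?j (g f) \<in> extensional (carrier M)" by (simp add: KSpec_pullback_def)
  qed
  have "homotopic_with (\<lambda>_. True) (KSpec_topology ?U) (KSpec_topology ?U) (g \<circ> ?j) id"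
    by (rule homotopic_with_id2) (use gj in simp)
  moreover have "homotopic_with (\<lambda>_. True) (KSpec_topology M) (KSpec_topology M) id (?j \<circ> g)"
    by (subst homotopic_with) (use H H0 jg in \<open>auto intro!: exI[of _ H] simp: r_def\<close>)
  ultimately show ?thesis
    unfolding homotopy_equivalence_map_def using contj contg homotopic_with_symD by blast
qed

end

section \<open>Disjoint sums\<close>

lemma continuous_map_from_sum:
  assumes "\<And>i. i \<in> I \<Longrightarrow> continuous_map (X i) Z (\<lambda>x. f (i, x))"
  shows "continuous_map (sum_topology X I) Z f"
  unfolding continuous_map_def
proof (intro conjI allI impI)
  have "f (i, x) \<in> topspace Z" if "i \<in> I" "x \<in> topspace (X i)" for i x
    using assms[OF that(1)] that(2) by (auto simp: continuous_map_def)
  then show "f \<in> topspace (sum_topology X I) \<rightarrow> topspace Z" by auto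
  fix U assume U: "openin Z U"
  have "openin (X i) {x. (i, x) \<in> {p \<in> topspace (sum_topology X I). f p \<in> U}}" if "i \<in> I" for i
    using openin_continuous_map_preimage[OF assms[OF that] U] that by simp
  then show "openin (sum_topology X I) {p \<in> topspace (sum_topology X I). f p \<in> U}"
    by (auto simp: openin_sum_topology)
qed

text \<open>The slices over the summands are open and cover the product, so continuity can be
  checked on each; dropping the index maps a slice continuously to the product with one
  summand.\<close>

lemma continuous_map_prod_sum:
  assumes cont: "\<And>i. i \<in> I \<Longrightarrow> continuous_map (prod_topology J (X i)) Z (\<lambda>p. h (fst p, (i, snd p)))"
  shows "continuous_map (prod_topology J (sum_topology X I)) Z h"
proof (rule pasting_lemma[where I = I and T = "\<lambda>i. topspace J \<times> ({i} \<times> topspace (X i))" and f = "\<lambda>i. h"])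
  fix i assume i: "i \<in> I"
  have op: "openin (sum_topology X I) ({i} \<times> U)" if "openin (X i) U" for U
  proof -
    have "openin (sum_topology X I) (Pair i ` U)"
      using open_map_component_injection[OF i, where X = X] that by (simp add: open_map_def)
    moreover have "Pair i ` U = {i} \<times> U" by auto
    ultimately show ?thesis by simp
  qed
  show "openin (prod_topology J (sum_topology X I)) (topspace J \<times> ({i} \<times> topspace (X i)))"
    using op by (simp add: openin_prod_Times_iff)
  let ?S = "subtopology (prod_topology J (sum_topology X I)) (topspace J \<times> ({i} \<times> topspace (X i)))"
  have "continuous_map (subtopology (sum_topology X I) ({i} \<times> topspace (X i))) (X i) snd"
    unfolding continuous_map_def
  proof (intro conjI allI impI)
    fix U assume U: "openin (X i) U"
    have "{x \<in> topspace (subtopology (sum_topology X I) ({i} \<times> topspace (X i))). snd x \<in> U} =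
        ({i} \<times> U) \<inter> ({i} \<times> topspace (X i))"
      using openin_subset[OF U] i by auto
    then show "openin (subtopology (sum_topology X I) ({i} \<times> topspace (X i)))
        {x \<in> topspace (subtopology (sum_topology X I) ({i} \<times> topspace (X i))). snd x \<in> U}"
      using op[OF U] by (auto simp: openin_subtopology)
  qed auto
  moreover have "continuous_map ?S (subtopology (sum_topology X I) ({i} \<times> topspace (X i))) snd"
    by (auto simp: continuous_map_in_subtopology continuous_map_from_subtopology continuous_map_snd)
  ultimately have "continuous_map ?S (X i) (snd \<circ> snd)"
    by (rule continuous_map_compose[rotated])
  moreover have "continuous_map ?S J fst"
    by (simp add: continuous_map_from_subtopology continuous_map_fst)
  ultimately have "continuous_map ?S (prod_topology J (X i)) (\<lambda>p. (fst p, snd (snd p)))"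
    by (simp add: continuous_map_pairedI o_def)
  from continuous_map_compose[OF this cont[OF i]]
  show "continuous_map ?S Z h"
    by (rule continuous_map_eq) auto
qed auto

lemma homotopic_with_sum:
  assumes "\<And>i. i \<in> I \<Longrightarrow> homotopic_with (\<lambda>_. True) (X i) (Y i) (f i) (g i)"
  shows "homotopic_with (\<lambda>_. True) (sum_topology X I) (sum_topology Y I)
    (\<lambda>(i, x). (i, f i x)) (\<lambda>(i, x). (i, g i x))"
proof -
  have "\<forall>i\<in>I. \<exists>h. continuous_map (prod_topology (top_of_set {0..1::real}) (X i)) (Y i) h \<and>
      (\<forall>x. h (0, x) = f i x) \<and> (\<forall>x. h (1, x) = g i x)"
    using assms unfolding homotopic_with_def by blast
  then obtain h where h: "\<And>i. i \<in> I \<Longrightarrow> continuous_map (prod_topology (top_of_set {0..1::real}) (X i)) (Y i) (h i)"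
    "\<And>i x. i \<in> I \<Longrightarrow> h i (0, x) = f i x" "\<And>i x. i \<in> I \<Longrightarrow> h i (1, x) = g i x"
    by metis
  let ?H = "\<lambda>(t, (i, x)). (i, h i (t, x))"
  have "continuous_map (prod_topology (top_of_set {0..1::real}) (sum_topology X I)) (sum_topology Y I) ?H"
  proof (rule continuous_map_prod_sum)
    fix i assume i: "i \<in> I"
    from continuous_map_compose[OF h(1)[OF i] continuous_map_component_injection[OF i, where X = Y]]
    show "continuous_map (prod_topology (top_of_set {0..1::real}) (X i)) (sum_topology Y I)
        (\<lambda>p. ?H (fst p, (i, snd p)))"
      by (simp add: o_def)
  qed
  then show ?thesis
    by (subst homotopic_with) (auto intro!: exI[of _ ?H] simp: h(2,3))
qed

lemma homotopy_equivalence_map_sum: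
  assumes "\<And>i. i \<in> I \<Longrightarrow> homotopy_equivalence_map (X i) (Y i) (f i)"
  shows "homotopy_equivalence_map (sum_topology X I) (sum_topology Y I) (\<lambda>(i, x). (i, f i x))"
proof -
  have cont: "continuous_map (sum_topology X I) (sum_topology Y I) (\<lambda>(i, x). (i, f i x))"
    if "\<And>i. i \<in> I \<Longrightarrow> continuous_map (X i) (Y i) (f i)" for X Y f
  proof (rule continuous_map_from_sum)
    fix i assume i: "i \<in> I"
    from continuous_map_compose[OF that[OF i] continuous_map_component_injection[OF i, where X = Y]]
    show "continuous_map (X i) (sum_topology Y I) (\<lambda>x. case (i, x) of (i, x) \<Rightarrow> (i, f i x))"
      by (simp add: o_def)
  qed
  have "\<forall>i\<in>I. \<exists>g. continuous_map (X i) (Y i) (f i) \<and> continuous_map (Y i) (X i) g \<and>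
      homotopic_with (\<lambda>_. True) (X i) (X i) (g \<circ> f i) id \<and>
      homotopic_with (\<lambda>_. True) (Y i) (Y i) (f i \<circ> g) id"
    using assms by (simp add: homotopy_equivalence_map_def)
  then obtain g where g: "\<And>i. i \<in> I \<Longrightarrow> continuous_map (X i) (Y i) (f i)"
    "\<And>i. i \<in> I \<Longrightarrow> continuous_map (Y i) (X i) (g i)"
    "\<And>i. i \<in> I \<Longrightarrow> homotopic_with (\<lambda>_. True) (X i) (X i) (g i \<circ> f i) id"
    "\<And>i. i \<in> I \<Longrightarrow> homotopic_with (\<lambda>_. True) (Y i) (Y i) (f i \<circ> g i) id"
    by metis
  have id: "(\<lambda>(i, x). (i, id x)) = id" by auto
  have comp: "(\<lambda>(i, x). (i, b i x)) \<circ> (\<lambda>(i, x). (i, a i x)) = (\<lambda>(i, x). (i, (b i \<circ> a i) x))" for a b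
    by auto
  have "homotopic_with (\<lambda>_. True) (sum_topology X I) (sum_topology X I)
      (\<lambda>(i, x). (i, (g i \<circ> f i) x)) (\<lambda>(i, x). (i, id x))"
    by (rule homotopic_with_sum) (rule g(3))
  moreover have "homotopic_with (\<lambda>_. True) (sum_topology Y I) (sum_topology Y I)
      (\<lambda>(i, x). (i, (f i \<circ> g i) x)) (\<lambda>(i, x). (i, id x))"
    by (rule homotopic_with_sum) (rule g(4))
  moreover have "continuous_map (sum_topology X I) (sum_topology Y I) (\<lambda>(i, x). (i, f i x))"
    by (rule cont) (rule g(1))
  moreover have "continuous_map (sum_topology Y I) (sum_topology X I) (\<lambda>(i, x). (i, g i x))"
    by (rule cont) (rule g(2))
  ultimately show ?thesis
    unfolding homotopy_equivalence_map_def
    by (intro exI[of _ "\<lambda>(i, x). (i, g i x)"]) (simp only: comp id simp_thms)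
qed

lemma homotopy_equivalence_map_homeomorphic:
  assumes f: "homotopy_equivalence_map X Y f" and k: "homeomorphic_map Y Z k"
  shows "homotopy_equivalence_map X Z (k \<circ> f)"
proof -
  obtain g where g: "continuous_map X Y f" "continuous_map Y X g"
    "homotopic_with (\<lambda>_. True) X X (g \<circ> f) id" "homotopic_with (\<lambda>_. True) Y Y (f \<circ> g) id"
    using f by (auto simp: homotopy_equivalence_map_def)
  obtain l where l: "continuous_map Y Z k" "continuous_map Z Y l"
    "\<And>y. y \<in> topspace Y \<Longrightarrow> l (k y) = y" "\<And>z. z \<in> topspace Z \<Longrightarrow> k (l z) = z"
    using k by (auto simp: homeomorphic_map_maps homeomorphic_maps_def)
  have fY: "f x \<in> topspace Y" if "x \<in> topspace X" for x
    using continuous_map_image_subset_topspace[OF g(1)] that by auto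
  have "homotopic_with (\<lambda>_. True) X X ((g \<circ> l) \<circ> (k \<circ> f)) id"
    by (rule homotopic_with_eq[OF g(3)]) (simp_all add: l(3) fY)
  moreover have "homotopic_with (\<lambda>_. True) Z Z (k \<circ> ((f \<circ> g) \<circ> l)) (k \<circ> (id \<circ> l))"
    using g(4) l(1,2)
    by (intro homotopic_with_compose_continuous_map_left[of "\<lambda>_. True"]
        homotopic_with_compose_continuous_map_right[of "\<lambda>_. True"]) auto
  then have "homotopic_with (\<lambda>_. True) Z Z ((k \<circ> f) \<circ> (g \<circ> l)) id"
    by (rule homotopic_with_eq) (simp_all add: l(4))
  moreover have "continuous_map X Z (k \<circ> f)" "continuous_map Z X (g \<circ> l)"
    using continuous_map_compose g l by blast+
  ultimately show ?thesis unfolding homotopy_equivalence_map_def by blast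
qed

section \<open>Decomposition by idempotents\<close>

text \<open>A nonzero idempotent is determined by the generators dividing it: it is a product of
  such generators, so two idempotents with the same set of them divide each other, and idempotents
  dividing each other coincide.\<close>

lemma (in generated_binoid) finite_idempotents: "finite (carrier (idem_binoid M))"
proof -
  \<comment> \<open>An idempotent divisible by all generators that divide \<open>x\<close> is
    divisible by \<open>x\<close> itself, unless \<open>x\<close> is zero: from
    \<open>e = x \<otimes> a\<close> and \<open>e = y \<otimes> b\<close> it follows that
    \<open>x \<otimes> y\<close> divides \<open>e \<otimes> e = e\<close>.\<close>
  have dvd: "x = bzero M \<or> (\<exists>y\<in>carrier M. e = x \<otimes> y)"
    if e: "e \<in> carrier M" "e \<otimes> e = e" and "x \<in> carrier M"
      and "\<And>i. i < length es \<Longrightarrow> \<exists>y\<in>carrier M. x = es ! i \<otimes> y \<Longrightarrow> \<exists>y\<in>carrier M. e = es ! i \<otimes> y" for x e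
    using that(3,4)
  proof (induction rule: carrier_induct)
    case one
    then show ?case using e by (intro disjI2 bexI[of _ e]) simp_all
  next
    case (gen i)
    have "\<exists>y\<in>carrier M. es ! i = es ! i \<otimes> y"
      using gen.hyps by (intro bexI[of _ \<one>]) simp_all
    then show ?case using gen by blast
  next
    case (mult x y)
    have x: "x = bzero M \<or> (\<exists>z\<in>carrier M. e = x \<otimes> z)"
    proof (rule mult.IH(1))
      fix i assume i: "i < length es" "\<exists>z\<in>carrier M. x = es ! i \<otimes> z"
      then obtain z where z: "z \<in> carrier M" "x = es ! i \<otimes> z" by blast
      have "x \<otimes> y = es ! i \<otimes> (z \<otimes> y)" using z mult.hyps i(1) by (simp add: m_assoc)
      then show "\<exists>z\<in>carrier M. e = es ! i \<otimes> z" using mult.prems[OF i(1)] z(1) mult.hyps by blast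
    qed
    have y: "y = bzero M \<or> (\<exists>z\<in>carrier M. e = y \<otimes> z)"
    proof (rule mult.IH(2))
      fix i assume i: "i < length es" "\<exists>z\<in>carrier M. y = es ! i \<otimes> z"
      then obtain z where z: "z \<in> carrier M" "y = es ! i \<otimes> z" by blast
      have "x \<otimes> y = es ! i \<otimes> (x \<otimes> z)" using z mult.hyps i(1) by (simp add: m_lcomm)
      then show "\<exists>z\<in>carrier M. e = es ! i \<otimes> z" using mult.prems[OF i(1)] z(1) mult.hyps by blast
    qed
    show ?case
    proof (cases "x = bzero M \<or> y = bzero M")
      case True
      then show ?thesis using mult.hyps by auto
    next
      case False
      then obtain a b where ab: "a \<in> carrier M" "b \<in> carrier M" "e = x \<otimes> a" "e = y \<otimes> b"
        using x y by blast
      have "e = (x \<otimes> a) \<otimes> (y \<otimes> b)" using ab(3,4) e(2) by simp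
      also have "\<dots> = (x \<otimes> y) \<otimes> (a \<otimes> b)" using ab(1,2) mult.hyps by (simp add: m_ac)
      finally show ?thesis using ab(1,2) by blast
    qed
  qed simp
  define D where "D e = {i. i < length es \<and> (\<exists>y\<in>carrier M. e = es ! i \<otimes> y)}" for e
  have "inj_on D (carrier (idem_binoid M) - {bzero M})"
  proof (rule inj_onI)
    fix e e' assume *: "e \<in> carrier (idem_binoid M) - {bzero M}" "e' \<in> carrier (idem_binoid M) - {bzero M}"
      "D e = D e'"
    then have e: "e \<in> carrier M" "e \<otimes> e = e" "e \<noteq> bzero M"
      and e': "e' \<in> carrier M" "e' \<otimes> e' = e'" "e' \<noteq> bzero M"
      by (auto simp: idem_binoid_def)
    obtain a where a: "a \<in> carrier M" "e' = e \<otimes> a"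
      using dvd[OF e'(1,2) e(1)] e(3) \<open>D e = D e'\<close> by (auto simp: D_def set_eq_iff)
    obtain b where b: "b \<in> carrier M" "e = e' \<otimes> b"
      using dvd[OF e(1,2) e'(1)] e'(3) \<open>D e = D e'\<close> by (auto simp: D_def set_eq_iff)
    have "e \<otimes> e' = e'" using a e by (metis m_assoc)
    moreover have "e' \<otimes> e = e" using b e' by (metis m_assoc)
    ultimately show "e = e'" using e e' m_comm by metis
  qed
  moreover have "D ` (carrier (idem_binoid M) - {bzero M}) \<subseteq> Pow {..<length es}" by (auto simp: D_def)
  ultimately have "finite (carrier (idem_binoid M) - {bzero M})"
    using finite_imageD finite_subset by (metis finite_Pow_iff finite_lessThan)
  then show ?thesis by simp
qed

section \<open>Idempotents of the quotients at primes of the idempotent binoid\<close>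

context comm_binoid begin

lemma AdmD:
  assumes "r \<in> Adm M"
  shows "\<And>e. e \<in> r \<Longrightarrow> e \<in> carrier M \<and> e \<otimes> e = e"
    and "bzero M \<in> r" and "\<one> \<notin> r"
    and "\<And>e d. e \<in> carrier M \<Longrightarrow> d \<in> carrier M \<Longrightarrow> e \<otimes> e = e \<Longrightarrow> d \<otimes> d = d \<Longrightarrow> e \<otimes> d \<in> r \<Longrightarrow> e \<in> r \<or> d \<in> r"
proof -
  let ?E = "idem_binoid M"
  have r: "r \<subseteq> carrier ?E" "bzero M \<in> r" "r <#>\<^bsub>?E\<^esub> carrier ?E \<subseteq> r" "r \<noteq> carrier ?E"
    "\<And>x y. x \<in> carrier ?E \<Longrightarrow> y \<in> carrier ?E \<Longrightarrow> x \<otimes> y \<in> r \<Longrightarrow> x \<in> r \<or> y \<in> r"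
    using assms by (auto simp: Adm_def binoid_prime_def binoid_ideal_def idem_binoid_def)
  show E: "e \<in> carrier M \<and> e \<otimes> e = e" if "e \<in> r" for e
    using r(1) that by (auto simp: idem_binoid_def)
  show "bzero M \<in> r" by (rule r(2))
  show "\<one> \<notin> r"
  proof
    assume "\<one> \<in> r"
    have "x \<in> r" if "x \<in> carrier ?E" for x
    proof -
      have "\<one> \<otimes>\<^bsub>?E\<^esub> x \<in> r <#>\<^bsub>?E\<^esub> carrier ?E"
        using \<open>\<one> \<in> r\<close> that unfolding set_mult_def by blast
      moreover have "\<one> \<otimes>\<^bsub>?E\<^esub> x = x" using that by (simp add: idem_binoid_def)
      ultimately show ?thesis using r(3) by auto
    qed
    then show False using r(1,4) by blast
  qed
  show "e \<in> r \<or> d \<in> r"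
    if "e \<in> carrier M" "d \<in> carrier M" "e \<otimes> e = e" "d \<otimes> d = d" "e \<otimes> d \<in> r" for e d
    using r(5)[of e d] that by (simp add: idem_binoid_def)
qed

lemma set_mult_carrier_absorb:
  assumes "r \<subseteq> carrier M" "x \<in> r <#> carrier M" "y \<in> carrier M"
  shows "x \<in> carrier M" "x \<otimes> y \<in> r <#> carrier M" "y \<otimes> x \<in> r <#> carrier M"
proof -
  obtain e m where em: "e \<in> r" "m \<in> carrier M" "x = e \<otimes> m"
    using assms(2) by (auto simp: set_mult_def)
  have e: "e \<in> carrier M" using em assms(1) by blast
  show x: "x \<in> carrier M" using em e by simp
  have "x \<otimes> y = e \<otimes> (m \<otimes> y)" using em e assms(3) by (simp add: m_assoc)
  moreover have "m \<otimes> y \<in> carrier M" using em assms(3) by simp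
  ultimately show "x \<otimes> y \<in> r <#> carrier M" using em(1) unfolding set_mult_def by blast
  then show "y \<otimes> x \<in> r <#> carrier M" using m_comm[OF x assms(3)] by simp
qed

text \<open>The right-hand side is itself a congruence with the properties defining \<open>adm_rel\<close>.\<close>

lemma adm_relD:
  assumes r: "r \<in> Adm M" and ab: "(a, b) \<in> adm_rel M r"
  shows "\<exists>e\<in>carrier (idem_binoid M) - r. e \<otimes> a = e \<otimes> b \<or>
    (e \<otimes> a \<in> r <#> carrier M \<and> e \<otimes> b \<in> r <#> carrier M)"
proof -
  let ?I = "r <#> carrier M" and ?C = "carrier (idem_binoid M) - r"
  note absorb = set_mult_carrier_absorb[OF adm_subset[OF r]]
  \<comment> \<open>Equality after multiplication by an idempotent that is to become
    \<open>\<one>\<close>, up to elements that are to become zero.\<close>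
  define Q where "Q e a b \<longleftrightarrow> e \<otimes> a = e \<otimes> b \<or> (e \<otimes> a \<in> ?I \<and> e \<otimes> b \<in> ?I)" for e a b
  define R where "R = {(a, b). a \<in> carrier M \<and> b \<in> carrier M \<and> (\<exists>e\<in>?C. Q e a b)}"
  have C: "e \<in> carrier M" "e \<otimes> e = e" "e \<notin> r" if "e \<in> ?C" for e
    using that by (auto simp: idem_binoid_def)
  have C1: "\<one> \<in> ?C" using AdmD(3)[OF r] by (simp add: idem_binoid_def)
  \<comment> \<open>Primality of \<open>r\<close> closes its complement under products, so that
    witnesses for two pairs combine into one.\<close>
  have Cm: "e \<otimes> d \<in> ?C" if "e \<in> ?C" "d \<in> ?C" for e d
  proof -
    have "(e \<otimes> d) \<otimes> (e \<otimes> d) = (e \<otimes> e) \<otimes> (d \<otimes> d)"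
      using C(1)[OF that(1)] C(1)[OF that(2)] by (simp add: m_ac)
    then have "(e \<otimes> d) \<otimes> (e \<otimes> d) = e \<otimes> d" using C[OF that(1)] C[OF that(2)] by simp
    then show ?thesis
      using AdmD(4)[OF r] C[OF that(1)] C[OF that(2)] by (auto simp: idem_binoid_def)
  qed
  have Qr: "Q (e \<otimes> d) a b" if "Q e a b" "e \<in> carrier M" "d \<in> carrier M" "a \<in> carrier M" "b \<in> carrier M" for e d a b
  proof -
    have "(e \<otimes> d) \<otimes> a = d \<otimes> (e \<otimes> a)" "(e \<otimes> d) \<otimes> b = d \<otimes> (e \<otimes> b)"
      using that(2-5) by (simp_all add: m_ac)
    then show ?thesis using that(1) absorb(3)[OF _ that(3)] by (auto simp: Q_def)
  qed
  have Ql: "Q (d \<otimes> e) a b" if "Q e a b" "e \<in> carrier M" "d \<in> carrier M" "a \<in> carrier M" "b \<in> carrier M" for e d a b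
    using Qr[OF that] that by (simp add: m_comm)
  have common: "\<exists>e\<in>?C. Q e a b \<and> Q e c d" if R: "(a, b) \<in> R" "(c, d) \<in> R" for a b c d
  proof -
    obtain e where "e \<in> ?C" "Q e a b" using R(1) unfolding R_def by blast
    moreover obtain e' where "e' \<in> ?C" "Q e' c d" using R(2) unfolding R_def by blast
    ultimately have e: "e \<in> ?C" "Q e a b" "e' \<in> ?C" "Q e' c d" by blast+
    have "Q (e \<otimes> e') a b" using Qr[OF e(2)] C(1)[OF e(1)] C(1)[OF e(3)] that by (simp add: R_def)
    moreover have "Q (e \<otimes> e') c d" using Ql[OF e(4)] C(1)[OF e(1)] C(1)[OF e(3)] that by (simp add: R_def)
    ultimately show ?thesis using Cm[OF e(1,3)] by blast
  qed
  have "equiv (carrier M) R"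
  proof (rule equivI)
    show "R \<subseteq> carrier M \<times> carrier M" by (auto simp: R_def)
    show "refl_on (carrier M) R" using C1 by (auto simp: refl_on_def R_def Q_def)
    have "Q e b a" if "Q e a b" for e a b using that by (auto simp: Q_def)
    then show "sym R" unfolding sym_def R_def by blast
    show "trans R"
    proof (rule transI)
      fix x y z assume *: "(x, y) \<in> R" "(y, z) \<in> R"
      from common[OF *] obtain e where "e \<in> ?C" "Q e x y" "Q e y z" by blast
      moreover from this have "Q e x z" by (auto simp: Q_def)
      ultimately show "(x, z) \<in> R" using * by (auto simp: R_def)
    qed
  qed
  moreover have "(a \<otimes> c, b \<otimes> d) \<in> R" if *: "(a, b) \<in> R" "(c, d) \<in> R" for a b c d
  proof -
    from common[OF *] obtain e where e: "e \<in> ?C" "Q e a b" "Q e c d" by blast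
    have cl: "a \<in> carrier M" "b \<in> carrier M" "c \<in> carrier M" "d \<in> carrier M"
      using * by (auto simp: R_def)
    \<comment> \<open>Idempotence of \<open>e\<close> lets one witness act on both factors of a
      product.\<close>
    have sq: "e \<otimes> (x \<otimes> y) = (e \<otimes> x) \<otimes> (e \<otimes> y)" if "x \<in> carrier M" "y \<in> carrier M" for x y
    proof -
      have "(e \<otimes> x) \<otimes> (e \<otimes> y) = (e \<otimes> e) \<otimes> (x \<otimes> y)" using that C(1)[OF e(1)] by (simp add: m_ac)
      then show ?thesis using C(2)[OF e(1)] by simp
    qed
    have "Q e (a \<otimes> c) (b \<otimes> d)"
      using e(2,3) cl C(1)[OF e(1)] absorb(2)[of _ "e \<otimes> c"] absorb(2)[of _ "e \<otimes> d"]
        absorb(3)[of _ "e \<otimes> a"] absorb(3)[of _ "e \<otimes> b"]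
      unfolding Q_def sq[OF cl(1,3)] sq[OF cl(2,4)] by auto
    then show ?thesis using e(1) cl by (auto simp: R_def)
  qed
  ultimately have "binoid_congruence M R" unfolding binoid_congruence_def by blast
  moreover have "(x, bzero M) \<in> R" if "x \<in> ?I" for x
  proof -
    have "bzero M \<otimes> \<one> \<in> ?I" using AdmD(2)[OF r] unfolding set_mult_def by blast
    then have "Q \<one> x (bzero M)" using that absorb(1)[OF that one_closed] by (simp add: Q_def)
    then show ?thesis using C1 absorb(1)[OF that one_closed] by (auto simp: R_def)
  qed
  moreover have "(e, \<one>) \<in> R" if "e \<in> ?C" for e
  proof -
    have "Q e e \<one>" using C[OF that] by (simp add: Q_def)
    then show ?thesis using C(1)[OF that] that unfolding R_def by blast
  qed
  ultimately have "adm_rel M r \<subseteq> R" unfolding adm_rel_def by (intro Inter_lower) blast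
  then show ?thesis using ab by (auto simp: R_def Q_def)
qed

lemma adm_proj_eq_iff:
  assumes "r \<in> Adm M" "a \<in> carrier M" "b \<in> carrier M"
  shows "adm_proj M r a = adm_proj M r b \<longleftrightarrow> (a, b) \<in> adm_rel M r"
proof -
  have "equiv (carrier M) (adm_rel M r)"
    using adm_rel_congruence[OF assms(1)] by (simp add: binoid_congruence_def)
  then show ?thesis unfolding adm_proj_def using assms(2,3) by (rule eq_equiv_class_iff)
qed

lemma carrier_adm_quot: "carrier (adm_quot M r) = adm_proj M r ` carrier M"
  unfolding adm_quot_def binoid_quotient_def adm_proj_def quotient_def by auto

lemma adm_proj_zero:
  assumes r: "r \<in> Adm M" and "x \<in> r <#> carrier M"
  shows "adm_proj M r x = bzero (adm_quot M r)"
proof -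
  have "(x, bzero M) \<in> adm_rel M r" using assms(2) unfolding adm_rel_def by blast
  then have "adm_proj M r x = adm_proj M r (bzero M)"
    using adm_proj_eq_iff[OF r _ bzero_closed] set_mult_carrier_absorb(1)[OF adm_subset[OF r] assms(2) one_closed]
    by blast
  then show ?thesis by (simp add: binoid_homD(4)[OF adm_proj_hom[OF r]])
qed

lemma adm_proj_one:
  assumes r: "r \<in> Adm M" and "e \<in> carrier (idem_binoid M) - r"
  shows "adm_proj M r e = \<one>\<^bsub>adm_quot M r\<^esub>"
proof -
  have "(e, \<one>) \<in> adm_rel M r" using assms(2) unfolding adm_rel_def by blast
  moreover have "e \<in> carrier M" using assms(2) by (simp add: idem_binoid_def)
  ultimately have "adm_proj M r e = adm_proj M r \<one>" using adm_proj_eq_iff[OF r _ one_closed] by blast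
  then show ?thesis by (simp add: binoid_homD(3)[OF adm_proj_hom[OF r]])
qed

lemma in_set_mult_carrier: "e \<in> r \<Longrightarrow> r \<subseteq> carrier M \<Longrightarrow> e \<in> r <#> carrier M"
  unfolding set_mult_def using r_one by fastforce

text \<open>A nonzero idempotent class is represented by an idempotent of \<open>M\<close>:
  multiplying a representative \<open>e\<close> by the witness \<open>d\<close> from
  \<open>adm_relD\<close> does not change its class and makes \<open>d \<otimes> e\<close>
  idempotent. Idempotents of \<open>M\<close> become zero or one according to whether they lie in
  \<open>r\<close>.\<close>

lemma adm_quot_idempotent:
  assumes r: "r \<in> Adm M" and X: "X \<in> carrier (adm_quot M r)" "X \<otimes>\<^bsub>adm_quot M r\<^esub> X = X"
  shows "X = bzero (adm_quot M r) \<or> X = \<one>\<^bsub>adm_quot M r\<^esub>"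
proof -
  let ?p = "adm_proj M r"
  interpret Q: comm_binoid "adm_quot M r" by (rule comm_binoid_adm_quot[OF r])
  note hom = binoid_homD[OF adm_proj_hom[OF r]]
  obtain e where e: "e \<in> carrier M" "X = ?p e" using X(1) by (auto simp: carrier_adm_quot)
  have "?p (e \<otimes> e) = ?p e" using X(2) e hom(2) by simp
  then have "(e \<otimes> e, e) \<in> adm_rel M r" using adm_proj_eq_iff[OF r] e(1) by simp
  from adm_relD[OF r this] obtain d where d: "d \<in> carrier (idem_binoid M) - r"
    "d \<otimes> (e \<otimes> e) = d \<otimes> e \<or> d \<otimes> e \<in> r <#> carrier M" by blast
  have dM: "d \<in> carrier M" "d \<otimes> d = d" using d(1) by (auto simp: idem_binoid_def)
  have Xd: "X = ?p (d \<otimes> e)"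
    using hom(2)[OF dM(1) e(1)] adm_proj_one[OF r d(1)] hom(1)[OF e(1)] e(2) by simp
  from d(2) show ?thesis
  proof
    assume "d \<otimes> e \<in> r <#> carrier M"
    then show ?thesis using adm_proj_zero[OF r] Xd by simp
  next
    assume *: "d \<otimes> (e \<otimes> e) = d \<otimes> e"
    have "(d \<otimes> e) \<otimes> (d \<otimes> e) = (d \<otimes> d) \<otimes> (e \<otimes> e)" using dM(1) e(1) by (simp add: m_ac)
    then have idem: "d \<otimes> e \<in> carrier (idem_binoid M)" using * dM e(1) by (simp add: idem_binoid_def)
    show ?thesis
    proof (cases "d \<otimes> e \<in> r")
      case True
      then show ?thesis using adm_proj_zero[OF r in_set_mult_carrier[OF True adm_subset[OF r]]] Xd by simp
    next
      case False
      then show ?thesis using adm_proj_one[OF r] idem Xd by simp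
    qed
  qed
qed

end

section \<open>Points of the quotients as points with prescribed vanishing idempotents\<close>

definition vanishing_idem :: "'a binoid \<Rightarrow> ('a \<Rightarrow> 'k::field) \<Rightarrow> 'a set" where
  "vanishing_idem M f = {e \<in> carrier (idem_binoid M). f e = 0}"

text \<open>The map induced by \<open>f\<close> on the quotient. The choice of representatives is
  harmless when \<open>r\<close> is the set of idempotents at which \<open>f\<close> vanishes, for
  then \<open>f\<close> is constant on classes.\<close>

definition adm_factor :: "'a binoid \<Rightarrow> 'a set \<Rightarrow> ('a \<Rightarrow> 'k::field) \<Rightarrow> 'a set \<Rightarrow> 'k" where
  "adm_factor M r f = restrict (\<lambda>X. f (SOME x. x \<in> X)) (carrier (adm_quot M r))"

context comm_binoid begin

lemma KSpec_idempotent: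
  assumes f: "f \<in> KSpec M" and e: "e \<in> carrier (idem_binoid M)"
  shows "f e = 0 \<or> f e = 1"
proof -
  have "e \<in> carrier M" "e \<otimes> e = e" using e by (auto simp: idem_binoid_def)
  then have "f e * f e = f e" using KSpecD(1)[OF f, of e e] by simp
  then show ?thesis by simp
qed

text \<open>A field has no zero divisors, which makes the zeros of \<open>f\<close> prime; they are
  proper because \<open>f \<one> = 1\<close>.\<close>

lemma vanishing_idem_Adm:
  assumes f: "f \<in> KSpec M"
  shows "vanishing_idem M f \<in> Adm M"
proof -
  let ?E = "idem_binoid M" and ?r = "vanishing_idem M f"
  have E: "\<one> \<in> carrier ?E" "bzero M \<in> carrier ?E" by (simp_all add: idem_binoid_def)
  have mult: "x \<otimes> y \<in> carrier ?E" if "x \<in> carrier ?E" "y \<in> carrier ?E" for x y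
  proof -
    have xy: "x \<in> carrier M" "y \<in> carrier M" "x \<otimes> x = x" "y \<otimes> y = y"
      using that by (simp_all add: idem_binoid_def)
    have "(x \<otimes> y) \<otimes> (x \<otimes> y) = (x \<otimes> x) \<otimes> (y \<otimes> y)" using xy(1,2) by (simp add: m_ac)
    then show ?thesis using xy by (simp add: idem_binoid_def)
  qed
  have fm: "f (x \<otimes> y) = f x * f y" if "x \<in> carrier ?E" "y \<in> carrier ?E" for x y
    using that by (simp add: idem_binoid_def KSpecD[OF f])
  have simps: "x \<otimes>\<^bsub>?E\<^esub> y = x \<otimes> y" "bzero ?E = bzero M" for x y
    by (simp_all add: idem_binoid_def)
  have "binoid_ideal ?E ?r"
    using mult fm E by (auto simp: binoid_ideal_def set_mult_def simps vanishing_idem_def KSpecD[OF f])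
  moreover have "\<one> \<notin> ?r" by (simp add: vanishing_idem_def KSpecD[OF f])
  then have "?r \<noteq> carrier ?E" using E(1) by blast
  ultimately show ?thesis
    using fm by (auto simp: Adm_def binoid_prime_def simps vanishing_idem_def)
qed

text \<open>The kernel congruence of \<open>f\<close> contains the pairs generating
  \<open>adm_rel\<close>, since \<open>f\<close> has value \<open>1\<close> at every idempotent
  where it does not vanish.\<close>

lemma KSpec_adm_rel:
  assumes f: "f \<in> KSpec M" and "r = vanishing_idem M f" and ab: "(a, b) \<in> adm_rel M r"
  shows "f a = f b"
proof -
  define R where "R = {(a, b). a \<in> carrier M \<and> b \<in> carrier M \<and> f a = f b}"
  have "binoid_congruence M R"
    unfolding binoid_congruence_def
    by (auto simp: R_def KSpecD[OF f] intro!: equivI refl_onI symI transI)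
  moreover have "(x, bzero M) \<in> R" if x: "x \<in> r <#> carrier M" for x
  proof -
    obtain e m where em: "e \<in> r" "m \<in> carrier M" "x = e \<otimes> m" using x by (auto simp: set_mult_def)
    then have "e \<in> carrier M" "f e = 0" by (auto simp: assms(2) vanishing_idem_def idem_binoid_def)
    then show ?thesis using em by (simp add: R_def KSpecD[OF f])
  qed
  moreover have "(e, \<one>) \<in> R" if "e \<in> carrier (idem_binoid M) - r" for e
  proof -
    have "f e = 1" using KSpec_idempotent[OF f, of e] that by (auto simp: assms(2) vanishing_idem_def)
    then show ?thesis using that by (simp add: R_def KSpecD[OF f] idem_binoid_def)
  qed
  ultimately have "adm_rel M r \<subseteq> R" unfolding adm_rel_def by (intro Inter_lower) blast
  then show ?thesis using ab by (auto simp: R_def)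
qed

lemma adm_factor_proj:
  assumes f: "f \<in> KSpec M" and r: "r = vanishing_idem M f" and x: "x \<in> carrier M"
  shows "adm_factor M r f (adm_proj M r x) = f x"
proof -
  have "r \<in> Adm M" using vanishing_idem_Adm[OF f] r by simp
  then have "equiv (carrier M) (adm_rel M r)"
    using adm_rel_congruence by (simp add: binoid_congruence_def)
  then have "x \<in> adm_proj M r x" unfolding adm_proj_def using x by (rule equiv_class_self)
  then have "(SOME y. y \<in> adm_proj M r x) \<in> adm_proj M r x" by (rule someI)
  then have "f x = f (SOME y. y \<in> adm_proj M r x)"
    by (intro KSpec_adm_rel[OF f r]) (simp add: adm_proj_def)
  then show ?thesis using x by (simp add: adm_factor_def carrier_adm_quot)
qed

lemma adm_factor_in_KSpec:
  assumes f: "f \<in> KSpec M" and r: "r = vanishing_idem M f"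
  shows "adm_factor M r f \<in> KSpec (adm_quot M r)"
proof (rule KSpecI)
  have rA: "r \<in> Adm M" using vanishing_idem_Adm[OF f] r by simp
  note hom = binoid_homD[OF adm_proj_hom[OF rA]] and proj = adm_factor_proj[OF f r]
  show "adm_factor M r f (X \<otimes>\<^bsub>adm_quot M r\<^esub> Y) = adm_factor M r f X * adm_factor M r f Y"
    if XY: "X \<in> carrier (adm_quot M r)" "Y \<in> carrier (adm_quot M r)" for X Y
  proof -
    obtain x y where xy: "X = adm_proj M r x" "Y = adm_proj M r y" "x \<in> carrier M" "y \<in> carrier M"
      using XY unfolding carrier_adm_quot by blast
    then show ?thesis by (simp add: hom(2)[symmetric] proj KSpecD[OF f])
  qed
  show "adm_factor M r f \<one>\<^bsub>adm_quot M r\<^esub> = 1" "adm_factor M r f (bzero (adm_quot M r)) = 0"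
    unfolding hom(3,4)[symmetric] by (simp_all add: proj KSpecD[OF f])
  show "adm_factor M r f \<in> extensional (carrier (adm_quot M r))" by (simp add: adm_factor_def)
qed

lemma KSpec_pullback_adm_factor:
  assumes f: "f \<in> KSpec M" and r: "r = vanishing_idem M f"
  shows "KSpec_pullback M (adm_proj M r) (adm_factor M r f) = f"
proof (rule extensionalityI)
  show "KSpec_pullback M (adm_proj M r) (adm_factor M r f) x = f x" if "x \<in> carrier M" for x
    using that by (simp add: KSpec_pullback_apply adm_factor_proj[OF f r])
qed (use f in \<open>simp_all add: KSpec_def KSpec_pullback_def\<close>)

lemma vanishing_idem_pullback:
  assumes r: "r \<in> Adm M" and f: "f \<in> KSpec (adm_quot M r)"
  shows "vanishing_idem M (KSpec_pullback M (adm_proj M r) f) = r"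
proof -
  have E: "e \<in> carrier M" if "e \<in> carrier (idem_binoid M)" for e
    using that by (simp add: idem_binoid_def)
  have "f (adm_proj M r e) = 0 \<longleftrightarrow> e \<in> r" if "e \<in> carrier (idem_binoid M)" for e
  proof (cases "e \<in> r")
    case True
    then show ?thesis
      using adm_proj_zero[OF r in_set_mult_carrier[OF True adm_subset[OF r]]] by (simp add: KSpecD[OF f])
  next
    case False
    then show ?thesis using adm_proj_one[OF r, of e] that by (simp add: KSpecD[OF f])
  qed
  moreover have "r \<subseteq> carrier (idem_binoid M)" using AdmD(1)[OF r] by (auto simp: idem_binoid_def)
  ultimately show ?thesis by (auto simp: vanishing_idem_def KSpec_pullback_apply E)
qed

lemma adm_factor_pullback:
  assumes r: "r \<in> Adm M" and f: "f \<in> KSpec (adm_quot M r)"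
  shows "adm_factor M r (KSpec_pullback M (adm_proj M r) f) = f"
proof (rule extensionalityI)
  let ?g = "KSpec_pullback M (adm_proj M r) f"
  have g: "?g \<in> KSpec M" by (rule KSpec_pullback_in_KSpec[OF adm_proj_hom[OF r] f])
  show "adm_factor M r ?g X = f X" if X: "X \<in> carrier (adm_quot M r)" for X
  proof -
    obtain x where "X = adm_proj M r x" "x \<in> carrier M" using X unfolding carrier_adm_quot by blast
    then show ?thesis
      by (simp add: adm_factor_proj[OF g vanishing_idem_pullback[OF r f, symmetric]] KSpec_pullback_apply)
  qed
qed (use f in \<open>simp_all add: KSpec_def adm_factor_def\<close>)

end

text \<open>On idempotents a point takes only the values \<open>0\<close> and \<open>1\<close>, so
  vanishing is the open condition \<open>f e \<noteq> 1\<close> and not vanishing the open condition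
  \<open>f e \<noteq> 0\<close>. Finitely many of them are intersected.\<close>

lemma (in generated_binoid) openin_vanishing_idem:
  "openin (KSpec_topology M :: ('a \<Rightarrow> 'k::real_normed_field) topology) {f \<in> KSpec M. vanishing_idem M f = r}"
proof (cases "r \<subseteq> carrier (idem_binoid M)")
  case False
  then have "{f \<in> KSpec M. vanishing_idem M f = r} = ({} :: ('a \<Rightarrow> 'k) set)"
    by (auto simp: vanishing_idem_def)
  then show ?thesis by (simp only: openin_empty)
next
  case True
  let ?X = "KSpec_topology M :: ('a \<Rightarrow> 'k) topology" and ?E = "carrier (idem_binoid M)"
  define S where "S e = (if e \<in> r then - {1} else - {0 :: 'k})" for e
  have S: "f e \<in> S e \<longleftrightarrow> (f e = 0 \<longleftrightarrow> e \<in> r)" if "f \<in> KSpec M" "e \<in> ?E" for f e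
    using KSpec_idempotent[OF that] by (auto simp: S_def)
  have "openin ?X {f \<in> topspace ?X. f e \<in> S e}" if "e \<in> ?E" for e
  proof (rule openin_continuous_map_preimage)
    have "e \<in> carrier M" using that by (simp add: idem_binoid_def)
    then show "continuous_map ?X euclidean (\<lambda>f. f e)"
      unfolding KSpec_topology_eq[OF es] by (rule continuous_map_KSpec_eval[OF es])
  qed (simp add: S_def open_Compl)
  then have "openin ?X ((\<Inter>e\<in>?E. {f \<in> topspace ?X. f e \<in> S e}) \<inter> topspace ?X)"
    by (rule openin_INT[OF finite_idempotents])
  moreover have "(\<Inter>e\<in>?E. {f \<in> topspace ?X. f e \<in> S e}) \<inter> topspace ?X = {f \<in> KSpec M. vanishing_idem M f = r}"
    using True S by (auto simp: vanishing_idem_def)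
  ultimately show ?thesis by simp
qed

text \<open>The summand of a point is read off from its vanishing idempotents. Continuity of the
  inverse is checked on the open sets where these are constant; there the coordinates of the
  factored point are evaluations at representatives of the generators.\<close>

lemma (in generated_binoid) homeomorphic_map_adm_decomposition:
  "homeomorphic_map (sum_topology (\<lambda>r. KSpec_topology (adm_quot M r)) (Adm M))
     (KSpec_topology M :: ('a \<Rightarrow> 'k::real_normed_field) topology)
     (\<lambda>(r, f). KSpec_pullback M (adm_proj M r) f)"
proof -
  let ?X = "KSpec_topology M :: ('a \<Rightarrow> 'k) topology"
  let ?Y = "sum_topology (\<lambda>r. KSpec_topology (adm_quot M r) :: ('a set \<Rightarrow> 'k) topology) (Adm M)"
  let ?\<Psi> = "\<lambda>(r, f). KSpec_pullback M (adm_proj M r) f :: 'a \<Rightarrow> 'k"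
  define \<Theta> :: "('a \<Rightarrow> 'k) \<Rightarrow> 'a set \<times> ('a set \<Rightarrow> 'k)"
    where "\<Theta> f = (vanishing_idem M f, adm_factor M (vanishing_idem M f) f)" for f
  have fg: "fg_binoid M" using es by (auto simp: fg_binoid_def)
  have cont\<Psi>: "continuous_map ?Y ?X ?\<Psi>"
  proof (rule continuous_map_from_sum)
    fix r assume r: "r \<in> Adm M"
    show "continuous_map (KSpec_topology (adm_quot M r)) ?X (\<lambda>f. ?\<Psi> (r, f))"
      using continuous_map_KSpec_pullback[OF adm_proj_hom[OF r] fg fg_adm_quot[OF r fg]] by simp
  qed
  have cont\<Theta>: "continuous_map ?X ?Y \<Theta>"
  proof (rule pasting_lemma[where I = "Adm M" and T = "\<lambda>r. {f \<in> KSpec M. vanishing_idem M f = r}"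
        and f = "\<lambda>r f. (r, adm_factor M r f)"])
    fix r assume r: "r \<in> Adm M"
    let ?T = "{f \<in> KSpec M. vanishing_idem M f = r} :: ('a \<Rightarrow> 'k) set"
    show "openin ?X ?T" by (rule openin_vanishing_idem)
    obtain fs where fs: "binoid_generators (adm_quot M r) fs"
      using fg_adm_quot[OF r fg] by (auto simp: fg_binoid_def)
    have "continuous_map (subtopology ?X ?T) (KSpec_topology_wrt (adm_quot M r) fs) (adm_factor M r)"
    proof (rule continuous_map_into_KSpec)
      show "adm_factor M r f \<in> KSpec (adm_quot M r)" if "f \<in> topspace (subtopology ?X ?T)" for f
        using that by (auto intro: adm_factor_in_KSpec)
      fix i assume "i < length fs"
      then have "fs ! i \<in> carrier (adm_quot M r)" using fs by (auto simp: binoid_generators_def)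
      then obtain x where x: "x \<in> carrier M" "fs ! i = adm_proj M r x" unfolding carrier_adm_quot by blast
      have "continuous_map ?X euclidean (\<lambda>f. f x)"
        using continuous_map_KSpec_eval[OF es x(1)] by (simp add: KSpec_topology_eq[OF es])
      then have "continuous_map (subtopology ?X ?T) euclidean (\<lambda>f. f x)"
        by (rule continuous_map_from_subtopology)
      then show "continuous_map (subtopology ?X ?T) euclidean (\<lambda>f. adm_factor M r f (fs ! i))"
        by (rule continuous_map_eq) (use x in \<open>auto simp: adm_factor_proj\<close>)
    qed
    then have "continuous_map (subtopology ?X ?T) (KSpec_topology (adm_quot M r)) (adm_factor M r)"
      by (simp add: KSpec_topology_eq[OF fs])
    from continuous_map_compose[OF this continuous_map_component_injection[OF r,
        where X = "\<lambda>r. KSpec_topology (adm_quot M r)"]]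
    show "continuous_map (subtopology ?X ?T) ?Y (\<lambda>f. (r, adm_factor M r f))" by (simp add: o_def)
  qed (auto simp: \<Theta>_def vanishing_idem_Adm)
  have "homeomorphic_maps ?Y ?X ?\<Psi> \<Theta>"
    unfolding homeomorphic_maps_def
    using cont\<Psi> cont\<Theta>
    by (auto simp: \<Theta>_def vanishing_idem_pullback adm_factor_pullback KSpec_pullback_adm_factor)
  then show ?thesis by (auto simp: homeomorphic_map_maps)
qed

text \<open>Stated over any \<open>real_normed_field\<close>, so that the real and the complex case
  are instances: the homotopy is built from the multiplicative norm and the phases
  \<open>sgn\<close>.\<close>

lemma KSpec_homotopy_decomposition:
  fixes M :: "'a binoid"
  assumes "comm_binoid M" "fg_binoid M"
  shows "homeomorphic_map
         (sum_topology (\<lambda>r. KSpec_topology (adm_quot M r)) (Adm M))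
         (KSpec_topology M :: ('a \<Rightarrow> 'k::real_normed_field) topology)
         (\<lambda>(r, f). KSpec_pullback M (adm_proj M r) f)
     \<and> (\<exists>\<Phi>. homotopy_equivalence_map
           (sum_topology (\<lambda>r. KSpec_topology (units_binoid (adm_quot M r))) (Adm M))
           (KSpec_topology M :: ('a \<Rightarrow> 'k) topology) \<Phi>
         \<and> (\<forall>r\<in>Adm M.
               homotopy_equivalence_map
                 (KSpec_topology (units_binoid (adm_quot M r)))
                 (KSpec_topology (adm_quot M r) :: ('a set \<Rightarrow> 'k) topology)
                 (KSpec_pullback (adm_quot M r) (units_retract (adm_quot M r)))
             \<and> (\<forall>f\<in>KSpec (units_binoid (adm_quot M r)).
                   \<Phi> (r, f) = KSpec_pullback M (adm_proj M r)
                     (KSpec_pullback (adm_quot M r) (units_retract (adm_quot M r)) f))))"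
proof -
  obtain es where es: "binoid_generators M es" using assms(2) by (auto simp: fg_binoid_def)
  interpret comm_binoid M by (rule assms(1))
  interpret generated_binoid M es by unfold_locales (rule es)
  have hom: "homeomorphic_map (sum_topology (\<lambda>r. KSpec_topology (adm_quot M r)) (Adm M))
         (KSpec_topology M :: ('a \<Rightarrow> 'k) topology)
         (\<lambda>(r, f). KSpec_pullback M (adm_proj M r) f)"
    by (rule homeomorphic_map_adm_decomposition)
  have equiv: "homotopy_equivalence_map (KSpec_topology (units_binoid (adm_quot M r)))
       (KSpec_topology (adm_quot M r) :: ('a set \<Rightarrow> 'k) topology)
       (KSpec_pullback (adm_quot M r) (units_retract (adm_quot M r)))" if r: "r \<in> Adm M" for r
  proof -
    obtain fs where fs: "binoid_generators (adm_quot M r) fs"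
      using fg_adm_quot[OF r assms(2)] by (auto simp: fg_binoid_def)
    interpret Q: comm_binoid "adm_quot M r" by (rule comm_binoid_adm_quot[OF r])
    interpret Q: generated_binoid "adm_quot M r" fs by unfold_locales (rule fs)
    show ?thesis by (rule Q.homotopy_equivalence_units_retract) (rule adm_quot_idempotent[OF r])
  qed
  \<comment> \<open>The disjoint sum of the pullbacks along the retractions, followed by the
    homeomorphism of the decomposition; this form is what compatibility with the summands amounts
    to.\<close>
  let ?\<Phi> = "(\<lambda>(r, f). KSpec_pullback M (adm_proj M r) f) \<circ>
      (\<lambda>(r, f). (r, KSpec_pullback (adm_quot M r) (units_retract (adm_quot M r)) f))"
  have "homotopy_equivalence_map
      (sum_topology (\<lambda>r. KSpec_topology (units_binoid (adm_quot M r))) (Adm M))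
      (KSpec_topology M :: ('a \<Rightarrow> 'k) topology) ?\<Phi>"
    by (rule homotopy_equivalence_map_homeomorphic[OF homotopy_equivalence_map_sum hom]) (rule equiv)
  with hom equiv show ?thesis by (intro conjI exI[of _ ?\<Phi>]) auto
qed

theorem theorem2p6p1:
  fixes M :: "'a binoid"
  assumes "comm_binoid M" and "fg_binoid M"
  shows
    "(homeomorphic_map
         (sum_topology (\<lambda>r. KSpec_topology (adm_quot M r)) (Adm M))
         (KSpec_topology M :: ('a \<Rightarrow> real) topology)
         (\<lambda>(r, f). KSpec_pullback M (adm_proj M r) f)
     \<and> (\<exists>\<Phi>. homotopy_equivalence_map
           (sum_topology (\<lambda>r. KSpec_topology (units_binoid (adm_quot M r))) (Adm M))
           (KSpec_topology M :: ('a \<Rightarrow> real) topology) \<Phi>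
         \<and> (\<forall>r\<in>Adm M.
               homotopy_equivalence_map
                 (KSpec_topology (units_binoid (adm_quot M r)))
                 (KSpec_topology (adm_quot M r) :: ('a set \<Rightarrow> real) topology)
                 (KSpec_pullback (adm_quot M r) (units_retract (adm_quot M r)))
             \<and> (\<forall>f\<in>KSpec (units_binoid (adm_quot M r)).
                   \<Phi> (r, f) = KSpec_pullback M (adm_proj M r)
                     (KSpec_pullback (adm_quot M r) (units_retract (adm_quot M r)) f)))))
   \<and> (homeomorphic_map
         (sum_topology (\<lambda>r. KSpec_topology (adm_quot M r)) (Adm M))
         (KSpec_topology M :: ('a \<Rightarrow> complex) topology)
         (\<lambda>(r, f). KSpec_pullback M (adm_proj M r) f)
     \<and> (\<exists>\<Phi>. homotopy_equivalence_map
           (sum_topology (\<lambda>r. KSpec_topology (units_binoid (adm_quot M r))) (Adm M))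
           (KSpec_topology M :: ('a \<Rightarrow> complex) topology) \<Phi>
         \<and> (\<forall>r\<in>Adm M.
               homotopy_equivalence_map
                 (KSpec_topology (units_binoid (adm_quot M r)))
                 (KSpec_topology (adm_quot M r) :: ('a set \<Rightarrow> complex) topology)
                 (KSpec_pullback (adm_quot M r) (units_retract (adm_quot M r)))
             \<and> (\<forall>f\<in>KSpec (units_binoid (adm_quot M r)).
                   \<Phi> (r, f) = KSpec_pullback M (adm_proj M r)
                     (KSpec_pullback (adm_quot M r) (units_retract (adm_quot M r)) f)))))"
  by (rule conjI) (rule KSpec_homotopy_decomposition[OF assms])+

end
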